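(* For each pair $(g,\ell)$ of integers with $g\ge0$, $\ell\ge1$ and $(g,\ell)\notin\{(0,1),(0,2)\}$, there is a polynomial $\vec{P}_{g,\ell}$ in $\ell$ variables (with rational coefficients) such that, for all partitions $\alpha=(\alpha_1,\dots,\alpha_\ell)\vdash d$, $d\ge1$, with $\ell$ parts, $$\vec{H}_g(\alpha)=\frac{d!}{|\operatorname{Aut}\alpha|}\,\vec{P}_{g,\ell}(\alpha_1,\dots,\alpha_\ell)\prod_{j=1}^{\ell}\binom{2\alpha_j}{\alpha_j}.$$
   Context: Monotone single Hurwitz numbers: for $g\ge 0$, $d\ge1$ and a partition $\alpha\vdash d$ with $\ell(\alpha)$ parts, $\vec{H}_g(\alpha)$ is the number of tuples $(\rho,\sigma,\tau_1,\dots,\tau_r)$ of permutations in the symmetric group $S_d$ such that: (1) $\rho$ has cycle type $\alpha$, $\sigma$ has cycle type $(1^d)$ (so $\sigma$ is the identity), and the $\tau_i$ are transpositions; (2) the product $\rho\sigma\tau_1\cdots\tau_r$ is the identity; (3) the subgroup $\langle\rho,\sigma,\tau_1,\dots,\tau_r\rangle\subseteq S_d$ is transitive on $\{1,\dots,d\}$; (4) $r=2g-2+\ell(\alpha)+d$; (5) writing $\tau_i=(a_i\,b_i)$ with $a_i<b_i$, one has $b_1\le\cdots\le b_r$. Notation: $|\operatorname{Aut}\alpha|=\prod_{i\ge1}m_i!$, where $m_i$ is the number of parts of $\alpha$ equal to $i$. *)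

theory Defs
  imports
    Complex_Main
    "HOL-Algebra.Sym_Groups"
    "HOL-Combinatorics.Orbits"
    "HOL-Library.Multiset"
    "HOL-Library.Poly_Mapping"
begin

definition partition_of :: "nat list \<Rightarrow> nat \<Rightarrow> bool" where
  "partition_of \<alpha> d \<longleftrightarrow> sorted_wrt (\<ge>) \<alpha> \<and> (\<forall>a\<in>set \<alpha>. a \<ge> 1) \<and> sum_list \<alpha> = d"

text \<open>Parts \<open>i\<close> that do not occur would contribute a factor \<open>0! = 1\<close>.\<close>

definition aut_order :: "nat list \<Rightarrow> nat" where
  "aut_order \<alpha> = (\<Prod>i\<in>set \<alpha>. fact (count_list \<alpha> i))"

text \<open>The cycles are the orbits; fixed points give orbits of size \<open>1\<close>. The orbits are
  collected in a set first, so that each cycle is counted once.\<close>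

definition cycle_type_on :: "nat \<Rightarrow> (nat \<Rightarrow> nat) \<Rightarrow> nat multiset" where
  "cycle_type_on d \<pi> = image_mset card (mset_set (orbit \<pi> ` {1..d}))"

definition transitive_on :: "nat \<Rightarrow> (nat \<Rightarrow> nat) set \<Rightarrow> bool" where
  "transitive_on d H \<longleftrightarrow> (\<forall>x\<in>{1..d}. \<forall>y\<in>{1..d}. \<exists>h\<in>H. h x = y)"

text \<open>A list of transpositions \<open>(a\<^sub>i b\<^sub>i)\<close>, \<open>a\<^sub>i < b\<^sub>i\<close>, of \<open>{1..d}\<close> with \<open>b\<^sub>1 \<le> \<dots> \<le> b\<^sub>r\<close>.\<close>

definition monotone_transpositions :: "nat \<Rightarrow> (nat \<Rightarrow> nat) list \<Rightarrow> bool" where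
  "monotone_transpositions d \<tau>s \<longleftrightarrow>
     (\<exists>ps. \<tau>s = map (\<lambda>(a, b). Transposition.transpose a b) ps \<and>
           (\<forall>(a, b)\<in>set ps. 1 \<le> a \<and> a < b \<and> b \<le> d) \<and>
           sorted (map snd ps))"

text \<open>The product is taken in \<open>sym_group d\<close>, whose multiplication is \<open>(\<circ>)\<close>. Since inversion
  preserves cycle types, the opposite convention for multiplying permutations yields the same
  number of tuples. The length condition is \<open>r = 2g - 2 + \<ell>(\<alpha>) + d\<close> without subtraction.\<close>

definition monotone_hurwitz_tuples ::
  "nat \<Rightarrow> nat list \<Rightarrow> ((nat \<Rightarrow> nat) \<times> (nat \<Rightarrow> nat) \<times> (nat \<Rightarrow> nat) list) set" where
  "monotone_hurwitz_tuples g \<alpha> =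
     (let d = sum_list \<alpha> in
      {(\<rho>, \<sigma>, \<tau>s).
         \<rho> permutes {1..d} \<and> cycle_type_on d \<rho> = mset \<alpha> \<and>
         \<sigma> permutes {1..d} \<and> cycle_type_on d \<sigma> = replicate_mset d 1 \<and>
         monotone_transpositions d \<tau>s \<and>
         foldr (mult (sym_group d)) (\<rho> # \<sigma> # \<tau>s) (one (sym_group d)) = one (sym_group d) \<and>
         transitive_on d (generate (sym_group d) ({\<rho>, \<sigma>} \<union> set \<tau>s)) \<and>
         length \<tau>s + 2 = 2 * g + length \<alpha> + d})"

definition monotone_hurwitz :: "nat \<Rightarrow> nat list \<Rightarrow> nat" where
  "monotone_hurwitz g \<alpha> = card (monotone_hurwitz_tuples g \<alpha>)"

text \<open>Multivariate polynomials: finitely supported maps from monomials (finitely supported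
  exponent vectors) to coefficients. Variables are numbered from \<open>0\<close>.\<close>

type_synonym 'a mpolynomial = "(nat \<Rightarrow>\<^sub>0 nat) \<Rightarrow>\<^sub>0 'a"

definition in_variables :: "nat \<Rightarrow> 'a::zero mpolynomial \<Rightarrow> bool" where
  "in_variables l P \<longleftrightarrow> (\<forall>m\<in>Poly_Mapping.keys P. Poly_Mapping.keys m \<subseteq> {..<l})"

definition eval_mpolynomial :: "'a::comm_semiring_1 mpolynomial \<Rightarrow> (nat \<Rightarrow> 'a) \<Rightarrow> 'a" where
  "eval_mpolynomial P x =
     (\<Sum>m\<in>Poly_Mapping.keys P.
        Poly_Mapping.lookup P m * (\<Prod>i\<in>Poly_Mapping.keys m. x i ^ Poly_Mapping.lookup m i))"

lemma finite_monotone_hurwitz_tuples: "finite (monotone_hurwitz_tuples g \<alpha>)"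
proof -
  define d where "d = sum_list \<alpha>"
  define S where "S = {p. p permutes {1..d}}"
  define n where "n = 2 * g + length \<alpha> + d"
  have S: "finite S" unfolding S_def by (rule finite_permutations) simp
  have "set \<tau>s \<subseteq> S" if m: "monotone_transpositions d \<tau>s" for \<tau>s
  proof -
    obtain ps where ps: "\<tau>s = map (\<lambda>(a, b). Transposition.transpose a b) ps"
      "\<And>a b. (a, b) \<in> set ps \<Longrightarrow> 1 \<le> a \<and> a < b \<and> b \<le> d"
      using m unfolding monotone_transpositions_def by fast
    show ?thesis
    proof
      fix t assume "t \<in> set \<tau>s"
      then obtain a b where "(a, b) \<in> set ps" "t = Transposition.transpose a b"
        using ps(1) by auto
      then show "t \<in> S"
        unfolding S_def using ps(2)[of a b] by (auto intro!: permutes_swap_id)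
    qed
  qed
  then have "monotone_hurwitz_tuples g \<alpha> \<subseteq> S \<times> S \<times> {xs. set xs \<subseteq> S \<and> length xs \<le> n}"
    unfolding monotone_hurwitz_tuples_def n_def d_def S_def by (auto simp: Let_def)
  moreover have "finite (S \<times> S \<times> {xs. set xs \<subseteq> S \<and> length xs \<le> n})"
    using S by (intro finite_cartesian_product finite_lists_length_le)
  ultimately show ?thesis by (rule finite_subset)
qed

end

(* The product of the transpositions of a monotone factorization is a term of a complete symmetric
   polynomial in the Jucys-Murphy elements, so the number of transitive monotone factorizations of a
   permutation depends only on its cycle type. Removing the last transposition either cuts a cycle,
   joins two cycles, or disconnects the factorization into two, which gives a recursion on the genus
   and the number of parts.

   Write c(k) = (2k choose k) and let u = (1 - 4x)^(-1/2) be the generating function of c. The genus 0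
   numbers with one part are Catalan numbers. Collecting the terms that contain them turns the
   recursion, as a function of one part k, into a convolution equation whose kernel is 1/u. By
   induction its right-hand side is 4^k times a polynomial in k, that is, even in u; multiplication
   by u makes it odd, that is, c(k) times a polynomial in k. The genus 0 numbers with two parts,
   k a c(k) c(a) / (2 (k + a)), are not of this form. They enter only combined with a join term, and
   multiplying such a combination by k + a, which acts on convolutions as a derivation, removes the
   denominators. *)

theory Submission
  imports
    Defs
    "HOL-Computational_Algebra.Formal_Power_Series"
    "HOL-Computational_Algebra.Polynomial"
begin

unbundle fps_syntax

section \<open>Central binomial coefficients\<close>

text \<open>The group algebra of the symmetric group does not see transitivity, so the classical
  fact that symmetric polynomials in the Jucys-Murphy elements are central does not by itself count
  transitive factorizations. The algebra is therefore built on a monoid whose elements remember,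
  besides a permutation, which sets no used transposition has crossed; the few relations behind the
  classical argument survive there.

  The Catalan terms come in pairs, one for each order of the two factors, and 1 - 2C = 1/u for their
  generating function C. Parity in u is the right invariant because x d/dx maps u^m to (m/2)(u^(m+2)
  - u^m): a factor k on the coefficients keeps the parity.

  A cycle type has d! / (|Aut| times the product of the parts) permutations, so the count for a
  single permutation must carry k c(k) for each part k; this stronger form goes through the
  induction. It starts at genus 0 with three parts and genus 1 with one part, where the recursion
  produces sums made of two-part numbers; these are evaluated in closed form.\<close>

abbreviation (input) cbin :: "nat \<Rightarrow> rat" where
  "cbin k \<equiv> of_nat ((2 * k) choose k)"

lemma cbin_Suc: "of_nat (Suc k) * cbin (Suc k) = (4 * of_nat k + 2) * cbin k"
proof -
  have "Suc k * (Suc k * ((2 * Suc k) choose Suc k)) = Suc k * ((4 * k + 2) * ((2 * k) choose k))"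
  proof -
    have "Suc k * ((2 * Suc k) choose Suc k) = (2 * k + 2) * (Suc (2 * k) choose k)"
      using Suc_times_binomial_eq[of "Suc (2*k)" k] by (simp add: algebra_simps)
    moreover have "Suc k * (Suc (2 * k) choose k) = Suc (2 * k) * ((2 * k) choose k)"
      using binomial_absorb_comp[of "Suc (2*k)" k] by (simp add: algebra_simps)
    ultimately have "Suc k * (Suc k * ((2 * Suc k) choose Suc k)) = (2 * k + 2) * (Suc (2 * k) * ((2 * k) choose k))"
      by (metis mult.left_commute)
    then show ?thesis by (simp add: algebra_simps)
  qed
  then have "Suc k * ((2 * Suc k) choose Suc k) = (4 * k + 2) * ((2 * k) choose k)"
    by (metis mult_cancel1 nat.distinct(1))
  then have "(of_nat (Suc k * ((2 * Suc k) choose Suc k)) :: rat) = of_nat ((4 * k + 2) * ((2 * k) choose k))"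
    by (rule arg_cong)
  then show ?thesis by (simp only: of_nat_mult of_nat_add of_nat_numeral)
qed

lemma cbin_nonzero: "cbin k \<noteq> 0"
  by simp

section \<open>The series u and its differential equation\<close>

definition uf :: "rat fps" where "uf = Abs_fps cbin"

text \<open>The Euler operator x d/dx. It multiplies the \<open>k\<close>-th coefficient by
  \<open>k\<close>, so polynomial factors in the index become a derivation on series.\<close>

definition theta :: "rat fps \<Rightarrow> rat fps" where "theta f = fps_X * fps_deriv f"

lemma theta_nth [simp]: "theta f $ k = of_nat k * f $ k"
  by (cases k) (auto simp: theta_def)

lemma theta_mult: "theta (f * g) = theta f * g + f * theta g"
  by (simp add: theta_def algebra_simps)

lemma theta_add: "theta (f + g) = theta f + theta g"
  by (simp add: theta_def algebra_simps)

lemma theta_const_mult: "theta (fps_const c * f) = fps_const c * theta f"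
  by (simp add: theta_mult) (simp add: theta_def)

abbreviation X4 :: "rat fps" where "X4 \<equiv> 1 - 4 * fps_X"

lemma numeral_mult_nth: "(numeral n * f) $ k = numeral n * (f $ k :: rat)"
  by (simp add: numeral_fps_const)

lemma X4_nth_Suc: "(X4 * f) $ Suc k = f $ Suc k - 4 * f $ k"
  by (simp add: left_diff_distrib mult.assoc numeral_mult_nth)

lemma X4_nth_0: "(X4 * f) $ 0 = f $ 0"
  by (simp add: left_diff_distrib mult.assoc numeral_mult_nth)

lemma X4_cancel: "X4 * f = X4 * g \<Longrightarrow> f = g"
proof -
  have "(X4 * 1) $ 0 \<noteq> (0 * 1 :: rat fps) $ 0" by (simp only: X4_nth_0) simp
  then have "X4 \<noteq> 0" by metis
  then show "X4 * f = X4 * g \<Longrightarrow> f = g" by (metis mult_cancel_left)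
qed

text \<open>The differential equation of (1 - 4x)^(-1/2); coefficientwise it is the two-term
  recursion \<open>cbin_Suc\<close>.\<close>

lemma theta_uf: "X4 * theta uf = 2 * fps_X * uf"
proof (rule fps_ext)
  fix n
  show "(X4 * theta uf) $ n = (2 * fps_X * uf) $ n"
  proof (cases n)
    case 0 then show ?thesis by (simp add: X4_nth_0 mult.assoc numeral_mult_nth)
  next
    case (Suc k)
    have "(X4 * theta uf) $ Suc k = of_nat (Suc k) * cbin (Suc k) - 4 * of_nat k * cbin k"
      by (simp only: X4_nth_Suc uf_def theta_nth fps_nth_Abs_fps mult.assoc)
    also have "\<dots> = 2 * cbin k" by (subst cbin_Suc) (simp add: algebra_simps)
    finally show ?thesis using Suc by (simp add: mult.assoc uf_def numeral_mult_nth)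
  qed
qed

text \<open>The equation for u yields one for u^2, and the latter forces consecutive coefficients of
  u^2 to have ratio 4.\<close>

lemma uf_sq: "X4 * uf ^ 2 = 1"
proof (rule fps_ext)
  fix n
  have "X4 * theta (uf ^ 2) = 2 * uf * (X4 * theta uf)"
    by (simp add: power2_eq_square theta_mult)
  also have "\<dots> = 4 * (fps_X * uf ^ 2)"
    unfolding theta_uf by (simp add: power2_eq_square)
  finally have d: "(X4 * theta (uf ^ 2)) $ Suc k = (4 * (fps_X * uf ^ 2)) $ Suc k" for k
    by simp
  have s: "(uf^2) $ Suc k = 4 * (uf^2) $ k" for k
  proof -
    have "of_nat (Suc k) * (uf^2) $ Suc k = of_nat (Suc k) * (4 * (uf^2) $ k)"
      using d[of k] unfolding X4_nth_Suc numeral_mult_nth theta_nth by (simp add: algebra_simps)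
    then show ?thesis by (metis mult_cancel_left of_nat_eq_0_iff nat.distinct(1))
  qed
  show "(X4 * uf ^ 2) $ n = (1 :: rat fps) $ n"
    by (cases n) (simp_all only: X4_nth_0 X4_nth_Suc s, simp_all add: uf_def power2_eq_square)
qed

text \<open>The relation 4x = 1 - u^(-2) eliminates x. Hence \<open>theta\<close> acts inside the
  polynomials in \<open>uf\<close>, raising degrees by 2 and preserving parity.\<close>

lemma theta_uf': "2 * theta uf = uf ^ 3 - uf"
proof (rule X4_cancel)
  have "X4 * (uf ^ 3 - uf) = (X4 * uf^2) * uf - X4 * uf"
    by (simp only: right_diff_distrib power3_eq_cube power2_eq_square mult.assoc)
  also have "\<dots> = 4 * fps_X * uf"
    unfolding uf_sq by (simp add: left_diff_distrib)
  also have "\<dots> = 2 * (X4 * theta uf)" unfolding theta_uf by simp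
  finally show "X4 * (2 * theta uf) = X4 * (uf ^ 3 - uf)" by (simp only: mult.left_commute)
qed

lemma theta_uf_power: "2 * theta (uf ^ m) = of_nat m * (uf ^ (m + 2) - uf ^ m)"
proof (induction m)
  case 0 then show ?case by (simp add: theta_def)
next
  case (Suc m)
  have "2 * theta (uf ^ Suc m) = (2 * theta uf) * uf ^ m + uf * (2 * theta (uf ^ m))"
    by (simp add: theta_mult distrib_left)
  also have "\<dots> = (1 + of_nat m) * (uf ^ (Suc m + 2) - uf ^ Suc m)"
    unfolding Suc theta_uf' by (simp add: algebra_simps power3_eq_cube power2_eq_square power_add)
  finally show ?case by simp
qed

text \<open>Passing from u^m to u^(m+2) costs a linear factor in the index, so powers of equal
  parity have coefficients that differ by polynomial factors only.\<close>

lemma uf_power_nth_rec: "m > 0 \<Longrightarrow> (uf ^ (m + 2)) $ k = (1 + 2 * of_nat k / of_nat m) * (uf ^ m) $ k"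
  using arg_cong[OF theta_uf_power[of m], of "\<lambda>f. f $ k"]
  by (simp only: numeral_mult_nth theta_nth fps_mult_of_nat_nth fps_sub_nth) (simp add: field_simps)

lemma uf_sq_nth: "(uf ^ 2) $ k = 4 ^ k"
proof (induction k)
  case 0 then show ?case by (simp add: uf_def power2_eq_square)
next
  case (Suc k)
  have "(X4 * uf ^ 2) $ Suc k = 0" unfolding uf_sq by simp
  then show ?case using Suc by (simp add: X4_nth_Suc)
qed

text \<open>The span of u^e, u^(e+2), and so on. Odd series are the case \<open>e = 1\<close>. Even
  series are taken with \<open>e = 2\<close> and not 0, since the coefficients of u^0 = 1 are not
  4^k times a polynomial in k.\<close>

inductive uspan :: "nat \<Rightarrow> rat fps \<Rightarrow> bool" for e where
  pow: "uspan e (uf ^ (2 * p + e))"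
| add: "uspan e f \<Longrightarrow> uspan e g \<Longrightarrow> uspan e (f + g)"
| scale: "uspan e f \<Longrightarrow> uspan e (fps_const c * f)"

lemma uspan_diff: "uspan e f \<Longrightarrow> uspan e g \<Longrightarrow> uspan e (f - g)"
  using uspan.add[of e f "fps_const (-1) * g"] uspan.scale[of e g "-1"]
  by (simp flip: fps_const_neg)

lemma uspan_theta: "uspan e f \<Longrightarrow> uspan e (theta f)"
proof (induction rule: uspan.induct)
  case (pow p)
  have "uspan e (uf ^ (2 * p + e + 2))" using uspan.pow[of e "Suc p"] by (simp add: add.commute)
  then have "uspan e (fps_const (of_nat (2 * p + e) / 2) * (uf ^ (2 * p + e + 2) - uf ^ (2 * p + e)))"
    by (intro uspan.scale uspan_diff uspan.pow)
  also have "fps_const (of_nat (2 * p + e) / 2) * (uf ^ (2 * p + e + 2) - uf ^ (2 * p + e)) = theta (uf ^ (2 * p + e))"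
  proof (rule fps_ext)
    fix k
    show "(fps_const (of_nat (2 * p + e) / 2) * (uf ^ (2 * p + e + 2) - uf ^ (2 * p + e))) $ k = theta (uf ^ (2 * p + e)) $ k"
      using arg_cong[OF theta_uf_power[of "2 * p + e"], of "\<lambda>f. f $ k"]
      by (simp only: numeral_mult_nth fps_mult_of_nat_nth fps_sub_nth fps_mult_left_const_nth)
  qed
  finally show ?case .
qed (simp_all only: theta_add theta_const_mult uspan.add uspan.scale)

lemma uspan_mult: "uspan d f \<Longrightarrow> uspan e g \<Longrightarrow> uspan (d + e) (f * g)"
proof (induction rule: uspan.induct)
  case (pow p)
  then show ?case
  proof (induction rule: uspan.induct)
    case (pow q)
    show ?case using uspan.pow[of "d + e" "p + q"] by (simp add: power_add[symmetric] algebra_simps)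
  next
    case (add f g)
    then show ?case by (metis distrib_left uspan.add)
  next
    case (scale f c)
    then show ?case by (metis mult.left_commute uspan.scale)
  qed
next
  case (add f g)
  then show ?case by (metis distrib_right uspan.add)
next
  case (scale f c)
  then show ?case by (metis mult.assoc uspan.scale)
qed

lemma uspan_nth:
  assumes "e > 0" and "uspan e f"
  shows "\<exists>h :: rat poly. \<forall>k. f $ k = (uf ^ e) $ k * poly h (of_nat k)"
  using assms(2)
proof (induction rule: uspan.induct)
  case (pow p)
  show ?case
  proof (induction p)
    case 0 show ?case by (intro exI[of _ 1]) simp
  next
    case (Suc p)
    then obtain h :: "rat poly" where h: "\<forall>k. (uf ^ (2 * p + e)) $ k = (uf ^ e) $ k * poly h (of_nat k)" by auto
    have "(uf ^ (2 * Suc p + e)) $ k = (uf ^ e) $ k * poly ([:1, 2 / of_nat (2 * p + e):] * h) (of_nat k)" for k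
      using uf_power_nth_rec[of "2 * p + e" k] assms(1) h by (simp add: algebra_simps)
    then show ?case by blast
  qed
next
  case (add f g)
  then obtain h h' :: "rat poly" where "\<forall>k. f $ k = (uf ^ e) $ k * poly h (of_nat k)"
    "\<forall>k. g $ k = (uf ^ e) $ k * poly h' (of_nat k)" by auto
  then show ?case by (intro exI[of _ "h + h'"]) (simp add: algebra_simps)
next
  case (scale f c)
  then obtain h :: "rat poly" where "\<forall>k. f $ k = (uf ^ e) $ k * poly h (of_nat k)" by auto
  then show ?case by (intro exI[of _ "smult c h"]) (simp add: algebra_simps)
qed

lemma uspan_powers:
  "uspan e (uf ^ e) \<Longrightarrow> uspan e (Abs_fps (\<lambda>k. of_nat k ^ q * (uf ^ e) $ k))"
proof (induction q)
  case 0 then show ?case by (simp add: fps_nth_inverse)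
next
  case (Suc q)
  have "Abs_fps (\<lambda>k. of_nat k ^ Suc q * (uf ^ e) $ k) = theta (Abs_fps (\<lambda>k. of_nat k ^ q * (uf ^ e) $ k))"
    by (rule fps_ext) simp
  then show ?case using Suc uspan_theta by metis
qed

lemma uspan_odd: "uspan 1 (Abs_fps (\<lambda>k. of_nat k ^ q * cbin k))"
  using uspan_powers[of 1 q] uspan.pow[of 1 0] by (simp add: uf_def)

lemma uspan_even: "uspan 2 (Abs_fps (\<lambda>k. of_nat k ^ q * 4 ^ k))"
proof -
  have "uspan 2 (uf ^ 2)" using uspan.pow[of 2 0] by (simp only: mult_0_right add_0)
  then show ?thesis using uspan_powers[of 2 q] unfolding uf_sq_nth by blast
qed

section \<open>Convolutions of odd and even coefficient sequences\<close>

lemma conv_odd_odd: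
  "\<exists>h :: rat poly. \<forall>k. (\<Sum>i=0..k. (of_nat i ^ p * cbin i) * (of_nat (k - i) ^ q * cbin (k - i))) = 4 ^ k * poly h (of_nat k)"
proof -
  let ?f = "Abs_fps (\<lambda>k. of_nat k ^ p * cbin k) * Abs_fps (\<lambda>k. of_nat k ^ q * cbin k)"
  have "uspan 2 ?f"
    using uspan_mult[OF uspan_odd[of p] uspan_odd[of q]] by (simp only: one_add_one)
  then obtain h :: "rat poly" where "\<forall>k. ?f $ k = (uf ^ 2) $ k * poly h (of_nat k)"
    using uspan_nth[of 2] by fastforce
  moreover have "?f $ k = (\<Sum>i=0..k. (of_nat i ^ p * cbin i) * (of_nat (k - i) ^ q * cbin (k - i)))" for k
    by (simp only: fps_mult_nth fps_nth_Abs_fps)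
  ultimately have "\<forall>k. (\<Sum>i=0..k. (of_nat i ^ p * cbin i) * (of_nat (k - i) ^ q * cbin (k - i))) = 4 ^ k * poly h (of_nat k)"
    by (simp only: uf_sq_nth, intro allI refl)
  then show ?thesis by (rule exI)
qed

lemma uspan_3_1: "uspan 3 f \<Longrightarrow> uspan 1 f"
proof (induction rule: uspan.induct)
  case (pow p)
  have "2 * p + 3 = 2 * Suc p + 1" by simp
  then show ?case using uspan.pow[of 1 "Suc p"] by metis
qed (auto intro: uspan.intros)

text \<open>Even times odd is odd. The sum starts at 1, so the contribution of the constant
  coefficient, a multiple of u, is subtracted; it is odd as well.\<close>

lemma conv_even_odd:
  "\<exists>h :: rat poly. \<forall>k. (\<Sum>i=1..k. (of_nat i ^ q * 4 ^ i) * cbin (k - i)) = of_nat k * cbin k * poly h (of_nat k)"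
proof -
  let ?f = "Abs_fps (\<lambda>k. of_nat k ^ q * 4 ^ k) :: rat fps"
  have "uspan 1 (?f * uf)"
    using uspan_mult[OF uspan_even[of q] uspan.pow[of 1 0]] uspan_3_1 by simp
  moreover have "uspan 1 (fps_const (?f $ 0) * uf)"
    using uspan.scale[OF uspan.pow[of 1 0]] by simp
  ultimately have "uspan 1 (?f * uf - fps_const (?f $ 0) * uf)" by (rule uspan_diff)
  then obtain h :: "rat poly" where
    h1: "\<forall>k. (?f * uf - fps_const (?f $ 0) * uf) $ k = (uf ^ 1) $ k * poly h (of_nat k)"
    using uspan_nth[OF zero_less_one] by blast
  have h: "(?f * uf) $ k - (?f $ 0) * cbin k = cbin k * poly h (of_nat k)" for k
    using h1[rule_format, of k]
    by (simp only: power_one_right uf_def fps_nth_Abs_fps fps_sub_nth fps_mult_left_const_nth)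
  have eq: "(\<Sum>i=1..k. (of_nat i ^ q * 4 ^ i) * cbin (k - i)) = cbin k * poly h (of_nat k)" for k
  proof -
    have "(?f * uf) $ k = (\<Sum>i=0..k. (of_nat i ^ q * 4 ^ i) * cbin (k - i))"
      by (simp only: fps_mult_nth uf_def fps_nth_Abs_fps)
    also have "\<dots> = (?f $ 0) * cbin k + (\<Sum>i=1..k. (of_nat i ^ q * 4 ^ i) * cbin (k - i))"
      by (subst sum.atLeast_Suc_atMost) simp_all
    finally show ?thesis using h[of k] by simp
  qed
  \<comment> \<open>The sum is empty at 0 and \<open>cbin 0 = 1\<close>, so 0 is a root; this
    produces the factor \<open>of_nat k\<close>.\<close>
  have "poly h 0 = 0" using eq[of 0] by simp
  then obtain h' where "h = [:0, 1:] * h'" using poly_eq_0_iff_dvd[of h 0] by (metis dvdE neg_0_equal_iff_equal)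
  then have "(\<Sum>i=1..k. (of_nat i ^ q * 4 ^ i) * cbin (k - i)) = of_nat k * cbin k * poly h' (of_nat k)" for k
    unfolding eq[of k] by (simp add: mult_ac)
  then show ?thesis by blast
qed

lemma conv_cbin: "(\<Sum>i=0..k. cbin i * cbin (k - i)) = 4 ^ k"
  using uf_sq_nth[of k] by (simp only: power2_eq_square fps_mult_nth uf_def fps_nth_Abs_fps)

lemma conv_cbin_1: "(\<Sum>i=0..k. of_nat i * cbin i * cbin (k - i)) = of_nat k * 4 ^ k / 2"
proof -
  have "theta (uf ^ 2) = 2 * (theta uf * uf)" by (simp add: power2_eq_square theta_mult)
  from arg_cong[OF this, of "\<lambda>f. f $ k"]
  have "of_nat k * 4 ^ k = 2 * (theta uf * uf) $ k"
    by (simp only: theta_nth uf_sq_nth numeral_mult_nth)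
  also have "(theta uf * uf) $ k = (\<Sum>i=0..k. of_nat i * cbin i * cbin (k - i))"
    by (simp only: fps_mult_nth theta_nth) (simp only: uf_def fps_nth_Abs_fps)
  finally show ?thesis by simp
qed

text \<open>The square of 2 theta u = u^3 - u is u^6 - 2u^4 + u^2, and
  \<open>uf_power_nth_rec\<close> gives the coefficients of these powers from those of u^2.\<close>

lemma conv_cbin_1_1:
  "(\<Sum>i=0..k. (of_nat i * cbin i) * (of_nat (k - i) * cbin (k - i))) = of_nat k * (of_nat k - 1) * 4 ^ k / 8"
proof -
  have "4 * (theta uf * theta uf) = (2 * theta uf) ^ 2" by (simp add: power2_eq_square)
  also have "\<dots> = uf ^ (4 + 2) - 2 * uf ^ (2 + 2) + uf ^ 2"
    unfolding theta_uf' by (simp add: power2_eq_square algebra_simps flip: power_Suc)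
  finally have "4 * (theta uf * theta uf) $ k = (uf ^ (4 + 2)) $ k - 2 * (uf ^ (2 + 2)) $ k + (uf ^ 2) $ k"
    by (metis numeral_mult_nth fps_add_nth fps_sub_nth)
  also have "(uf ^ (4 + 2)) $ k = (1 + of_nat k / 2) * (1 + of_nat k) * 4 ^ k"
    using uf_power_nth_rec[of 4 k] uf_power_nth_rec[of 2 k] by (simp add: uf_sq_nth)
  also have "(uf ^ (2 + 2)) $ k = (1 + of_nat k) * 4 ^ k"
    using uf_power_nth_rec[of 2 k] by (simp add: uf_sq_nth)
  also have "(theta uf * theta uf) $ k = (\<Sum>i=0..k. (of_nat i * cbin i) * (of_nat (k - i) * cbin (k - i)))"
    by (simp only: fps_mult_nth theta_nth) (simp only: uf_def fps_nth_Abs_fps)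
  finally show ?thesis by (simp only: uf_sq_nth) (simp add: field_simps)
qed

text \<open>The series \<open>?G\<close> solves theta G + a G = u. It follows that G u satisfies a
  first-order equation, whose coefficient recursion is that of \<open>cbin\<close> at the shifted
  index \<open>k + a\<close>.\<close>

lemma conv_cbin_shift:
  assumes "a > 0"
  shows "(\<Sum>i=0..k. of_nat a / of_nat (i + a) * cbin i * cbin (k - i)) = cbin (k + a) / cbin a"
proof -
  let ?G = "Abs_fps (\<lambda>i. cbin i / of_nat (i + a))"
  let ?S = "?G * uf"
  have G: "theta ?G + of_nat a * ?G = uf"
  proof (rule fps_ext)
    fix n
    have "of_nat n * (cbin n / of_nat (n + a)) + of_nat a * (cbin n / of_nat (n + a)) = of_nat (n + a) * (cbin n / of_nat (n + a))"
      by (simp add: distrib_right add_divide_distrib)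
    then show "(theta ?G + of_nat a * ?G) $ n = uf $ n"
      using assms by (simp add: fps_mult_of_nat_nth uf_def)
  qed
  have "X4 * (theta ?S + of_nat a * ?S) = ?G * (X4 * theta uf) + (X4 * uf) * (theta ?G + of_nat a * ?G)"
    by (simp add: theta_mult algebra_simps)
  also have "\<dots> = 2 * (fps_X * ?S) + 1"
    unfolding G theta_uf using uf_sq by (simp add: power2_eq_square mult_ac)
  finally have d: "(X4 * (theta ?S + of_nat a * ?S)) $ Suc k = (2 * (fps_X * ?S) + 1) $ Suc k" for k by simp
  have rec: "of_nat (Suc (k + a)) * ?S $ Suc k = (4 * of_nat (k + a) + 2) * ?S $ k" for k
  proof -
    have g: "of_nat (Suc (k + a)) * S $ Suc k = (4 * of_nat (k + a) + 2) * S $ k"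
      if "(X4 * (theta S + of_nat a * S)) $ Suc k = (2 * (fps_X * S) + 1) $ Suc k" for S :: "rat fps"
      using that unfolding X4_nth_Suc fps_add_nth theta_nth numeral_mult_nth fps_mult_of_nat_nth
      by (simp add: algebra_simps)
    show ?thesis by (rule g[OF d])
  qed
  have "of_nat a * ?S $ k * cbin a = cbin (k + a)"
  proof (induction k)
    case 0 then show ?case using assms by (simp add: uf_def)
  next
    case (Suc k)
    have "of_nat (Suc (k + a)) * (of_nat a * ?S $ Suc k * cbin a) = of_nat a * cbin a * (of_nat (Suc (k + a)) * ?S $ Suc k)"
      by (simp only: mult_ac)
    also have "\<dots> = (4 * of_nat (k + a) + 2) * (of_nat a * ?S $ k * cbin a)"
      unfolding rec by (simp only: mult_ac)
    also have "\<dots> = of_nat (Suc (k + a)) * cbin (Suc (k + a))" unfolding Suc cbin_Suc ..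
    finally have "of_nat a * ?S $ Suc k * cbin a = cbin (Suc (k + a))"
      by (rule mult_left_cancel[THEN iffD1, rotated]) (simp only: of_nat_eq_0_iff nat.distinct not_False_eq_True)
    then show ?case by (simp only: add_Suc)
  qed
  moreover have "of_nat a * ?S $ k = (\<Sum>i=0..k. of_nat a / of_nat (i + a) * cbin i * cbin (k - i))"
    unfolding fps_mult_nth sum_distrib_left by (rule sum.cong) (simp_all add: uf_def)
  ultimately have "(\<Sum>i=0..k. of_nat a / of_nat (i + a) * cbin i * cbin (k - i)) * cbin a = cbin (k + a)"
    by (simp only:)
  then show ?thesis by (subst nonzero_eq_divide_eq) (rule cbin_nonzero)
qed

text \<open>The genus 0 numbers with two parts, as \<open>w_two\<close> will show. Division by zero
  makes the value at \<open>k = a = 0\<close> equal to 0, as it should be for a part of size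
  0.\<close>

definition w02 :: "nat \<Rightarrow> nat \<Rightarrow> rat" where
  "w02 k a = of_nat (k * a) * cbin k * cbin a / (2 * of_nat (k + a))"

lemma w02_0 [simp]: "w02 0 a = 0" "w02 k 0 = 0"
  by (simp_all add: w02_def)

lemma w02_times: "k + a > 0 \<Longrightarrow> of_nat (k + a) * w02 k a = of_nat (k * a) * cbin k * cbin a / 2"
  by (simp add: w02_def del: of_nat_add of_nat_mult)

text \<open>A join term together with the products that contain a two-part genus 0 number for the
  same part \<open>a\<close>; the factor 2 stands for the two orders of the product. In this
  combination the denominators cancel.\<close>

definition jn :: "(nat \<Rightarrow> rat) \<Rightarrow> nat \<Rightarrow> nat \<Rightarrow> rat" where
  "jn f k a = of_nat a * f (k + a) + 2 * (\<Sum>i=0..k. w02 i a * f (k - i))"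

text \<open>Since i / (i + a) = 1 - a / (i + a), the convolution with \<open>w02\<close> splits into
  \<open>conv_cbin\<close> and \<open>conv_cbin_shift\<close>; the second piece cancels the join
  term.\<close>

lemma jn_cbin:
  assumes "a > 0"
  shows "jn cbin k a = 4 ^ k * (of_nat a * cbin a)"
proof -
  have w: "2 * w02 i a = of_nat a * cbin a * (cbin i - of_nat a / of_nat (i + a) * cbin i)" for i
    using assms by (simp add: w02_def field_simps)
  have "2 * (\<Sum>i=0..k. w02 i a * cbin (k - i)) = (\<Sum>i=0..k. (2 * w02 i a) * cbin (k - i))"
    by (simp only: sum_distrib_left mult.assoc)
  also have "\<dots> = of_nat a * cbin a * ((\<Sum>i=0..k. cbin i * cbin (k - i)) - (\<Sum>i=0..k. of_nat a / of_nat (i + a) * cbin i * cbin (k - i)))"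
    unfolding w sum_subtractf[symmetric] sum_distrib_left
    by (rule sum.cong) (simp_all only: left_diff_distrib right_diff_distrib mult.assoc)
  also have "\<dots> = of_nat a * cbin a * (4 ^ k - cbin (k + a) / cbin a)"
    unfolding conv_cbin conv_cbin_shift[OF assms] ..
  finally show ?thesis unfolding jn_def by (simp add: algebra_simps)
qed

text \<open>Write k + a = (k - i) + (i + a): the first summand multiplies \<open>f\<close> by its
  argument, the second removes the denominator of \<open>w02 i a\<close>. Iteration from
  \<open>jn_cbin\<close> reaches every polynomial multiple of \<open>cbin\<close>.\<close>

lemma jn_step:
  assumes "a > 0"
  shows "jn (\<lambda>i. of_nat i * f i) k a =
    of_nat (k + a) * jn f k a - of_nat a * cbin a * (\<Sum>i=0..k. of_nat i * cbin i * f (k - i))"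
proof -
  have "2 * (\<Sum>i=0..k. w02 i a * (of_nat (k - i) * f (k - i))) =
    (\<Sum>i=0..k. of_nat (k + a) * (2 * (w02 i a * f (k - i))) - of_nat a * cbin a * (of_nat i * cbin i * f (k - i)))"
    unfolding sum_distrib_left
  proof (rule sum.cong)
    fix i assume "i \<in> {0..k}"
    then have "of_nat (k + a) = of_nat (k - i) + (of_nat (i + a) :: rat)" by (simp flip: of_nat_add)
    then have "of_nat (k + a) * (2 * (w02 i a * f (k - i))) =
      2 * (w02 i a * (of_nat (k - i) * f (k - i))) + 2 * (of_nat (i + a) * w02 i a) * f (k - i)"
      by (simp only: distrib_left distrib_right mult_ac)
    then show "2 * (w02 i a * (of_nat (k - i) * f (k - i))) =
      of_nat (k + a) * (2 * (w02 i a * f (k - i))) - of_nat a * cbin a * (of_nat i * cbin i * f (k - i))"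
      using assms by (subst (asm) w02_times) (simp_all add: mult_ac)
  qed simp
  then show ?thesis
    unfolding jn_def sum_subtractf sum_distrib_left[symmetric] by (simp only: distrib_left mult_ac)
qed

lemma jn_cbin_1:
  assumes "a > 0"
  shows "jn (\<lambda>i. of_nat i * cbin i) k a = of_nat a * cbin a * 4 ^ k * (of_nat k / 2 + of_nat a)"
  unfolding jn_step[OF assms] jn_cbin[OF assms] conv_cbin_1 by (simp add: algebra_simps)

text \<open>The terms of the recursion for genus 0 and three parts, apart from the Catalan ones.
  Multiplication by k + a + b = (i + a) + (k - i + b) removes one denominator from each product, and
  what remains are two values of \<open>jn\<close> at the function i c(i).\<close>

lemma three_point:
  assumes "a > 0" "b > 0"
  shows "of_nat a * w02 (k + a) b + of_nat b * w02 (k + b) a + 2 * (\<Sum>i=0..k. w02 i a * w02 (k - i) b)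
    = 4 ^ k * (of_nat a * cbin a) * (of_nat b * cbin b) / 2" (is "?E = ?R")
proof -
  let ?c = "of_nat (k + a + b) :: rat"
  let ?f = "\<lambda>i. of_nat i * cbin i"
  let ?A = "of_nat a * cbin a" and ?B = "of_nat b * cbin b"
  have 1: "?c * (of_nat a * w02 (k + a) b) = ?B / 2 * (of_nat a * ?f (k + a))"
    using w02_times[of "k + a" b] assms by (simp add: mult_ac add_ac)
  have 2: "?c * (of_nat b * w02 (k + b) a) = ?A / 2 * (of_nat b * ?f (k + b))"
    using w02_times[of "k + b" a] assms by (simp add: mult_ac add_ac)
  have 3: "?c * (w02 i a * w02 (k - i) b) = ?B / 2 * (w02 i a * ?f (k - i)) + ?A / 2 * (?f i * w02 (k - i) b)"
    if "i \<in> {0..k}" for i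
  proof -
    have "?c = of_nat (i + a) + of_nat (k - i + b)" using that by (simp flip: of_nat_add)
    then have "?c * (w02 i a * w02 (k - i) b) = (of_nat (i + a) * w02 i a) * w02 (k - i) b + w02 i a * (of_nat (k - i + b) * w02 (k - i) b)"
      by (simp only: distrib_left distrib_right mult_ac)
    also have "\<dots> = of_nat (i * a) * cbin i * cbin a / 2 * w02 (k - i) b + w02 i a * (of_nat ((k - i) * b) * cbin (k - i) * cbin b / 2)"
    proof -
      have "i + a > 0" "k - i + b > 0" using assms by auto
      then show ?thesis by (simp only: w02_times)
    qed
    finally show ?thesis by (simp add: mult_ac)
  qed
  have 4: "(\<Sum>i=0..k. ?f i * w02 (k - i) b) = (\<Sum>i=0..k. w02 i b * ?f (k - i))"
    by (rule sum.reindex_bij_witness[of _ "\<lambda>i. k - i" "\<lambda>i. k - i"]) auto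
  have "?c * (\<Sum>i=0..k. w02 i a * w02 (k - i) b) = ?B / 2 * (\<Sum>i=0..k. w02 i a * ?f (k - i)) + ?A / 2 * (\<Sum>i=0..k. w02 i b * ?f (k - i))"
    unfolding 4[symmetric] sum_distrib_left sum.distrib[symmetric] by (rule sum.cong) (simp_all only: 3)
  then have "?c * ?E = ?B / 2 * jn ?f k a + ?A / 2 * jn ?f k b"
    unfolding jn_def distrib_left 1 2 mult.left_commute[of ?c 2]
    by (simp only: distrib_left mult_ac)
  also have "\<dots> = ?c * ?R"
    unfolding jn_cbin_1[OF assms(1)] jn_cbin_1[OF assms(2)] by (simp add: field_simps)
  finally show ?thesis using assms by (simp only: mult_cancel_left of_nat_eq_0_iff) simp
qed

text \<open>Both parts come from splitting \<open>k\<close>, so all summands share the denominator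
  2k.\<close>

lemma one_one:
  assumes "k > 0"
  shows "(\<Sum>i=0..k. w02 i (k - i)) = 4 ^ k * (of_nat k - 1) / 16"
proof -
  have "(\<Sum>i=0..k. w02 i (k - i)) = (\<Sum>i=0..k. (of_nat i * cbin i) * (of_nat (k - i) * cbin (k - i))) / (2 * of_nat k)"
    unfolding sum_divide_distrib by (rule sum.cong) (auto simp: w02_def mult_ac)
  then show ?thesis using assms unfolding conv_cbin_1_1 by simp
qed

text \<open>The Catalan number of index k - 1. At 0 the formula would give -1/2; the value 0 says
  that there is no part of size 0 and makes the convolutions below start harmlessly at 0.\<close>

definition cat :: "nat \<Rightarrow> rat" where
  "cat k = (if k = 0 then 0 else cbin k / (4 * of_nat k - 2))"

lemma cat_Suc: "2 * cat (Suc k) = 4 * cbin k - cbin (Suc k)"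
proof -
  have "of_nat (Suc k) * (4 * cbin k - cbin (Suc k)) = 2 * cbin k"
    unfolding right_diff_distrib cbin_Suc by (simp add: algebra_simps)
  moreover have "of_nat (Suc k) * (2 * cat (Suc k)) = 2 * cbin k"
  proof -
    have "of_nat (Suc k) * (2 * cat (Suc k)) = 2 * ((of_nat (Suc k) * cbin (Suc k)) / (4 * of_nat (Suc k) - 2))"
      by (simp add: cat_def del: of_nat_Suc)
    moreover have "4 * of_nat (Suc k) - 2 = (4 * of_nat k + 2 :: rat)" by simp
    moreover have "(4 * of_nat k + 2 :: rat) > 0" by (simp add: add_nonneg_pos)
    then have "2 * (((4 * of_nat k + 2) * cbin k) / (4 * of_nat k + 2)) = 2 * cbin k"
      by (subst nonzero_mult_div_cancel_left) simp_all
    ultimately show ?thesis by (simp only: cbin_Suc)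
  qed
  ultimately show ?thesis by (metis mult_cancel_left of_nat_eq_0_iff nat.distinct(1))
qed

text \<open>Both sides are (1 - 4x)^(1/2) = 1/u, the kernel that appears when the two Catalan
  convolutions are moved to the left of the recursion.\<close>

lemma sqrt_X4: "X4 * uf = 1 - 2 * Abs_fps cat"
proof (rule fps_ext)
  fix n
  show "(X4 * uf) $ n = (1 - 2 * Abs_fps cat) $ n"
    by (cases n) (simp_all only: X4_nth_0 X4_nth_Suc fps_sub_nth numeral_mult_nth fps_nth_Abs_fps cat_Suc uf_def,
        simp_all add: cat_def)
qed

lemma cat_rec:
  assumes "k > 0"
  shows "cat k = (if k = 1 then 1 else 0) + (\<Sum>i=0..k. cat i * cat (k - i))"
proof -
  let ?C = "Abs_fps cat"
  have "(1 - 2 * ?C) * (1 - 2 * ?C) = X4 * (X4 * uf ^ 2)"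
    unfolding sqrt_X4[symmetric] by (simp add: power2_eq_square mult_ac)
  then have "4 * ?C = 4 * (fps_X + ?C * ?C)" unfolding uf_sq by (simp add: algebra_simps)
  then have "(4 * ?C) $ k = (4 * (fps_X + ?C * ?C)) $ k" by (rule arg_cong)
  moreover have "(?C * ?C) $ k = (\<Sum>i=0..k. cat i * cat (k - i))"
    by (simp only: fps_mult_nth fps_nth_Abs_fps)
  ultimately show ?thesis
    by (simp only: numeral_mult_nth fps_nth_Abs_fps fps_add_nth) (simp add: fps_X_def)
qed

text \<open>The left side is a convolution with 1/u, so multiplication by u inverts it. The equation
  is given at positive indices only; with \<open>w 0 = 0\<close> the right side counts as 0 at index
  0, whence the lower bound 1.\<close>

lemma conv_cat_inverse:
  assumes "\<And>k. k > 0 \<Longrightarrow> w k - 2 * (\<Sum>i=0..k. cat i * w (k - i)) = f k" and "w 0 = 0" and "k > 0"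
  shows "w k = (\<Sum>i=1..k. f i * cbin (k - i))"
proof -
  let ?f = "\<lambda>k. if k = 0 then 0 else f k"
  have "X4 * uf * Abs_fps w = Abs_fps ?f"
  proof (rule fps_ext)
    fix n
    have "(X4 * uf * Abs_fps w) $ n = w n - 2 * (Abs_fps cat * Abs_fps w) $ n"
      unfolding sqrt_X4 unfolding left_diff_distrib fps_sub_nth mult.assoc numeral_mult_nth by simp
    also have "(Abs_fps cat * Abs_fps w) $ n = (\<Sum>i=0..n. cat i * w (n - i))"
      by (simp only: fps_mult_nth fps_nth_Abs_fps)
    also have "w n - 2 * \<dots> = ?f n" using assms(1)[of n] assms(2) by (cases n) auto
    finally show "(X4 * uf * Abs_fps w) $ n = Abs_fps ?f $ n" by simp
  qed
  then have "Abs_fps ?f * uf = (X4 * uf ^ 2) * Abs_fps w"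
    unfolding power2_eq_square by (simp only: mult_ac flip: \<open>X4 * uf * Abs_fps w = Abs_fps ?f\<close>)
  then have "Abs_fps w = Abs_fps ?f * uf" by (simp only: uf_sq mult_1)
  from arg_cong[OF this, of "\<lambda>f. f $ k"] have "w k = (Abs_fps ?f * uf) $ k" by (simp only: fps_nth_Abs_fps)
  also have "\<dots> = (\<Sum>i=0..k. ?f i * cbin (k - i))" by (simp only: fps_mult_nth uf_def fps_nth_Abs_fps)
  also have "\<dots> = (\<Sum>i=1..k. f i * cbin (k - i))"
    by (rule sum.mono_neutral_cong_right) auto
  finally show ?thesis .
qed

text \<open>As an identity of series, \<open>jn_cbin\<close> reads a T + 2 F u = a c(a) u^2, where T
  is the shifted series of \<open>cbin\<close>. Multiplication by 1 - 4x makes the right side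
  constant and turns T into Catalan numbers by \<open>cat_Suc\<close>.\<close>

lemma w02_rec:
  assumes "k > 0" "a > 0"
  shows "w02 k a - 2 * (\<Sum>i=0..k. cat i * w02 (k - i) a) = of_nat a * cat (k + a)"
proof -
  let ?F = "Abs_fps (\<lambda>k. w02 k a)" and ?T = "Abs_fps (\<lambda>k. cbin (k + a))"
  have "of_nat a * ?T + 2 * (?F * uf) = fps_const (of_nat a * cbin a) * uf ^ 2"
  proof (rule fps_ext)
    fix n
    have "(?F * uf) $ n = (\<Sum>i=0..n. w02 i a * cbin (n - i))"
      by (simp only: fps_mult_nth uf_def fps_nth_Abs_fps)
    then show "(of_nat a * ?T + 2 * (?F * uf)) $ n = (fps_const (of_nat a * cbin a) * uf ^ 2) $ n"
      using jn_cbin[OF assms(2), of n] unfolding jn_def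
      by (simp only: fps_add_nth fps_mult_of_nat_nth numeral_mult_nth fps_nth_Abs_fps
          fps_mult_left_const_nth uf_sq_nth) (simp only: mult_ac)
  qed
  then have "X4 * (of_nat a * ?T + 2 * (?F * uf)) = X4 * (fps_const (of_nat a * cbin a) * uf ^ 2)"
    by (rule arg_cong)
  note e = this
  have g: "2 * ((Y * U) * F) = c * (Y * U ^ 2) - of_nat a * (Y * T)"
    if "Y * (of_nat a * T + 2 * (F * U)) = Y * (c * U ^ 2)" for Y T F U c :: "rat fps"
    using that by (simp add: algebra_simps)
  from g[OF e] have "2 * ((X4 * uf) * ?F) = fps_const (of_nat a * cbin a) - of_nat a * (X4 * ?T)"
    unfolding uf_sq mult_1_right .
  from arg_cong[OF this, of "\<lambda>f. f $ k"]
  have 1: "2 * ((X4 * uf) * ?F) $ k = fps_const (of_nat a * cbin a) $ k - of_nat a * (X4 * ?T) $ k"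
    by (simp only: numeral_mult_nth fps_sub_nth fps_mult_of_nat_nth)
  obtain k' where k': "k = Suc k'" using assms by (cases k) auto
  have 2: "((X4 * uf) * ?F) $ k = w02 k a - 2 * (\<Sum>i=0..k. cat i * w02 (k - i) a)"
    unfolding sqrt_X4 unfolding left_diff_distrib fps_sub_nth mult.assoc numeral_mult_nth
    by (simp only: mult_1 fps_nth_Abs_fps) (simp only: fps_mult_nth fps_nth_Abs_fps)
  have 3: "(X4 * ?T) $ k = - (2 * cat (k + a))"
    unfolding k' X4_nth_Suc fps_nth_Abs_fps add_Suc cat_Suc by simp
  have 4: "fps_const (of_nat a * cbin a) $ k = 0" using assms by simp
  have "2 * (w02 k a - 2 * (\<Sum>i=0..k. cat i * w02 (k - i) a)) = 2 * (of_nat a * cat (k + a))"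
    using 1 unfolding 2 3 4 by (simp only: diff_0 mult_minus_right minus_minus mult.left_commute)
  then show ?thesis by (simp only: mult_cancel_left) simp
qed

section \<open>Polynomial functions\<close>

inductive polyfun :: "nat set \<Rightarrow> ((nat \<Rightarrow> rat) \<Rightarrow> rat) \<Rightarrow> bool" for X where
  const: "polyfun X (\<lambda>x. c)"
| var: "i \<in> X \<Longrightarrow> polyfun X (\<lambda>x. x i)"
| add: "polyfun X f \<Longrightarrow> polyfun X g \<Longrightarrow> polyfun X (\<lambda>x. f x + g x)"
| mult: "polyfun X f \<Longrightarrow> polyfun X g \<Longrightarrow> polyfun X (\<lambda>x. f x * g x)"

lemma polyfun_mono: "polyfun X f \<Longrightarrow> X \<subseteq> Y \<Longrightarrow> polyfun Y f"
  by (induction rule: polyfun.induct) (auto intro: polyfun.intros)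

lemma polyfun_cong: "polyfun X f \<Longrightarrow> (\<And>i. i \<in> X \<Longrightarrow> x i = y i) \<Longrightarrow> f x = f y"
  by (induction rule: polyfun.induct) auto

lemma polyfun_power: "polyfun X f \<Longrightarrow> polyfun X (\<lambda>x. f x ^ n)"
  by (induction n) (auto intro: polyfun.intros)

lemma polyfun_poly: "polyfun X f \<Longrightarrow> polyfun X (\<lambda>x. poly h (f x))"
  by (induction h) (auto intro: polyfun.intros)

lemma polyfun_diff:
  assumes "polyfun X f" "polyfun X g"
  shows "polyfun X (\<lambda>x. f x - g x)"
  using polyfun.add[OF assms(1) polyfun.mult[OF polyfun.const[of X "-1"] assms(2)]] by simp

text \<open>Polynomial functions sorted by powers of one variable, with coefficients free of it. A
  convolution in that variable then reduces by linearity to the one-variable statements about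
  powers.\<close>

inductive zspan :: "nat \<Rightarrow> nat set \<Rightarrow> ((nat \<Rightarrow> rat) \<Rightarrow> rat) \<Rightarrow> bool" for z X where
  monom: "polyfun (X - {z}) Q \<Longrightarrow> zspan z X (\<lambda>x. x z ^ p * Q x)"
| add: "zspan z X f \<Longrightarrow> zspan z X g \<Longrightarrow> zspan z X (\<lambda>x. f x + g x)"

lemma zspan_mult: "zspan z X f \<Longrightarrow> zspan z X g \<Longrightarrow> zspan z X (\<lambda>x. f x * g x)"
proof (induction rule: zspan.induct)
  case (monom Q p)
  from monom(2) show ?case
  proof (induction rule: zspan.induct)
    case (monom R q)
    have "zspan z X (\<lambda>x. x z ^ (p + q) * (Q x * R x))"
      using \<open>polyfun (X - {z}) Q\<close> monom by (intro zspan.monom polyfun.mult)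
    then show ?case by (simp add: power_add mult_ac)
  next
    case (add f g)
    then show ?case using zspan.add[OF add.IH] by (simp add: algebra_simps)
  qed
next
  case (add f h)
  then show ?case using zspan.add[OF add.IH] by (simp add: algebra_simps)
qed

lemma polyfun_zspan: "polyfun X f \<Longrightarrow> zspan z X f"
proof (induction rule: polyfun.induct)
  case (const c)
  show ?case using zspan.monom[where p=0, OF polyfun.const[of "X - {z}" c]] by simp
next
  case (var i)
  show ?case
  proof (cases "i = z")
    case True
    then show ?thesis using zspan.monom[where p=1, OF polyfun.const[of "X - {z}" 1]] by simp
  next
    case False
    then show ?thesis using zspan.monom[where p=0, OF polyfun.var[of i "X - {z}"]] var by simp
  qed
qed (auto intro: zspan.add zspan_mult)

lemma jn_add: "jn (\<lambda>m. f m + g m) k a = jn f k a + jn g k a"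
  unfolding jn_def distrib_left sum.distrib by (simp only: distrib_left add_ac)

lemma jn_mult_right: "jn (\<lambda>m. f m * c) k a = jn f k a * c"
  unfolding jn_def distrib_right mult.assoc sum_distrib_right ..

abbreviation (input) ev :: "(nat \<Rightarrow> nat) \<Rightarrow> nat \<Rightarrow> rat" where "ev a \<equiv> \<lambda>i. of_nat (a i)"

lemma polyfun_ev_upd: "polyfun (X - {z}) Q \<Longrightarrow> Q (ev (a(z := i))) = Q (ev a)"
  by (rule polyfun_cong) auto

lemma even_odd_poly:
  assumes "polyfun X f" "z \<in> X"
  shows "\<exists>h. polyfun X h \<and> (\<forall>a. (\<Sum>i=1..a z. 4 ^ i * f (ev (a(z := i))) * cbin (a z - i)) = of_nat (a z) * cbin (a z) * h (ev a))"
  using polyfun_zspan[OF assms(1), of z]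
proof (induction rule: zspan.induct)
  case (monom Q p)
  obtain h0 :: "rat poly" where h0': "\<forall>k. (\<Sum>i=1..k. (of_nat i ^ p * 4 ^ i) * cbin (k - i)) = of_nat k * cbin k * poly h0 (of_nat k)"
      using conv_even_odd[of p] by (rule exE)
    note h0 = h0'[rule_format]
  let ?h = "\<lambda>x. poly h0 (x z) * Q x"
  have "polyfun X ?h"
    using assms(2) monom by (intro polyfun.mult polyfun_poly polyfun.var) (auto intro: polyfun_mono)
  moreover have "(\<Sum>i=1..a z. 4 ^ i * (of_nat ((a(z := i)) z) ^ p * Q (ev (a(z := i)))) * cbin (a z - i)) = of_nat (a z) * cbin (a z) * ?h (ev a)" for a
  proof -
    have "(\<Sum>i=1..a z. 4 ^ i * (of_nat ((a(z := i)) z) ^ p * Q (ev (a(z := i)))) * cbin (a z - i)) =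
      (\<Sum>i=1..a z. (of_nat i ^ p * 4 ^ i) * cbin (a z - i)) * Q (ev a)"
      unfolding sum_distrib_right polyfun_ev_upd[OF monom] by (intro sum.cong refl) (simp only: fun_upd_same mult_ac)
    then show ?thesis unfolding h0 by (simp only: mult_ac)
  qed
  ultimately show ?case by blast
next
  case (add f g)
  then obtain h h' where p: "polyfun X h" "polyfun X h'"
    and e: "\<And>a. (\<Sum>i=1..a z. 4 ^ i * f (ev (a(z := i))) * cbin (a z - i)) = of_nat (a z) * cbin (a z) * h (ev a)"
    "\<And>a. (\<Sum>i=1..a z. 4 ^ i * g (ev (a(z := i))) * cbin (a z - i)) = of_nat (a z) * cbin (a z) * h' (ev a)" by blast
  show ?case
  proof (intro exI conjI allI impI)
    show "polyfun X (\<lambda>x. h x + h' x)" using p by (rule polyfun.add)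
  qed (simp only: distrib_left distrib_right sum.distrib jn_add e)
qed

lemma odd_odd_poly:
  assumes "polyfun X f" "polyfun Y g"
  shows "\<exists>h. polyfun (insert z (X \<union> Y)) h \<and> (\<forall>a. (\<Sum>i=0..a z. (of_nat i * cbin i * f (ev (a(z := i)))) *
    (of_nat (a z - i) * cbin (a z - i) * g (ev (a(z := a z - i))))) = 4 ^ a z * h (ev a))"
  using polyfun_zspan[OF assms(1), of z]
proof (induction rule: zspan.induct)
  case (monom Q p)
  note Q = monom
  from polyfun_zspan[OF assms(2), of z] show ?case
  proof (induction rule: zspan.induct)
    case (monom R q)
    obtain h0 :: "rat poly" where h0': "\<forall>k. (\<Sum>i=0..k. (of_nat i ^ Suc p * cbin i) * (of_nat (k - i) ^ Suc q * cbin (k - i))) = 4 ^ k * poly h0 (of_nat k)"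
      using conv_odd_odd[of "Suc p" "Suc q"] by (rule exE)
    note h0 = h0'[rule_format]
    let ?h = "\<lambda>x. poly h0 (x z) * Q x * R x"
    have "polyfun (insert z (X \<union> Y)) ?h"
      using Q monom by (intro polyfun.mult polyfun_poly polyfun.var) (auto intro: polyfun_mono)
    moreover have "(\<Sum>i=0..a z. (of_nat i * cbin i * (of_nat ((a(z := i)) z) ^ p * Q (ev (a(z := i))))) *
        (of_nat (a z - i) * cbin (a z - i) * (of_nat ((a(z := a z - i)) z) ^ q * R (ev (a(z := a z - i)))))) = 4 ^ a z * ?h (ev a)" for a
    proof -
      have "(\<Sum>i=0..a z. (of_nat i * cbin i * (of_nat ((a(z := i)) z) ^ p * Q (ev (a(z := i))))) *
        (of_nat (a z - i) * cbin (a z - i) * (of_nat ((a(z := a z - i)) z) ^ q * R (ev (a(z := a z - i)))))) =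
        (\<Sum>i=0..a z. (of_nat i ^ Suc p * cbin i) * (of_nat (a z - i) ^ Suc q * cbin (a z - i))) * (Q (ev a) * R (ev a))"
        unfolding sum_distrib_right polyfun_ev_upd[OF monom] polyfun_ev_upd[OF Q]
        by (intro sum.cong refl) (simp only: fun_upd_same power_Suc mult_ac)
      then show ?thesis unfolding h0 by (simp only: mult_ac)
    qed
    ultimately show ?case by blast
  next
    case (add g g')
    then obtain h h' where p: "polyfun (insert z (X \<union> Y)) h" "polyfun (insert z (X \<union> Y)) h'"
      and e: "\<And>a. (\<Sum>i=0..a z. (of_nat i * cbin i * (of_nat ((a(z := i)) z) ^ p * Q (ev (a(z := i))))) *
        (of_nat (a z - i) * cbin (a z - i) * g (ev (a(z := a z - i))))) = 4 ^ a z * h (ev a)"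
      "\<And>a. (\<Sum>i=0..a z. (of_nat i * cbin i * (of_nat ((a(z := i)) z) ^ p * Q (ev (a(z := i))))) *
        (of_nat (a z - i) * cbin (a z - i) * g' (ev (a(z := a z - i))))) = 4 ^ a z * h' (ev a)" by blast
    show ?case
    proof (intro exI conjI allI impI)
      show "polyfun (insert z (X \<union> Y)) (\<lambda>x. h x + h' x)" using p by (rule polyfun.add)
    qed (simp only: distrib_left distrib_right sum.distrib jn_add e)
  qed
next
  case (add f f')
  then obtain h h' where p: "polyfun (insert z (X \<union> Y)) h" "polyfun (insert z (X \<union> Y)) h'"
    and e: "\<And>a. (\<Sum>i=0..a z. (of_nat i * cbin i * f (ev (a(z := i)))) *
      (of_nat (a z - i) * cbin (a z - i) * g (ev (a(z := a z - i))))) = 4 ^ a z * h (ev a)"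
    "\<And>a. (\<Sum>i=0..a z. (of_nat i * cbin i * f' (ev (a(z := i)))) *
      (of_nat (a z - i) * cbin (a z - i) * g (ev (a(z := a z - i))))) = 4 ^ a z * h' (ev a)" by blast
  show ?case
  proof (intro exI conjI allI impI)
    show "polyfun (insert z (X \<union> Y)) (\<lambda>x. h x + h' x)" using p by (rule polyfun.add)
  qed (simp only: distrib_left distrib_right sum.distrib jn_add e)
qed

text \<open>For the cut that keeps a factorization connected: both halves of the cycle are variables
  of one polynomial, and \<open>z'\<close> disappears from the result.\<close>

lemma odd_odd_poly_2:
  assumes "polyfun X f" "z \<noteq> z'"
  shows "\<exists>h. polyfun (insert z (X - {z'})) h \<and> (\<forall>a. (\<Sum>i=0..a z. (of_nat i * cbin i) * (of_nat (a z - i) * cbin (a z - i)) *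
    f (ev (a(z := i, z' := a z - i)))) = 4 ^ a z * h (ev a))"
  using polyfun_zspan[OF assms(1), of z']
proof (induction rule: zspan.induct)
  case (monom Q p)
  obtain h where h: "polyfun (insert z ((X - {z'}) \<union> {z})) h"
    "\<And>a. (\<Sum>i=0..a z. (of_nat i * cbin i * Q (ev (a(z := i)))) *
      (of_nat (a z - i) * cbin (a z - i) * (of_nat ((a(z := a z - i)) z) ^ p))) = 4 ^ a z * h (ev a)"
    using odd_odd_poly[OF monom polyfun_power[OF polyfun.var[of z "{z}", OF singletonI]], of z p] by blast
  have "polyfun (insert z (X - {z'})) h" using h(1) by (rule polyfun_mono) auto
  moreover have "(\<Sum>i=0..a z. (of_nat i * cbin i) * (of_nat (a z - i) * cbin (a z - i)) *
    (of_nat ((a(z := i, z' := a z - i)) z') ^ p * Q (ev (a(z := i, z' := a z - i))))) = 4 ^ a z * h (ev a)" for a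
    unfolding h(2)[symmetric] polyfun_ev_upd[OF monom] by (intro sum.cong refl) (simp only: fun_upd_same mult_ac)
  ultimately show ?case by blast
next
  case (add f g)
  then obtain h h' where p: "polyfun (insert z (X - {z'})) h" "polyfun (insert z (X - {z'})) h'"
    and e: "\<And>a. (\<Sum>i=0..a z. (of_nat i * cbin i) * (of_nat (a z - i) * cbin (a z - i)) *
      f (ev (a(z := i, z' := a z - i)))) = 4 ^ a z * h (ev a)"
    "\<And>a. (\<Sum>i=0..a z. (of_nat i * cbin i) * (of_nat (a z - i) * cbin (a z - i)) *
      g (ev (a(z := i, z' := a z - i)))) = 4 ^ a z * h' (ev a)" by blast
  show ?case
  proof (intro exI conjI allI impI)
    show "polyfun (insert z (X - {z'})) (\<lambda>x. h x + h' x)" using p by (rule polyfun.add)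
  qed (simp only: distrib_left distrib_right sum.distrib jn_add e)
qed

lemma jn_power_poly:
  "\<exists>h. polyfun {z, j} h \<and> (\<forall>a. a j > 0 \<longrightarrow> jn (\<lambda>m. of_nat m ^ p * cbin m) (a z) (a j) = 4 ^ a z * (of_nat (a j) * cbin (a j)) * h (ev a))"
proof (induction p)
  case 0
  show ?case
    by (intro exI[of _ "\<lambda>_. 1"] conjI allI impI polyfun.const) (simp only: power_0 mult_1 jn_cbin mult_1_right)
next
  case (Suc p)
  then obtain h where h: "polyfun {z, j} h"
    "\<And>a. a j > 0 \<Longrightarrow> jn (\<lambda>m. of_nat m ^ p * cbin m) (a z) (a j) = 4 ^ a z * (of_nat (a j) * cbin (a j)) * h (ev a)" by blast
  obtain q :: "rat poly" where q': "\<forall>k. (\<Sum>i=0..k. (of_nat i ^ 1 * cbin i) * (of_nat (k - i) ^ p * cbin (k - i))) = 4 ^ k * poly q (of_nat k)"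
      using conv_odd_odd[of 1 p] by (rule exE)
    note q = q'[rule_format]
  \<comment> \<open>The two terms of \<open>jn_step\<close>, the second one a convolution of two odd
    sequences.\<close>
  let ?h = "\<lambda>x. (x z + x j) * h x - poly q (x z)"
  have "polyfun {z, j} ?h"
    using h(1) by (intro polyfun_diff polyfun.mult polyfun.add polyfun_poly polyfun.var) auto
  moreover have "jn (\<lambda>m. of_nat m ^ Suc p * cbin m) (a z) (a j) = 4 ^ a z * (of_nat (a j) * cbin (a j)) * ?h (ev a)" if "a j > 0" for a
  proof -
    have "jn (\<lambda>m. of_nat m ^ Suc p * cbin m) (a z) (a j) =
      of_nat (a z + a j) * (4 ^ a z * (of_nat (a j) * cbin (a j)) * h (ev a)) - of_nat (a j) * cbin (a j) * (4 ^ a z * poly q (of_nat (a z)))"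
      using jn_step[OF that, of "\<lambda>m. of_nat m ^ p * cbin m" "a z"] h(2)[of a, OF that] q[of "a z"]
      by (simp only: power_Suc mult.assoc power_one_right)
    then show ?thesis by (simp only: of_nat_add right_diff_distrib distrib_left distrib_right mult_ac)
  qed
  ultimately show ?case by blast
qed

lemma jn_poly:
  assumes "polyfun X f"
  shows "\<exists>h. polyfun (insert z (insert j X)) h \<and> (\<forall>a. a j > 0 \<longrightarrow>
    jn (\<lambda>m. of_nat m * cbin m * f (ev (a(z := m)))) (a z) (a j) = 4 ^ a z * (of_nat (a j) * cbin (a j)) * h (ev a))"
  using polyfun_zspan[OF assms(1), of z]
proof (induction rule: zspan.induct)
  case (monom Q p)
  obtain h where h: "polyfun {z, j} h"
    "\<And>a. a j > 0 \<Longrightarrow> jn (\<lambda>m. of_nat m ^ Suc p * cbin m) (a z) (a j) = 4 ^ a z * (of_nat (a j) * cbin (a j)) * h (ev a)"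
    using jn_power_poly[of z j "Suc p"] by blast
  let ?h = "\<lambda>x. h x * Q x"
  have "polyfun (insert z (insert j X)) ?h"
    using h(1) monom by (intro polyfun.mult) (auto intro: polyfun_mono)
  moreover have "jn (\<lambda>m. of_nat m * cbin m * (of_nat ((a(z := m)) z) ^ p * Q (ev (a(z := m))))) (a z) (a j) =
    4 ^ a z * (of_nat (a j) * cbin (a j)) * ?h (ev a)" if "a j > 0" for a
  proof -
    have e: "(\<lambda>m. of_nat m * cbin m * (of_nat ((a(z := m)) z) ^ p * Q (ev (a(z := m))))) = (\<lambda>m. (of_nat m ^ Suc p * cbin m) * Q (ev a))"
      unfolding polyfun_ev_upd[OF monom] by (simp only: fun_upd_same power_Suc mult_ac)
    show ?thesis unfolding e jn_mult_right h(2)[of a, OF that] by (simp only: mult.assoc)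
  qed
  ultimately show ?case by blast
next
  case (add f g)
  then obtain h h' where p: "polyfun (insert z (insert j X)) h" "polyfun (insert z (insert j X)) h'"
    and e: "\<And>a. a j > 0 \<Longrightarrow> jn (\<lambda>m. of_nat m * cbin m * f (ev (a(z := m)))) (a z) (a j) = 4 ^ a z * (of_nat (a j) * cbin (a j)) * h (ev a)"
    "\<And>a. a j > 0 \<Longrightarrow> jn (\<lambda>m. of_nat m * cbin m * g (ev (a(z := m)))) (a z) (a j) = 4 ^ a z * (of_nat (a j) * cbin (a j)) * h' (ev a)" by blast
  show ?case
  proof (intro exI conjI allI impI)
    show "polyfun (insert z (insert j X)) (\<lambda>x. h x + h' x)" using p by (rule polyfun.add)
  qed (simp only: distrib_left distrib_right sum.distrib jn_add e)
qed

section \<open>Realizing polynomial functions by coefficient maps\<close>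

definition eval_monom :: "(nat \<Rightarrow>\<^sub>0 nat) \<Rightarrow> (nat \<Rightarrow> 'a::comm_semiring_1) \<Rightarrow> 'a" where
  "eval_monom m x = (\<Prod>i\<in>Poly_Mapping.keys m. x i ^ Poly_Mapping.lookup m i)"

lemma eval_monom_superset:
  "finite A \<Longrightarrow> Poly_Mapping.keys m \<subseteq> A \<Longrightarrow> eval_monom m x = (\<Prod>i\<in>A. x i ^ Poly_Mapping.lookup m i)"
  unfolding eval_monom_def by (rule prod.mono_neutral_left) (auto simp: in_keys_iff)

lemma eval_monom_add: "eval_monom (m + n) x = eval_monom m x * eval_monom n x"
proof -
  let ?A = "Poly_Mapping.keys m \<union> Poly_Mapping.keys n"
  have "eval_monom (m + n) x = (\<Prod>i\<in>?A. x i ^ Poly_Mapping.lookup (m + n) i)"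
    using Poly_Mapping.keys_add[of m n] by (intro eval_monom_superset) auto
  also have "\<dots> = (\<Prod>i\<in>?A. x i ^ Poly_Mapping.lookup m i) * (\<Prod>i\<in>?A. x i ^ Poly_Mapping.lookup n i)"
    by (simp add: lookup_add power_add prod.distrib)
  finally show ?thesis using eval_monom_superset[of ?A m x] eval_monom_superset[of ?A n x] by simp
qed

lemma eval_mpolynomial_superset:
  "finite A \<Longrightarrow> Poly_Mapping.keys P \<subseteq> A \<Longrightarrow> eval_mpolynomial P x = (\<Sum>m\<in>A. Poly_Mapping.lookup P m * eval_monom m x)"
  unfolding eval_mpolynomial_def eval_monom_def by (rule sum.mono_neutral_left) (auto simp: in_keys_iff)

lemma eval_mpolynomial_add: "eval_mpolynomial (P + Q) x = eval_mpolynomial P x + eval_mpolynomial Q x"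
proof -
  let ?A = "Poly_Mapping.keys P \<union> Poly_Mapping.keys Q"
  have "eval_mpolynomial (P + Q) x = (\<Sum>m\<in>?A. Poly_Mapping.lookup (P + Q) m * eval_monom m x)"
    using Poly_Mapping.keys_add[of P Q] by (intro eval_mpolynomial_superset) auto
  then show ?thesis
    using eval_mpolynomial_superset[of ?A P x] eval_mpolynomial_superset[of ?A Q x]
    by (simp add: lookup_add sum.distrib distrib_right)
qed

lemma eval_mpolynomial_zero: "eval_mpolynomial 0 x = 0"
  by (simp add: eval_mpolynomial_def)

lemma eval_mpolynomial_sum: "eval_mpolynomial (\<Sum>i\<in>A. P i) x = (\<Sum>i\<in>A. eval_mpolynomial (P i) x)"
  by (induction A rule: infinite_finite_induct) (simp_all add: eval_mpolynomial_add eval_mpolynomial_zero)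

lemma eval_mpolynomial_single: "eval_mpolynomial (Poly_Mapping.single m c) x = c * eval_monom m x"
  using eval_mpolynomial_superset[of "{m}" "Poly_Mapping.single m c" x] by (simp split: if_splits)

lemma sum_single_lookup: "(\<Sum>m\<in>Poly_Mapping.keys P. Poly_Mapping.single m (Poly_Mapping.lookup P m)) = P"
  by (rule poly_mapping_eqI)
    (simp add: lookup_sum lookup_single when_def in_keys_iff sum.delta' split: if_splits)

lemma eval_mpolynomial_mult:
  fixes P Q :: "'a::comm_semiring_1 mpolynomial"
  shows "eval_mpolynomial (P * Q) x = eval_mpolynomial P x * eval_mpolynomial Q x"
proof -
  let ?s = "\<lambda>P m. Poly_Mapping.single m (Poly_Mapping.lookup P m)"
  have "P * Q = (\<Sum>m\<in>Poly_Mapping.keys P. ?s P m) * (\<Sum>n\<in>Poly_Mapping.keys Q. ?s Q n)"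
    by (simp add: sum_single_lookup)
  also have "eval_mpolynomial \<dots> x = (\<Sum>m\<in>Poly_Mapping.keys P. \<Sum>n\<in>Poly_Mapping.keys Q.
      (Poly_Mapping.lookup P m * eval_monom m x) * (Poly_Mapping.lookup Q n * eval_monom n x))"
    by (simp add: sum_product eval_mpolynomial_sum mult_single eval_mpolynomial_single eval_monom_add mult_ac)
  finally show ?thesis
    unfolding sum_product[symmetric]
    using eval_mpolynomial_superset[of "Poly_Mapping.keys P" P x] eval_mpolynomial_superset[of "Poly_Mapping.keys Q" Q x]
    by simp
qed

lemma polyfun_mpolynomial:
  "polyfun {..<l} f \<Longrightarrow> \<exists>P. in_variables l P \<and> (\<forall>x. eval_mpolynomial P x = f x)"
proof (induction rule: polyfun.induct)
  case (const c)
  show ?case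
    by (intro exI[of _ "Poly_Mapping.single 0 c"])
      (simp add: in_variables_def eval_mpolynomial_single eval_monom_def)
next
  case (var i)
  then show ?case
    by (intro exI[of _ "Poly_Mapping.single (Poly_Mapping.single i 1) 1"])
      (simp add: in_variables_def eval_mpolynomial_single eval_monom_def)
next
  case (add f g)
  then obtain P Q where PQ: "in_variables l P" "in_variables l Q"
    "\<forall>x. eval_mpolynomial P x = f x" "\<forall>x. eval_mpolynomial Q x = g x" by blast
  moreover have "in_variables l (P + Q)"
    using PQ Poly_Mapping.keys_add[of P Q] unfolding in_variables_def by blast
  ultimately show ?case by (metis eval_mpolynomial_add)
next
  case (mult f g)
  then obtain P Q where PQ: "in_variables l P" "in_variables l Q"
    "\<forall>x. eval_mpolynomial P x = f x" "\<forall>x. eval_mpolynomial Q x = g x" by blast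
  moreover have "in_variables l (P * Q)"
    unfolding in_variables_def
  proof
    fix m assume "m \<in> Poly_Mapping.keys (P * Q)"
    then obtain a b where "m = a + b" "a \<in> Poly_Mapping.keys P" "b \<in> Poly_Mapping.keys Q"
      using keys_mult[of P Q] by auto
    then show "Poly_Mapping.keys m \<subseteq> {..<l}"
      using PQ Poly_Mapping.keys_add[of a b] unfolding in_variables_def by blast
  qed
  ultimately show ?case by (metis eval_mpolynomial_mult)
qed

section \<open>Polynomiality from the cut-and-join recursion\<close>

abbreviation (input) mset_on :: "('a \<Rightarrow> 'b) \<Rightarrow> 'a set \<Rightarrow> 'b multiset" where
  "mset_on a I \<equiv> image_mset a (mset_set I)"

text \<open>The counts depend on multisets, yet the parts are labelled by a set \<open>S\<close>: a
  disconnection distributes the untouched cycles, and equal parts belong to different cycles, so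
  \<open>Pow S\<close> has to tell them apart.\<close>

locale cut_join =
  fixes w :: "nat \<Rightarrow> nat multiset \<Rightarrow> rat"
  assumes zero: "0 \<in># M \<Longrightarrow> w g M = 0"
    and rec: "k > 0 \<Longrightarrow> finite (S :: nat set) \<Longrightarrow> \<forall>j\<in>S. a j > 0 \<Longrightarrow>
      w g (add_mset k (mset_on a S)) =
        (if g = 0 \<and> S = {} \<and> k = 1 then 1 else 0)
        + (\<Sum>j\<in>S. of_nat (a j) * w g (add_mset (k + a j) (mset_on a (S - {j}))))
        + (\<Sum>i\<in>{1..<k}. (if g = 0 then 0 else w (g - 1) (add_mset i (add_mset (k - i) (mset_on a S))))
            + (\<Sum>(I, h)\<in>Pow S \<times> {..g}. w h (add_mset i (mset_on a I)) * w (g - h) (add_mset (k - i) (mset_on a (S - I)))))"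
begin

text \<open>Labels turn a count into a function of variables. \<open>z\<close> labels the
  distinguished part, and updates at \<open>z\<close> give the values that enter a convolution in
  this part.\<close>

definition V :: "nat \<Rightarrow> nat \<Rightarrow> nat set \<Rightarrow> (nat \<Rightarrow> nat) \<Rightarrow> rat" where
  "V z g I a = w g (add_mset (a z) (mset_on a I))"

lemma V_zero: "a z = 0 \<Longrightarrow> V z g I a = 0"
  by (simp add: V_def zero)

lemma mset_on_upd: "z \<notin> I \<Longrightarrow> mset_on (a(z := k)) I = mset_on a I"
  by (cases "finite I") (auto intro!: image_mset_cong)

lemma V_upd: "z \<notin> I \<Longrightarrow> V z g I (a(z := k)) = w g (add_mset k (mset_on a I))"
  by (simp add: V_def mset_on_upd)

definition G :: "nat \<Rightarrow> nat \<Rightarrow> nat set \<Rightarrow> (nat \<Rightarrow> nat) \<Rightarrow> nat set \<times> nat \<Rightarrow> rat" where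
  "G z g S a = (\<lambda>(I, h). \<Sum>i=0..a z. V z h I (a(z := i)) * V z (g - h) (S - I) (a(z := a z - i)))"

text \<open>Counts with a part of size 0 vanish, which turns the sums over proper cuts into full
  convolutions.\<close>

lemma sum_ends_zero:
  fixes f :: "nat \<Rightarrow> rat"
  assumes "f 0 = 0" "f k = 0"
  shows "(\<Sum>i\<in>{1..<k}. f i) = (\<Sum>i=0..k. f i)"
proof (rule sum.mono_neutral_left)
  show "\<forall>i\<in>{0..k} - {1..<k}. f i = 0"
  proof
    fix i assume "i \<in> {0..k} - {1..<k}"
    then have "i = 0 \<or> i = k" by auto
    then show "f i = 0" using assms by auto
  qed
qed auto

lemma V_rec:
  assumes "a z > 0" "finite S" "\<forall>j\<in>S. a j > 0" "z \<notin> S"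
  shows "V z g S a =
    (if g = 0 \<and> S = {} \<and> a z = 1 then 1 else 0)
    + (\<Sum>j\<in>S. of_nat (a j) * V z g (S - {j}) (a(z := a z + a j)))
    + (if g = 0 then 0 else (\<Sum>i=0..a z. w (g - 1) (add_mset i (add_mset (a z - i) (mset_on a S)))))
    + (\<Sum>x\<in>Pow S \<times> {..g}. G z g S a x)"
proof -
  have z: "z \<notin> I" if "I \<in> Pow S" for I using that assms(4) by auto
  have 1: "(\<Sum>i\<in>{1..<a z}. (if g = 0 then 0 else w (g - 1) (add_mset i (add_mset (a z - i) (mset_on a S))))) =
    (if g = 0 then 0 else (\<Sum>i=0..a z. w (g - 1) (add_mset i (add_mset (a z - i) (mset_on a S)))))"
    by (subst sum_ends_zero) (auto intro!: zero)
  have 2: "(\<Sum>i\<in>{1..<a z}. \<Sum>(I, h)\<in>Pow S \<times> {..g}. w h (add_mset i (mset_on a I)) * w (g - h) (add_mset (a z - i) (mset_on a (S - I)))) =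
    (\<Sum>x\<in>Pow S \<times> {..g}. G z g S a x)"
  proof (subst sum.swap, rule sum.cong[OF refl])
    fix x assume "x \<in> Pow S \<times> {..g}"
    then obtain I h where x: "x = (I, h)" "I \<in> Pow S" by auto
    have "(\<Sum>i\<in>{1..<a z}. w h (add_mset i (mset_on a I)) * w (g - h) (add_mset (a z - i) (mset_on a (S - I)))) =
      (\<Sum>i=0..a z. w h (add_mset i (mset_on a I)) * w (g - h) (add_mset (a z - i) (mset_on a (S - I))))"
      by (rule sum_ends_zero) (simp_all add: zero)
    also have "\<dots> = G z g S a x"
      unfolding G_def x using z[OF x(2)] assms(4) by (simp add: V_upd)
    finally show "(\<Sum>i\<in>{1..<a z}. case x of (I, h) \<Rightarrow> w h (add_mset i (mset_on a I)) * w (g - h) (add_mset (a z - i) (mset_on a (S - I)))) =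
      G z g S a x" by (simp add: x)
  qed
  have 3: "(\<Sum>j\<in>S. of_nat (a j) * w g (add_mset (a z + a j) (mset_on a (S - {j})))) =
    (\<Sum>j\<in>S. of_nat (a j) * V z g (S - {j}) (a(z := a z + a j)))"
    using assms(4) by (intro sum.cong refl) (simp add: V_upd)
  show ?thesis unfolding V_def[of z g S a] rec[OF assms(1-3)] sum.distrib 1 2 3 by (simp only: add_ac)
qed

lemma sum_flip: "(\<Sum>i=0..k. f i * g (k - i)) = (\<Sum>i=0..(k::nat). (g i :: rat) * f (k - i))"
  by (rule sum.reindex_bij_witness[of _ "\<lambda>i. k - i" "\<lambda>i. k - i"]) auto

lemma w_one: "w 0 {#k#} = cat k"
proof (induction k rule: less_induct)
  case (less k)
  show ?case
  proof (cases "k = 0")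
    case True then show ?thesis by (simp add: zero cat_def)
  next
    case False
    have "w 0 {#k#} = (if k = 1 then 1 else 0) + (\<Sum>i\<in>{1..<k}. w 0 {#i#} * w 0 {#k - i#})"
      using rec[of k "{}" _ 0] False by simp
    also have "(\<Sum>i\<in>{1..<k}. w 0 {#i#} * w 0 {#k - i#}) = (\<Sum>i\<in>{1..<k}. cat i * cat (k - i))"
      using less by (intro sum.cong refl) simp
    also have "\<dots> = (\<Sum>i=0..k. cat i * cat (k - i))"
      by (rule sum_ends_zero) (simp_all add: cat_def)
    also have "(if k = 1 then 1 else 0) + \<dots> = cat k" using cat_rec[of k] False by simp
    finally show ?thesis .
  qed
qed

text \<open>The two pairs with a one-part genus 0 factor give the same Catalan convolution; together
  they make up the 2C of the kernel 1 - 2C.\<close>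

lemma G_ends:
  assumes "z \<notin> S" "finite S"
  shows "G z g S a ({}, 0) = (\<Sum>i=0..a z. cat i * V z g S (a(z := a z - i)))"
    and "G z g S a (S, g) = (\<Sum>i=0..a z. cat i * V z g S (a(z := a z - i)))"
  using assms sum_flip[where k="a z" and f="\<lambda>i. V z g S (a(z := i))" and g=cat]
  by (simp_all add: G_def V_upd w_one)

text \<open>The count and \<open>w02\<close> satisfy the same convolution equation and both vanish
  at 0; by \<open>conv_cat_inverse\<close> the solution is unique.\<close>

lemma w_two:
  assumes "b > 0"
  shows "w 0 {#k, b#} = w02 k b"
proof (cases "k = 0")
  case True then show ?thesis by (simp add: zero)
next
  case False
  let ?f = "\<lambda>k. of_nat b * cat (k + b)"
  have 1: "w 0 {#k, b#} - 2 * (\<Sum>i=0..k. cat i * w 0 {#k - i, b#}) = ?f k" if "k > 0" for k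
  proof -
    let ?a = "(\<lambda>_. b)(0 := k)"
    have P: "Pow {Suc 0} \<times> {0::nat} = {({}, 0), ({Suc 0}, 0)}" by auto
    show ?thesis
      using V_rec[of ?a 0 "{1}" 0] that assms G_ends[of 0 "{1}" 0 ?a]
      by (simp add: P V_def w_one)
  qed
  have "w 0 {#k, b#} = (\<Sum>i=1..k. ?f i * cbin (k - i))"
    using False by (intro conv_cat_inverse[of "\<lambda>k. w 0 {#k, b#}"] 1) (auto intro: zero)
  moreover have "w02 k b = (\<Sum>i=1..k. ?f i * cbin (k - i))"
    using False assms by (intro conv_cat_inverse[of "\<lambda>k. w02 k b"] w02_rec) auto
  ultimately show ?thesis by (simp only:)
qed

section \<open>Odd and even dependence on the distinguished part\<close>

definition wt :: "nat set \<Rightarrow> (nat \<Rightarrow> nat) \<Rightarrow> rat" where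
  "wt I a = (\<Prod>j\<in>I. of_nat (a j) * cbin (a j))"

lemma wt_upd: "z \<notin> I \<Longrightarrow> wt I (a(z := k)) = wt I a"
  unfolding wt_def by (rule prod.cong) auto

lemma wt_split: "finite S \<Longrightarrow> I \<subseteq> S \<Longrightarrow> wt I a * wt (S - I) a = wt S a"
  unfolding wt_def by (subst prod.subset_diff[of I S]) (simp_all only: mult.commute)

text \<open>The odd form. The distinguished part may be 0, where both sides vanish, so the formula
  can be used at the ends of a convolution.\<close>

definition poly_V :: "nat \<Rightarrow> nat \<Rightarrow> nat set \<Rightarrow> bool" where
  "poly_V z g I \<longleftrightarrow> (\<exists>p. polyfun (insert z I) p \<and>
     (\<forall>a. (\<forall>j\<in>I. a j > 0) \<longrightarrow> V z g I a = of_nat (a z) * cbin (a z) * wt I a * p (ev a)))"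

text \<open>Only positive values of the distinguished part matter, since the sums in
  \<open>conv_cat_inverse\<close> start at 1.\<close>

definition even_form :: "nat \<Rightarrow> nat set \<Rightarrow> ((nat \<Rightarrow> nat) \<Rightarrow> rat) \<Rightarrow> bool" where
  "even_form z S f \<longleftrightarrow> (\<exists>p. polyfun (insert z S) p \<and>
     (\<forall>a. (\<forall>j\<in>S. a j > 0) \<longrightarrow> a z > 0 \<longrightarrow> f a = 4 ^ a z * wt S a * p (ev a)))"

lemma even_form_add:
  assumes "even_form z S f" "even_form z S g"
  shows "even_form z S (\<lambda>a. f a + g a)"
proof -
  obtain p q where pq: "polyfun (insert z S) p" "polyfun (insert z S) q"
    and e: "\<And>a. \<forall>j\<in>S. a j > 0 \<Longrightarrow> a z > 0 \<Longrightarrow> f a = 4 ^ a z * wt S a * p (ev a)"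
      "\<And>a. \<forall>j\<in>S. a j > 0 \<Longrightarrow> a z > 0 \<Longrightarrow> g a = 4 ^ a z * wt S a * q (ev a)"
    using assms unfolding even_form_def by blast
  show ?thesis unfolding even_form_def
  proof (intro exI conjI allI impI)
    show "polyfun (insert z S) (\<lambda>x. p x + q x)" using pq by (rule polyfun.add)
  qed (simp only: e distrib_left)
qed

lemma even_form_zero: "even_form z S (\<lambda>_. 0)"
  unfolding even_form_def by (intro exI[of _ "\<lambda>_. 0"]) (auto intro: polyfun.const)

lemma even_form_sum: "(\<And>i. i \<in> A \<Longrightarrow> even_form z S (f i)) \<Longrightarrow> even_form z S (\<lambda>a. \<Sum>i\<in>A. f i a)"
  by (induction A rule: infinite_finite_induct) (auto intro: even_form_zero even_form_add)

lemma even_form_cong: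
  assumes "even_form z S f" "\<And>a. \<forall>j\<in>S. a j > 0 \<Longrightarrow> a z > 0 \<Longrightarrow> g a = f a"
  shows "even_form z S g"
proof -
  obtain p where p: "polyfun (insert z S) p"
    "\<And>a. \<forall>j\<in>S. a j > 0 \<Longrightarrow> a z > 0 \<Longrightarrow> f a = 4 ^ a z * wt S a * p (ev a)"
    using assms(1) unfolding even_form_def by blast
  show ?thesis unfolding even_form_def
  proof (intro exI conjI allI impI)
    show "polyfun (insert z S) p" by (rule p(1))
  qed (simp only: assms(2) p(2))
qed

lemma even_form_cut:
  assumes "finite S" "z \<notin> S" "I \<subseteq> S" "poly_V z h I" "poly_V z (g - h) (S - I)"
  shows "even_form z S (\<lambda>a. G z g S a (I, h))"
proof -
  obtain p q where pq: "polyfun (insert z I) p" "polyfun (insert z (S - I)) q"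
    and e: "\<And>a. \<forall>j\<in>I. a j > 0 \<Longrightarrow> V z h I a = of_nat (a z) * cbin (a z) * wt I a * p (ev a)"
      "\<And>a. \<forall>j\<in>S - I. a j > 0 \<Longrightarrow> V z (g - h) (S - I) a = of_nat (a z) * cbin (a z) * wt (S - I) a * q (ev a)"
    using assms(4,5) unfolding poly_V_def by blast
  obtain r where r: "polyfun (insert z (insert z I \<union> insert z (S - I))) r"
    "\<And>a. (\<Sum>i=0..a z. (of_nat i * cbin i * p (ev (a(z := i)))) *
      (of_nat (a z - i) * cbin (a z - i) * q (ev (a(z := a z - i))))) = 4 ^ a z * r (ev a)"
    using odd_odd_poly[OF pq, of z] by blast
  have z: "z \<notin> I" "z \<notin> S - I" using assms by auto
  have "insert z (insert z I \<union> insert z (S - I)) = insert z S" using assms(3) by auto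
  then have "polyfun (insert z S) r" using r(1) by simp
  moreover have "G z g S a (I, h) = 4 ^ a z * wt S a * r (ev a)" if a: "\<forall>j\<in>S. a j > 0" for a
  proof -
    have V1: "V z h I (a(z := i)) = wt I a * (of_nat i * cbin i * p (ev (a(z := i))))" for i
    proof -
      have "\<forall>j\<in>I. (a(z := i)) j > 0" using a assms(3) z by auto
      from e(1)[OF this] show ?thesis by (simp only: fun_upd_same wt_upd[OF z(1)] mult_ac)
    qed
    have V2: "V z (g - h) (S - I) (a(z := i)) = wt (S - I) a * (of_nat i * cbin i * q (ev (a(z := i))))" for i
    proof -
      have "\<forall>j\<in>S - I. (a(z := i)) j > 0" using a assms(3) z by auto
      from e(2)[OF this] show ?thesis by (simp only: fun_upd_same wt_upd[OF z(2)] mult_ac)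
    qed
    have "G z g S a (I, h) = (wt I a * wt (S - I) a) * (\<Sum>i=0..a z. (of_nat i * cbin i * p (ev (a(z := i)))) *
      (of_nat (a z - i) * cbin (a z - i) * q (ev (a(z := a z - i)))))"
      unfolding G_def prod.case V1 V2 sum_distrib_left by (intro sum.cong refl) (simp only: mult_ac)
    then show ?thesis unfolding r(2) wt_split[OF assms(1,3)] by (simp only: mult_ac)
  qed
  ultimately show ?thesis unfolding even_form_def by blast
qed

lemma even_form_join:
  assumes "finite S" "z \<notin> S" "j \<in> S" "poly_V z g (S - {j})"
  shows "even_form z S (\<lambda>a. of_nat (a j) * V z g (S - {j}) (a(z := a z + a j)) +
    2 * (\<Sum>i=0..a z. w02 i (a j) * V z g (S - {j}) (a(z := a z - i))))"
proof -
  obtain p where p: "polyfun (insert z (S - {j})) p"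
    and e: "\<And>a. \<forall>j\<in>S - {j}. a j > 0 \<Longrightarrow> V z g (S - {j}) a = of_nat (a z) * cbin (a z) * wt (S - {j}) a * p (ev a)"
    using assms(4) unfolding poly_V_def by blast
  obtain r where r: "polyfun (insert z (insert j (insert z (S - {j})))) r"
    "\<And>a. a j > 0 \<Longrightarrow> jn (\<lambda>m. of_nat m * cbin m * p (ev (a(z := m)))) (a z) (a j) = 4 ^ a z * (of_nat (a j) * cbin (a j)) * r (ev a)"
    using jn_poly[OF p, of z j] by blast
  have "insert z (insert j (insert z (S - {j}))) = insert z S" using assms(3) by auto
  then have "polyfun (insert z S) r" using r(1) by simp
  moreover have "of_nat (a j) * V z g (S - {j}) (a(z := a z + a j)) +
    2 * (\<Sum>i=0..a z. w02 i (a j) * V z g (S - {j}) (a(z := a z - i))) = 4 ^ a z * wt S a * r (ev a)" if a: "\<forall>j\<in>S. a j > 0" for a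
  proof -
    have V: "V z g (S - {j}) (a(z := i)) = (of_nat i * cbin i * p (ev (a(z := i)))) * wt (S - {j}) a" for i
    proof -
      have 1: "\<forall>j\<in>S - {j}. (a(z := i)) j > 0" using a assms by auto
      have 2: "z \<notin> S - {j}" using assms by auto
      from e[OF 1] show ?thesis by (simp only: fun_upd_same wt_upd[OF 2] mult_ac)
    qed
    have "of_nat (a j) * V z g (S - {j}) (a(z := a z + a j)) +
      2 * (\<Sum>i=0..a z. w02 i (a j) * V z g (S - {j}) (a(z := a z - i))) =
      jn (\<lambda>m. of_nat m * cbin m * p (ev (a(z := m)))) (a z) (a j) * wt (S - {j}) a"
      unfolding jn_mult_right[symmetric] V unfolding jn_def ..
    also have "\<dots> = 4 ^ a z * (wt {j} a * wt (S - {j}) a) * r (ev a)"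
      using r(2)[of a] a assms(3) by (simp add: wt_def)
    also have "wt {j} a * wt (S - {j}) a = wt S a" using assms by (intro wt_split) auto
    finally show ?thesis .
  qed
  ultimately show ?thesis unfolding even_form_def by blast
qed

text \<open>A fresh label \<open>z'\<close> stands for the second half of the cut cycle, so that the
  odd form for one more part can be evaluated at both halves.\<close>

lemma even_form_handle:
  assumes "finite S" "z \<notin> S" "z' \<notin> insert z S" "poly_V z g (insert z' S)"
  shows "even_form z S (\<lambda>a. \<Sum>i=0..a z. w g (add_mset i (add_mset (a z - i) (mset_on a S))))"
proof -
  obtain p where p: "polyfun (insert z (insert z' S)) p"
    and e: "\<And>a. \<forall>j\<in>insert z' S. a j > 0 \<Longrightarrow> V z g (insert z' S) a = of_nat (a z) * cbin (a z) * wt (insert z' S) a * p (ev a)"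
    using assms(4) unfolding poly_V_def by blast
  have "z \<noteq> z'" using assms by auto
  then obtain r where r: "polyfun (insert z (insert z (insert z' S) - {z'})) r"
    "\<And>a. (\<Sum>i=0..a z. (of_nat i * cbin i) * (of_nat (a z - i) * cbin (a z - i)) *
    p (ev (a(z := i, z' := a z - i)))) = 4 ^ a z * r (ev a)"
    using odd_odd_poly_2[OF p, of z z'] by blast
  have "insert z (insert z (insert z' S) - {z'}) = insert z S" using assms(3) by auto
  then have "polyfun (insert z S) r" using r(1) by simp
  moreover have "(\<Sum>i=0..a z. w g (add_mset i (add_mset (a z - i) (mset_on a S)))) = 4 ^ a z * wt S a * r (ev a)" if a: "\<forall>j\<in>S. a j > 0" for a
  proof -
    have "w g (add_mset i (add_mset (a z - i) (mset_on a S))) =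
      wt S a * ((of_nat i * cbin i) * (of_nat (a z - i) * cbin (a z - i)) * p (ev (a(z := i, z' := a z - i))))"
      if "i \<in> {0..a z}" for i
    \<comment> \<open>Here the second half is 0, a value excluded for the label \<open>z'\<close> in
      \<open>poly_V\<close>; but both sides are 0.\<close>
    proof (cases "i = a z")
      case True
      then show ?thesis by (simp add: zero)
    next
      case False
      let ?b = "a(z := i, z' := a z - i)"
      have "mset_on ?b S = mset_on a S" using assms by (intro image_mset_cong) auto
      then have "w g (add_mset i (add_mset (a z - i) (mset_on a S))) = V z g (insert z' S) ?b"
        using assms \<open>z \<noteq> z'\<close> by (simp add: V_def)
      also have "\<dots> = of_nat (?b z) * cbin (?b z) * wt (insert z' S) ?b * p (ev ?b)"
        using a False that assms(2,3) by (intro e) auto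
      also have "wt (insert z' S) ?b = of_nat (a z - i) * cbin (a z - i) * wt S a"
      proof -
        have "wt S ?b = wt S a" using assms by (simp add: wt_upd)
        then show ?thesis using assms by (simp add: wt_def)
      qed
      also have "?b z = i" using \<open>z \<noteq> z'\<close> by simp
      finally show ?thesis by (simp only: mult_ac)
    qed
    then have "(\<Sum>i=0..a z. w g (add_mset i (add_mset (a z - i) (mset_on a S)))) =
      wt S a * (\<Sum>i=0..a z. (of_nat i * cbin i) * (of_nat (a z - i) * cbin (a z - i)) * p (ev (a(z := i, z' := a z - i))))"
      unfolding sum_distrib_left by (intro sum.cong refl) blast
    then show ?thesis unfolding r(2) by (simp only: mult_ac)
  qed
  ultimately show ?thesis unfolding even_form_def by blast
qed

lemma poly_V_if_even_form:
  assumes "finite S" "z \<notin> S"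
    and "even_form z S (\<lambda>a. V z g S a - 2 * (\<Sum>i=0..a z. cat i * V z g S (a(z := a z - i))))"
  shows "poly_V z g S"
proof -
  obtain p where p: "polyfun (insert z S) p"
    and e: "\<And>a. \<forall>j\<in>S. a j > 0 \<Longrightarrow> a z > 0 \<Longrightarrow>
      V z g S a - 2 * (\<Sum>i=0..a z. cat i * V z g S (a(z := a z - i))) = 4 ^ a z * wt S a * p (ev a)"
    using assms(3) unfolding even_form_def by blast
  obtain h where h: "polyfun (insert z S) h"
    "\<And>a. (\<Sum>i=1..a z. 4 ^ i * p (ev (a(z := i))) * cbin (a z - i)) = of_nat (a z) * cbin (a z) * h (ev a)"
    using even_odd_poly[OF p insertI1] by blast
  have "V z g S a = of_nat (a z) * cbin (a z) * wt S a * h (ev a)" if a: "\<forall>j\<in>S. a j > 0" for a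
  proof (cases "a z = 0")
    case True
    then show ?thesis by (simp add: V_zero)
  next
    case False
    let ?f = "\<lambda>k. 4 ^ k * wt S a * p (ev (a(z := k)))"
    \<comment> \<open>The trivial update exhibits the left side as a value of a function of one
      index, as \<open>conv_cat_inverse\<close> expects.\<close>
    have "V z g S (a(z := a z)) = (\<Sum>i=1..a z. ?f i * cbin (a z - i))"
    proof (rule conv_cat_inverse[of "\<lambda>k. V z g S (a(z := k))" ?f])
      fix k :: nat assume k: "k > 0"
      have "\<forall>j\<in>S. (a(z := k)) j > 0" "(a(z := k)) z > 0" using a k by auto
      from e[OF this]
      show "V z g S (a(z := k)) - 2 * (\<Sum>i=0..k. cat i * V z g S (a(z := k - i))) = ?f k"
        by (simp only: fun_upd_same fun_upd_upd wt_upd[OF assms(2)])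
    qed (use False in \<open>simp_all add: V_zero\<close>)
    also have "\<dots> = wt S a * (\<Sum>i=1..a z. 4 ^ i * p (ev (a(z := i))) * cbin (a z - i))"
      unfolding sum_distrib_left by (intro sum.cong refl) (simp only: mult_ac)
    finally show ?thesis unfolding h(2) fun_upd_triv by (simp only: mult_ac)
  qed
  then show ?thesis using h(1) unfolding poly_V_def by blast
qed

text \<open>The pairs with a two-part genus 0 factor. Each label \<open>j\<close> has two of them,
  and they combine with its join term to \<open>jn\<close>.\<close>

lemma G_two:
  assumes "finite S" "z \<notin> S" "j \<in> S" "\<forall>j\<in>S. a j > 0"
  shows "G z g S a ({j}, 0) = (\<Sum>i=0..a z. w02 i (a j) * V z g (S - {j}) (a(z := a z - i)))"
    and "G z g S a (S - {j}, g) = (\<Sum>i=0..a z. w02 i (a j) * V z g (S - {j}) (a(z := a z - i)))"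
proof -
  have 1: "V z 0 {j} (a(z := i)) = w02 i (a j)" for i
  proof -
    have "z \<notin> {j}" "a j > 0" using assms by auto
    then show ?thesis using w_two[of "a j" i] by (simp add: V_upd)
  qed
  have 2: "S - (S - {j}) = {j}" using assms by auto
  show "G z g S a ({j}, 0) = (\<Sum>i=0..a z. w02 i (a j) * V z g (S - {j}) (a(z := a z - i)))"
    by (simp add: G_def 1)
  show "G z g S a (S - {j}, g) = (\<Sum>i=0..a z. w02 i (a j) * V z g (S - {j}) (a(z := a z - i)))"
    unfolding G_def prod.case 2 diff_self_eq_0 1 by (rule sum_flip)
qed

text \<open>Cutting the only cycle gives genus 0 with two parts, which lacks the odd form;
  \<open>one_one\<close> evaluates the resulting sum, and its value 4^k (k - 1) / 16 is
  even.\<close>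

lemma poly_V_one_one: "poly_V z 1 {}"
proof (rule poly_V_if_even_form)
  have P: "Pow {} \<times> {..1::nat} = {({} :: nat set, 0), ({}, 1)}" by auto
  have "V z 1 {} a - 2 * (\<Sum>i=0..a z. cat i * V z 1 {} (a(z := a z - i))) = 4 ^ a z * (of_nat (a z) - 1) / 16"
    if "a z > 0" for a
  proof -
    have "(\<Sum>i=0..a z. w 0 (add_mset i (add_mset (a z - i) (mset_on a {})))) = (\<Sum>i=0..a z. w02 i (a z - i))"
    proof (rule sum.cong)
      fix i assume "i \<in> {0..a z}"
      then show "w 0 (add_mset i (add_mset (a z - i) (mset_on a {}))) = w02 i (a z - i)"
        using w_two[of "a z - i" i] by (cases "a z - i = 0") (simp_all add: zero)
    qed simp
    then have "V z 1 {} a = 4 ^ a z * (of_nat (a z) - 1) / 16 + (G z 1 {} a ({}, 0) + G z 1 {} a ({}, 1))"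
      using V_rec[of a z "{}" 1] that one_one[OF that] unfolding P by simp
    then show ?thesis using G_ends[of z "{}" 1 a] by simp
  qed
  moreover have "polyfun {z} (\<lambda>x. poly [:-1/16, 1/16:] (x z))" by (intro polyfun_poly polyfun.var) simp
  ultimately show "even_form z {} (\<lambda>a. V z 1 {} a - 2 * (\<Sum>i=0..a z. cat i * V z 1 {} (a(z := a z - i))))"
    unfolding even_form_def wt_def
    by (intro exI[of _ "\<lambda>x. poly [:-1/16, 1/16:] (x z)"]) (simp add: field_simps)
qed simp_all

text \<open>Here the join terms and both factors of the middle products are two-part numbers, so
  \<open>three_point\<close> takes the place of \<open>jn_poly\<close>.\<close>

lemma poly_V_zero_three:
  assumes "z \<notin> {j, j'}" "j \<noteq> j'"
  shows "poly_V z 0 {j, j'}"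
proof (rule poly_V_if_even_form)
  let ?S = "{j, j'}"
  have P: "Pow ?S \<times> {..0::nat} = {({}, 0), (?S, 0), ({j}, 0), ({j'}, 0)}" by auto
  have S: "?S - {j} = {j'}" "?S - {j'} = {j}" using assms by auto
  have "V z 0 ?S a - 2 * (\<Sum>i=0..a z. cat i * V z 0 ?S (a(z := a z - i))) = 4 ^ a z * wt ?S a / 2"
    if a: "a z > 0" "\<forall>j\<in>?S. a j > 0" for a
  proof -
    have z: "z \<notin> {j}" "z \<notin> {j'}" using assms by auto
    have V: "V z 0 {j} (a(z := i)) = w02 i (a j)" "V z 0 {j'} (a(z := i)) = w02 i (a j')" for i
      using a z w_two[of "a j" i] w_two[of "a j'" i] by (auto simp: V_upd)
    have g: "G z 0 ?S a ({j}, 0) = (\<Sum>i=0..a z. w02 i (a j) * w02 (a z - i) (a j'))"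
      using G_two(1)[of ?S z j a 0] assms a by (simp only: S V) simp
    have "G z 0 ?S a ({j'}, 0) = (\<Sum>i=0..a z. w02 i (a j') * w02 (a z - i) (a j))"
      using G_two(1)[of ?S z j' a 0] assms a by (simp only: S V) simp
    also have "\<dots> = (\<Sum>i=0..a z. w02 i (a j) * w02 (a z - i) (a j'))" by (rule sum_flip)
    finally have g': "G z 0 ?S a ({j'}, 0) = (\<Sum>i=0..a z. w02 i (a j) * w02 (a z - i) (a j'))" .
    have j: "(\<Sum>i\<in>?S. of_nat (a i) * V z 0 (?S - {i}) (a(z := a z + a i))) =
      of_nat (a j) * w02 (a z + a j) (a j') + of_nat (a j') * w02 (a z + a j') (a j)"
    proof -
      have "sum f ?S = f j + f j'" for f :: "nat \<Rightarrow> rat" using assms(2) by simp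
      then show ?thesis by (simp only: S V)
    qed
    have "V z 0 ?S a = of_nat (a j) * w02 (a z + a j) (a j') + of_nat (a j') * w02 (a z + a j') (a j)
      + (\<Sum>x\<in>Pow ?S \<times> {..0}. G z 0 ?S a x)"
      using V_rec[of a z ?S 0] a assms unfolding j by simp
    also have "(\<Sum>x\<in>Pow ?S \<times> {..0}. G z 0 ?S a x) = G z 0 ?S a ({}, 0) + G z 0 ?S a (?S, 0) + 2 * (\<Sum>i=0..a z. w02 i (a j) * w02 (a z - i) (a j'))"
      unfolding P using assms(2) g g' by auto
    finally show ?thesis
      using G_ends[of z ?S 0 a] three_point[of "a j" "a j'" "a z"] a assms
      by (simp add: wt_def)
  qed
  moreover have "polyfun (insert z ?S) (\<lambda>_. 1/2)" by (rule polyfun.const)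
  ultimately show "even_form z ?S (\<lambda>a. V z 0 ?S a - 2 * (\<Sum>i=0..a z. cat i * V z 0 ?S (a(z := a z - i))))"
    unfolding even_form_def by (intro exI[of _ "\<lambda>_. 1/2"]) simp
qed (use assms in simp_all)

text \<open>With l = card S + 1 parts, the hypothesis is the stability condition 2g - 2 + l > 0. All
  terms other than those with unstable factors involve only stable data with a smaller 2g +
  l.\<close>

lemma poly_V:
  assumes "finite S" "z \<notin> S" "2 * g + card S \<ge> 2"
  shows "poly_V z g S"
  using assms
proof (induction "2 * g + card S" arbitrary: g S rule: less_induct)
  case less
  show ?case
  proof (cases "2 * g + card S = 2")
    case True
    then consider "g = 1" "card S = 0" | "g = 0" "card S = 2" by (cases g) auto
    then show ?thesis
    proof cases
      case 1
      then show ?thesis using poly_V_one_one less.prems by simp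
    next
      case 2
      then show ?thesis using poly_V_zero_three less.prems unfolding card_2_iff by auto
    qed
  next
    case False
    then have size: "2 * g + card S \<ge> 3" using less.prems by simp
    \<comment> \<open>The pairs with an unstable factor: one part of genus 0 in \<open>E1\<close>,
      two parts of genus 0 in \<open>E2\<close> and \<open>E3\<close>. They are distinct because 2g
      + card S is at least 3; for genus 0 with three parts, \<open>E2\<close> and \<open>E3\<close>
      would coincide.\<close>
    define E1 where "E1 = {({}, 0), (S, g)}"
    define E2 where "E2 = (\<lambda>j. ({j}, 0::nat)) ` S"
    define E3 where "E3 = (\<lambda>j. (S - {j}, g)) ` S"
    define E where "E = Pow S \<times> {..g} - (E1 \<union> E2 \<union> E3)"
    have sub: "E1 \<union> E2 \<union> E3 \<subseteq> Pow S \<times> {..g}" unfolding E1_def E2_def E3_def by auto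
    have ne: "({}, 0) \<noteq> (S, g)" using size by auto
    have dis: "E1 \<inter> (E2 \<union> E3) = {}" "E2 \<inter> E3 = {}"
    proof -
      have "S \<noteq> {j}" if "g = 0" for j using size that by auto
      then show "E1 \<inter> (E2 \<union> E3) = {}" unfolding E1_def E2_def E3_def by blast
      show "E2 \<inter> E3 = {}"
      proof (rule ccontr)
        assume "E2 \<inter> E3 \<noteq> {}"
        then obtain i j where "{i} = S - {j}" "g = 0" "j \<in> S" unfolding E2_def E3_def by auto
        then have "card (S - {j}) = 1" "g = 0" "j \<in> S" by (metis card_1_singleton_iff One_nat_def)+
        then show False using size less.prems by simp
      qed
    qed
    have fin: "finite E1" "finite E2" "finite E3" unfolding E1_def E2_def E3_def using less.prems by auto
    have inj: "inj_on (\<lambda>j. (S - {j}, g)) S" by (auto simp: inj_on_def)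
    \<comment> \<open>The Catalan terms move to the left, and the terms of \<open>E2\<close> and
      \<open>E3\<close> are grouped with the join term of the same label.\<close>
    have V: "V z g S a - 2 * (\<Sum>i=0..a z. cat i * V z g S (a(z := a z - i))) =
      (\<Sum>j\<in>S. of_nat (a j) * V z g (S - {j}) (a(z := a z + a j)) + 2 * (\<Sum>i=0..a z. w02 i (a j) * V z g (S - {j}) (a(z := a z - i))))
      + (if g = 0 then 0 else (\<Sum>i=0..a z. w (g - 1) (add_mset i (add_mset (a z - i) (mset_on a S)))))
      + (\<Sum>x\<in>E. G z g S a x)" if a: "\<forall>j\<in>S. a j > 0" "a z > 0" for a
    proof -
      have "(\<Sum>x\<in>Pow S \<times> {..g}. G z g S a x) = (\<Sum>x\<in>E. G z g S a x) + (\<Sum>x\<in>E1 \<union> (E2 \<union> E3). G z g S a x)"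
        unfolding E_def using less.prems(1) sub by (subst sum.subset_diff[OF sub]) (auto simp: Un_assoc)
      also have "(\<Sum>x\<in>E1 \<union> (E2 \<union> E3). G z g S a x) = (\<Sum>x\<in>E1. G z g S a x) + ((\<Sum>x\<in>E2. G z g S a x) + (\<Sum>x\<in>E3. G z g S a x))"
        using dis fin by (simp add: sum.union_disjoint)
      also have "(\<Sum>x\<in>E1. G z g S a x) = 2 * (\<Sum>i=0..a z. cat i * V z g S (a(z := a z - i)))"
        unfolding E1_def using ne G_ends[of z S g a] less.prems by simp
      also have "(\<Sum>x\<in>E2. G z g S a x) = (\<Sum>j\<in>S. \<Sum>i=0..a z. w02 i (a j) * V z g (S - {j}) (a(z := a z - i)))"
        unfolding E2_def using less.prems G_two(1) a(1) by (subst sum.reindex) (auto simp: inj_on_def)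
      also have "(\<Sum>x\<in>E3. G z g S a x) = (\<Sum>j\<in>S. \<Sum>i=0..a z. w02 i (a j) * V z g (S - {j}) (a(z := a z - i)))"
        unfolding E3_def using less.prems G_two(2) a(1) inj by (subst sum.reindex) auto
      finally have "(\<Sum>x\<in>Pow S \<times> {..g}. G z g S a x) = (\<Sum>x\<in>E. G z g S a x) + (2 * (\<Sum>i=0..a z. cat i * V z g S (a(z := a z - i)))
        + 2 * (\<Sum>j\<in>S. \<Sum>i=0..a z. w02 i (a j) * V z g (S - {j}) (a(z := a z - i))))" by (simp only: mult_2)
      moreover have "\<not> (g = 0 \<and> S = {} \<and> a z = 1)" using size by auto
      ultimately show ?thesis
        using V_rec[OF a(2) less.prems(1) a(1) less.prems(2), of g] by (simp add: sum.distrib sum_distrib_left)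
    qed
    show ?thesis
    proof (rule poly_V_if_even_form[OF less.prems(1,2)], rule even_form_cong[OF _ V])
      show "even_form z S (\<lambda>a. (\<Sum>j\<in>S. of_nat (a j) * V z g (S - {j}) (a(z := a z + a j)) + 2 * (\<Sum>i=0..a z. w02 i (a j) * V z g (S - {j}) (a(z := a z - i))))
      + (if g = 0 then 0 else (\<Sum>i=0..a z. w (g - 1) (add_mset i (add_mset (a z - i) (mset_on a S)))))
      + (\<Sum>x\<in>E. G z g S a x))"
      proof (rule even_form_add, rule even_form_add, rule even_form_sum)
        fix j assume j: "j \<in> S"
        then have "card (S - {j}) = card S - 1" "card S > 0" using less.prems card_gt_0_iff by auto
        then have "poly_V z g (S - {j})" using less.prems size by (intro less.hyps) auto
        then show "even_form z S (\<lambda>a. of_nat (a j) * V z g (S - {j}) (a(z := a z + a j)) + 2 * (\<Sum>i=0..a z. w02 i (a j) * V z g (S - {j}) (a(z := a z - i))))"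
          using less.prems j by (intro even_form_join) auto
      next
        show "even_form z S (\<lambda>a. if g = 0 then 0 else (\<Sum>i=0..a z. w (g - 1) (add_mset i (add_mset (a z - i) (mset_on a S)))))"
        proof (cases "g = 0")
          case True
          then show ?thesis by (simp add: even_form_zero)
        next
          case g: False
          obtain z' where z': "z' \<notin> insert z S"
            using less.prems(1) ex_new_if_finite[of "insert z S"] by auto
          have "card (insert z' S) = card S + 1" using z' less.prems by simp
          then have "poly_V z (g - 1) (insert z' S)" using g z' less.prems size by (intro less.hyps) auto
          from even_form_handle[OF less.prems(1,2) z' this] show ?thesis using g by simp
        qed
      next
        show "even_form z S (\<lambda>a. \<Sum>x\<in>E. G z g S a x)"
        proof (rule even_form_sum)
        fix x assume x: "x \<in> E"
        obtain I h where xx: "x = (I, h)" by (cases x)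
        have I: "I \<subseteq> S" "h \<le> g" "(I, h) \<notin> E1" "(I, h) \<notin> E2" "(I, h) \<notin> E3" using x unfolding E_def xx by auto
        have finI: "finite I" using I less.prems finite_subset by auto
        have c: "card (S - I) + card I = card S"
          using I less.prems finI by (simp add: card_Diff_subset card_mono)
        have big1: "2 * h + card I \<ge> 2"
        proof (rule ccontr)
          assume "\<not> ?thesis"
          then have "h = 0" "card I = 0 \<or> card I = 1" by auto
          then show False using I finI unfolding E1_def E2_def by (auto simp: card_1_singleton_iff)
        qed
        have big2: "2 * (g - h) + card (S - I) \<ge> 2"
        proof (rule ccontr)
          assume "\<not> ?thesis"
          then have h: "h = g" "card (S - I) = 0 \<or> card (S - I) = 1" using I by auto
          from h(2) show False
          proof
            assume "card (S - I) = 0"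
            then have "I = S" using I less.prems by auto
            then show False using I h unfolding E1_def by auto
          next
            assume "card (S - I) = 1"
            then obtain j where "S - I = {j}" by (auto simp: card_1_singleton_iff)
            then have "I = S - {j}" "j \<in> S" using I by auto
            then show False using I h unfolding E3_def by auto
          qed
        qed
        have "z \<notin> I" "z \<notin> S - I" using I less.prems by auto
        moreover have "2 * h + card I < 2 * g + card S" using big2 c I(2) by linarith
        moreover have "2 * (g - h) + card (S - I) < 2 * g + card S" using big1 c I(2) by linarith
        ultimately have "poly_V z h I" "poly_V z (g - h) (S - I)"
          using big1 big2 finI less.prems(1) by (auto intro!: less.hyps)
        then show "even_form z S (\<lambda>a. G z g S a x)"
          unfolding xx using less.prems I by (intro even_form_cut) auto
        qed
      qed
    qed
  qed
qed

end

section \<open>Monotone factorizations and conjugation\<close>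

abbreviation tr :: "nat \<Rightarrow> nat \<Rightarrow> nat \<Rightarrow> nat" where "tr \<equiv> Transposition.transpose"

definition tprod :: "(nat \<times> nat) list \<Rightarrow> nat \<Rightarrow> nat" where
  "tprod ps = foldr (\<lambda>(a, b) p. tr a b \<circ> p) ps id"

lemma tprod_simps [simp]: "tprod [] = id" "tprod ((a, b) # ps) = tr a b \<circ> tprod ps"
  by (simp_all add: tprod_def)

lemma tprod_append: "tprod (ps @ qs) = tprod ps \<circ> tprod qs"
  by (induction ps) (auto simp: comp_assoc)

text \<open>The sets that no edge leaves, that is, the unions of components of the graph on all
  naturals. Unlike paths, they are easily transported by permutations and intersected.\<close>

definition uncut :: "(nat \<times> nat) list \<Rightarrow> nat set set" where
  "uncut ps = {C. \<forall>(a, b)\<in>set ps. a \<in> C \<longleftrightarrow> b \<in> C}"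

text \<open>For \<open>I = uncut ps\<close> this says that the edges connect \<open>B\<close>. An
  arbitrary family is allowed so that the condition can be read off a \<open>state\<close>.\<close>

definition conn :: "nat set \<Rightarrow> nat set set \<Rightarrow> bool" where
  "conn B I \<longleftrightarrow> (\<forall>C\<in>I. B \<subseteq> C \<or> B \<inter> C = {})"

text \<open>The larger endpoints have their own range \<open>U\<close>, which loses its least
  element in the recursion of the complete symmetric polynomials while \<open>B\<close>
  stays.\<close>

definition mono_seqs :: "nat set \<Rightarrow> nat set \<Rightarrow> nat \<Rightarrow> (nat \<times> nat) list set" where
  "mono_seqs B U r = {ps. length ps = r \<and> (\<forall>(a, b)\<in>set ps. a \<in> B \<and> b \<in> U \<and> a < b) \<and> sorted (map snd ps)}"

text \<open>\<open>B\<close> is any set of naturals with the inherited order, because a disconnected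
  factorization falls into factorizations on a subset and on its complement.\<close>

definition fact_count :: "nat \<Rightarrow> nat set \<Rightarrow> (nat \<Rightarrow> nat) \<Rightarrow> nat" where
  "fact_count r B p = card {ps \<in> mono_seqs B B r. tprod ps = p \<and> conn B (uncut ps)}"

lemma finite_mono_seqs:
  assumes "finite B" "finite U"
  shows "finite (mono_seqs B U r)"
proof (rule finite_subset)
  show "mono_seqs B U r \<subseteq> {ps. set ps \<subseteq> B \<times> U \<and> length ps = r}"
    by (auto simp: mono_seqs_def)
  show "finite {ps. set ps \<subseteq> B \<times> U \<and> length ps = r}"
    using assms by (intro finite_lists_length_eq) auto
qed

lemma tr_image_uncut: "(a \<in> C \<longleftrightarrow> b \<in> C) \<Longrightarrow> tr a b ` C = C"
  by (rule transpose_image_eq)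

lemma tprod_image_uncut: "C \<in> uncut ps \<Longrightarrow> tprod ps ` C = C"
proof (induction ps)
  case (Cons p ps)
  obtain a b where p: "p = (a, b)" by (cases p)
  have "tprod ps ` C = C" using Cons by (auto simp: uncut_def)
  moreover have "tr a b ` C = C" using Cons(2) by (intro tr_image_uncut) (auto simp: uncut_def p)
  ultimately show ?case unfolding p tprod_simps(2) image_comp[symmetric] by simp
qed simp

text \<open>The semidirect product of maps with families of sets under intersection. It makes conjugation
  by a transposition inner, and the family \<^term>\<open>uncut ps\<close> records the connected components of
  the graph with edges \<open>ps\<close>.\<close>

datatype state = State (the_map: "nat \<Rightarrow> nat") (the_sets: "nat set set")

instantiation state :: monoid_add
begin

definition zero_state :: state where "0 = State id UNIV"

definition plus_state :: "state \<Rightarrow> state \<Rightarrow> state" where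
  "x + y = State (the_map x \<circ> the_map y) {C \<in> the_sets y. the_map y ` C \<in> the_sets x}"

instance
  by standard (auto simp: zero_state_def plus_state_def comp_assoc image_comp intro: state.expand)

end

definition edge :: "nat \<Rightarrow> nat \<Rightarrow> state" where
  "edge a b = State (tr a b) {C. a \<in> C \<longleftrightarrow> b \<in> C}"

lemma edge_commute: "edge a b = edge b a"
  by (auto simp: edge_def transpose_commute)

text \<open>A transposition fixes every set that its edge does not leave, so the twist in the second
  component of the product has no effect and an intersection remains.\<close>

lemma edge_plus_edge: "edge a b + edge c d = State (tr a b \<circ> tr c d) ({C. a \<in> C \<longleftrightarrow> b \<in> C} \<inter> {C. c \<in> C \<longleftrightarrow> d \<in> C})"
proof -
  have "(c \<in> C \<longleftrightarrow> d \<in> C) \<and> tr c d ` C \<in> A \<longleftrightarrow> C \<in> A \<and> (c \<in> C \<longleftrightarrow> d \<in> C)" for C A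
    by (cases "c \<in> C \<longleftrightarrow> d \<in> C") (simp_all add: tr_image_uncut)
  then have "{C \<in> {C. c \<in> C \<longleftrightarrow> d \<in> C}. tr c d ` C \<in> A} = A \<inter> {C. c \<in> C \<longleftrightarrow> d \<in> C}" for A by blast
  then show ?thesis unfolding edge_def plus_state_def state.sel by (simp only:)
qed

definition state_of :: "(nat \<times> nat) list \<Rightarrow> state" where
  "state_of ps = sum_list (map (\<lambda>(a, b). edge a b) ps)"

lemma state_of_Nil [simp]: "state_of [] = 0"
  and state_of_Cons [simp]: "state_of ((a, b) # ps) = edge a b + state_of ps"
  by (simp_all add: state_of_def)

lemma state_of_eq: "state_of ps = State (tprod ps) (uncut ps)"
proof (induction ps)
  case Nil
  then show ?case by (auto simp: zero_state_def uncut_def)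
next
  case (Cons p ps)
  obtain a b where p: "p = (a, b)" by (cases p)
  have u: "C \<in> uncut ((a, b) # ps) \<longleftrightarrow> C \<in> uncut ps \<and> (a \<in> C \<longleftrightarrow> b \<in> C)" for C
    by (auto simp: uncut_def)
  have "{C \<in> uncut ps. tprod ps ` C \<in> {C. a \<in> C \<longleftrightarrow> b \<in> C}} = uncut ((a, b) # ps)"
  proof (rule subset_antisym; rule subsetI)
    fix C assume "C \<in> {C \<in> uncut ps. tprod ps ` C \<in> {C. a \<in> C \<longleftrightarrow> b \<in> C}}"
    then show "C \<in> uncut ((a, b) # ps)" using tprod_image_uncut[of C ps] unfolding u by simp
  next
    fix C assume "C \<in> uncut ((a, b) # ps)"
    then show "C \<in> {C \<in> uncut ps. tprod ps ` C \<in> {C. a \<in> C \<longleftrightarrow> b \<in> C}}"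
      using tprod_image_uncut[of C ps] unfolding u by simp
  qed
  then show ?case
    unfolding p state_of_Cons Cons by (simp only: edge_def plus_state_def state.sel tprod_simps)
qed

lemma tr_comp_tr: "tr u v \<circ> tr a b = tr (tr u v a) (tr u v b) \<circ> tr u v"
  using transpose_comp_eq[of "tr u v" "tr u v a" "tr u v b"] by simp

lemma tr_conj: "tr u v \<circ> tr a b \<circ> tr u v = tr (tr u v a) (tr u v b)"
  by (subst tr_comp_tr) (simp add: comp_assoc)

lemma mem_tr_image: "a \<in> tr u v ` C \<longleftrightarrow> tr u v a \<in> C"
  by (rule in_transpose_image_iff)

text \<open>The state with family \<open>UNIV\<close> carries a permutation but no edge: conjugation
  by it relabels an edge without adding another.\<close>

lemma edge_conj: "State (tr u v) UNIV + edge a b + State (tr u v) UNIV = edge (tr u v a) (tr u v b)"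
  unfolding plus_state_def edge_def state.sel tr_conj by (simp add: mem_tr_image)

text \<open>The complete homogeneous symmetric polynomial of degree \<open>r\<close> in possibly
  noncommuting elements, every monomial being written in the order of the list.\<close>

fun csym :: "('b \<Rightarrow> 'a::ring_1) \<Rightarrow> 'b list \<Rightarrow> nat \<Rightarrow> 'a" where
  "csym X bs 0 = 1"
| "csym X [] (Suc r) = 0"
| "csym X (b # bs) (Suc r) = X b * csym X (b # bs) r + csym X bs (Suc r)"

text \<open>Conjugation by S exchanges two neighbouring variables up to the error D. Their sum and
  product are nevertheless fixed, and the polynomial depends on the two variables only through
  these.\<close>

lemma csym_conj:
  fixes X :: "'b \<Rightarrow> 'a::ring_1"
  assumes S: "S * S = 1"
    and X: "\<And>b. b \<in> set pre \<union> set post \<Longrightarrow> S * X b * S = X b"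
    and u: "S * X u * S = X v - D" and v: "S * X v * S = X u + D"
    and comm: "X u * X v = X v * X u" and D: "X v * D - D * X u = D * D"
  shows "S * csym X (pre @ u # v # post) r * S = csym X (pre @ u # v # post) r"
proof -
  define c where "c = (\<lambda>z. S * z * S)"
  have c_mult: "c (y * z) = c y * c z" for y z
  proof -
    have "c y * c z = S * y * (S * S) * z * S" unfolding c_def by (simp only: mult.assoc)
    then show ?thesis unfolding S c_def by (simp only: mult.assoc mult_1)
  qed
  have c_add: "c (y + z) = c y + c z" "c (y - z) = c y - c z" for y z
    unfolding c_def by (simp_all only: distrib_left distrib_right left_diff_distrib right_diff_distrib)
  have c1: "c 1 = 1" "c 0 = 0" unfolding c_def using S by simp_all
  have cX: "c (X b) = X b" if "b \<in> set pre \<union> set post" for b using X[OF that] by (simp add: c_def)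
  have post: "c (csym X post r) = csym X post r" for r
    using cX
  proof (induction X post r rule: csym.induct)
    case (3 X b bs r)
    then show ?case by (simp add: c_add c_mult)
  qed (simp_all add: c1)
  have e1: "c (X u + X v) = X u + X v" unfolding c_add using u v by (simp add: c_def)
  have e2: "c (X v * X u) = X v * X u"
  proof -
    \<comment> \<open>Expanding this product, the relation assumed for D is exactly what cancels the
      error terms.\<close>
    have "c (X u * X v) = (X v - D) * (X u + D)" unfolding c_mult using u v by (simp add: c_def)
    also have "\<dots> = X v * X u + (X v * D - D * X u) - D * D" by (simp add: algebra_simps)
    finally show ?thesis using comm D by simp
  qed
  \<comment> \<open>Eliminating the polynomial in \<open>v # post\<close> leaves the elementary
    symmetric functions of the two variables as coefficients.\<close>
  have mid_rec: "csym X (u # v # post) (Suc (Suc r)) =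
    (X u + X v) * csym X (u # v # post) (Suc r) - (X v * X u) * csym X (u # v # post) r + csym X post (Suc (Suc r))" for r
    by (simp add: algebra_simps)
  have mid: "c (csym X (u # v # post) r) = csym X (u # v # post) r" for r
  proof (induction r rule: induct_nat_012)
    case 1
    then show ?case using e1 post[of "Suc 0"] by (simp add: c_add add.assoc[symmetric])
  next
    case (ge2 r)
    then show ?case unfolding mid_rec using e1 e2 post by (simp only: c_add c_mult)
  qed (simp add: c1)
  have "c (csym X (pre @ u # v # post) r) = csym X (pre @ u # v # post) r"
    using cX
  proof (induction pre arbitrary: r)
    case Nil
    then show ?case using mid by simp
  next
    case (Cons b pre)
    note IH = Cons
    show ?case
    proof (induction r)
      case 0
      then show ?case by (simp add: c1)
    next
      case (Suc r)
      then show ?case using IH by (simp add: c_add c_mult)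
    qed
  qed
  then show ?thesis by (simp add: c_def)
qed

text \<open>Elements of the monoid algebra over the integers. The product of finitely supported maps
  is convolution along \<open>+\<close>, which is why the noncommutative monoid of states is written
  additively.\<close>

abbreviation basis :: "state \<Rightarrow> (state \<Rightarrow>\<^sub>0 int)" where "basis x \<equiv> Poly_Mapping.single x 1"

lemma basis_mult: "basis x * basis y = basis (x + y)"
  by (simp add: mult_single)

text \<open>A Jucys-Murphy element whose transpositions keep their edges, so that products also
  record what has been connected.\<close>

definition JM :: "nat set \<Rightarrow> nat \<Rightarrow> (state \<Rightarrow>\<^sub>0 int)" where
  "JM B b = (\<Sum>a\<in>{a\<in>B. a < b}. basis (edge a b))"

lemma mono_seqs_0: "mono_seqs B U 0 = {[]}"
  by (auto simp: mono_seqs_def)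

lemma mono_seqs_empty: "mono_seqs B {} (Suc r) = {}"
  by (fastforce simp: mono_seqs_def length_Suc_conv)

text \<open>If the least admissible larger endpoint \<open>b\<close> occurs at all, then it occurs
  in the first edge.\<close>

lemma mono_seqs_Suc:
  assumes "\<forall>c\<in>U. b < c"
  shows "mono_seqs B (insert b U) (Suc r) =
    (\<lambda>(a, ps). (a, b) # ps) ` ({a\<in>B. a < b} \<times> mono_seqs B (insert b U) r) \<union> mono_seqs B U (Suc r)" (is "?L = ?R")
proof
  show "?L \<subseteq> ?R"
  proof
    fix ps assume ps: "ps \<in> ?L"
    then obtain a c qs where ps_eq: "ps = (a, c) # qs" by (cases ps) (auto simp: mono_seqs_def)
    show "ps \<in> ?R"
    proof (cases "c = b")
      case True
      then show ?thesis using ps unfolding ps_eq by (auto simp: mono_seqs_def image_iff)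
    next
      case False
      then have "c \<in> U" using ps unfolding ps_eq by (auto simp: mono_seqs_def)
      then have "\<forall>(a', b')\<in>set ps. b' \<noteq> b" using ps assms unfolding ps_eq by (force simp: mono_seqs_def)
      then show ?thesis using ps by (auto simp: mono_seqs_def)
    qed
  qed
  show "?R \<subseteq> ?L"
    using assms by (auto simp: mono_seqs_def less_imp_le) (force simp: less_imp_le)+
qed

lemma csym_JM:
  assumes "finite B" "sorted_wrt (<) bs"
  shows "csym (JM B) bs r = (\<Sum>ps\<in>mono_seqs B (set bs) r. basis (state_of ps))"
  using assms(2)
proof (induction bs arbitrary: r)
  case Nil
  show ?case
    by (cases r) (simp_all add: mono_seqs_0 mono_seqs_empty)
next
  case (Cons b bs)
  show ?case
  proof (induction r)
    case 0
    then show ?case by (simp add: mono_seqs_0)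
  next
    case (Suc r)
    let ?f = "\<lambda>(a, ps). (a, b) # ps"
    let ?A = "{a\<in>B. a < b} \<times> mono_seqs B (set (b # bs)) r"
    have b: "\<forall>c\<in>set bs. b < c" using Cons by simp
    have disj: "?f ` ?A \<inter> mono_seqs B (set bs) (Suc r) = {}"
      using b by (auto simp: mono_seqs_def)
    have "(\<Sum>ps\<in>mono_seqs B (set (b # bs)) (Suc r). basis (state_of ps)) =
      (\<Sum>ps\<in>?f ` ?A. basis (state_of ps)) + (\<Sum>ps\<in>mono_seqs B (set bs) (Suc r). basis (state_of ps))"
      unfolding list.set(2) mono_seqs_Suc[OF b]
      using disj assms(1) by (intro sum.union_disjoint) (auto intro!: finite_imageI finite_cartesian_product finite_mono_seqs)
    also have "(\<Sum>ps\<in>?f ` ?A. basis (state_of ps)) = (\<Sum>(a, ps)\<in>?A. basis (edge a b) * basis (state_of ps))"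
      by (subst sum.reindex) (auto simp: inj_on_def basis_mult intro!: sum.cong)
    also have "\<dots> = JM B b * csym (JM B) (b # bs) r"
      unfolding Suc JM_def sum_product by (simp add: sum.cartesian_product)
    finally show ?case using Cons by simp
  qed
qed

text \<open>For neighbours u, v in \<open>B\<close>, the relations of \<open>csym_conj\<close> hold
  with D = \<open>basis (edge u v)\<close>. In the group algebra D would be S itself; here S has no
  edge while D does, and D * D is not 1, so every relation is checked with its edges.\<close>

lemma fact_count_conj_adjacent:
  assumes B: "finite B" "u \<in> B" "v \<in> B" "u < v" "\<forall>z\<in>B. \<not> (u < z \<and> z < v)"
  shows "fact_count r B (tr u v \<circ> p \<circ> tr u v) = fact_count r B p"
proof -
  let ?\<sigma> = "State (tr u v) UNIV"
  let ?S = "basis ?\<sigma>"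
  let ?bs = "sorted_list_of_set B"
  define pre where "pre = sorted_list_of_set {z\<in>B. z < u}"
  define post where "post = sorted_list_of_set {z\<in>B. v < z}"
  have pp: "set pre = {z\<in>B. z < u}" "set post = {z\<in>B. v < z}" unfolding pre_def post_def using B by auto
  have sorted: "sorted_wrt (<) (pre @ u # v # post)"
    using B pp unfolding pre_def post_def by (auto simp: sorted_wrt_append)
  have set: "set (pre @ u # v # post) = B" using B pp by (auto simp: not_less_iff_gr_or_eq)
  have S: "?S * ?S = 1"
    by (simp add: basis_mult plus_state_def flip: single_one) (simp add: zero_state_def)
  have conj: "?S * (\<Sum>a\<in>A. basis (f a)) * ?S = (\<Sum>a\<in>A. basis (?\<sigma> + f a + ?\<sigma>))" for A and f :: "'x \<Rightarrow> state"
    by (simp add: sum_distrib_left sum_distrib_right basis_mult)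
  have X: "?S * JM B b * ?S = JM B b" if "b \<in> set pre \<union> set post" for b
  proof -
    have b: "b \<noteq> u" "b \<noteq> v" "b < u \<or> v < b" using that pp B by auto
    have "?S * JM B b * ?S = (\<Sum>a\<in>{a\<in>B. a < b}. basis (edge (tr u v a) b))"
      unfolding JM_def conj edge_conj using b by simp
    also have "\<dots> = JM B b" unfolding JM_def
      using b B by (intro sum.reindex_bij_witness[of _ "tr u v" "tr u v"]) (auto simp: Transposition.transpose_def)
    finally show ?thesis .
  qed
  have below_v: "{a\<in>B. a < v} = insert u {a\<in>B. a < u}" using B by (auto simp: not_less_iff_gr_or_eq)
  have JM_v: "JM B v = basis (edge u v) + (\<Sum>a\<in>{a\<in>B. a < u}. basis (edge a v))"
    unfolding JM_def below_v using B by simp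
  have u: "?S * JM B u * ?S = JM B v - basis (edge u v)"
  proof -
    have "?S * JM B u * ?S = (\<Sum>a\<in>{a\<in>B. a < u}. basis (edge a v))"
      unfolding JM_def conj edge_conj using B by (intro sum.cong) (auto simp: Transposition.transpose_def)
    then show ?thesis unfolding JM_v by simp
  qed
  have v: "?S * JM B v * ?S = JM B u + basis (edge u v)"
  proof -
    have "?S * JM B v * ?S = (\<Sum>a\<in>insert u {a\<in>B. a < u}. basis (edge (tr u v a) (tr u v v)))"
      unfolding JM_def[of B v] conj edge_conj below_v ..
    also have "\<dots> = basis (edge v u) + (\<Sum>a\<in>{a\<in>B. a < u}. basis (edge (tr u v a) u))"
      using B by simp
    also have "(\<Sum>a\<in>{a\<in>B. a < u}. basis (edge (tr u v a) u)) = JM B u"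
      unfolding JM_def using B by (intro sum.cong) (auto simp: Transposition.transpose_def)
    finally show ?thesis by (simp add: edge_commute)
  qed
  have comm: "JM B u * JM B v = JM B v * JM B u"
  proof -
    \<comment> \<open>Moving the edge at \<open>u\<close> to the right relabels \<open>a'\<close> by
      \<open>tr a u\<close>, which permutes the points of \<open>B\<close> below
      \<open>v\<close>.\<close>
    have "edge a u + edge a' v = edge (tr a u a') v + edge a u" if "a < u" "a' < v" for a a'
    proof -
      have "tr a u \<circ> tr a' v = tr (tr a u a') v \<circ> tr a u"
        using tr_comp_tr[of a u a' v] that B(4) by simp
      moreover have "{C. a \<in> C \<longleftrightarrow> u \<in> C} \<inter> {C. a' \<in> C \<longleftrightarrow> v \<in> C} =
        {C. tr a u a' \<in> C \<longleftrightarrow> v \<in> C} \<inter> {C. a \<in> C \<longleftrightarrow> u \<in> C}"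
        by (cases "a' = a"; cases "a' = u") auto
      ultimately show ?thesis unfolding edge_plus_edge by (simp only:)
    qed
    then have "(\<Sum>a\<in>{a\<in>B. a < u}. \<Sum>a'\<in>{a\<in>B. a < v}. basis (edge a u + edge a' v)) =
      (\<Sum>a\<in>{a\<in>B. a < u}. \<Sum>a'\<in>{a\<in>B. a < v}. basis (edge (tr a u a') v + edge a u))"
      by (intro sum.cong refl) simp
    also have "\<dots> = (\<Sum>a\<in>{a\<in>B. a < u}. \<Sum>a'\<in>{a\<in>B. a < v}. basis (edge a' v + edge a u))"
    proof (rule sum.cong[OF refl])
      fix a assume "a \<in> {a\<in>B. a < u}"
      then show "(\<Sum>a'\<in>{a\<in>B. a < v}. basis (edge (tr a u a') v + edge a u)) = (\<Sum>a'\<in>{a\<in>B. a < v}. basis (edge a' v + edge a u))"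
        using B by (intro sum.reindex_bij_witness[of _ "tr a u" "tr a u"]) (auto simp: Transposition.transpose_def)
    qed
    finally show ?thesis unfolding JM_def sum_product basis_mult by (simp add: sum.swap[of _ "{a\<in>B. a < v}"])
  qed
  have D: "JM B v * basis (edge u v) - basis (edge u v) * JM B u = basis (edge u v) * basis (edge u v)"
  proof -
    have "edge a v + edge u v = edge u v + edge a u" if "a < u" for a
    proof -
      have "tr a v \<circ> tr u v = tr u v \<circ> tr a u"
        using tr_comp_tr[of u v a u] that B(4) by simp
      moreover have "{C. a \<in> C \<longleftrightarrow> v \<in> C} \<inter> {C. u \<in> C \<longleftrightarrow> v \<in> C} = {C. u \<in> C \<longleftrightarrow> v \<in> C} \<inter> {C. a \<in> C \<longleftrightarrow> u \<in> C}"
        by blast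
      ultimately show ?thesis unfolding edge_plus_edge by (simp only:)
    qed
    then have "(\<Sum>a\<in>{a\<in>B. a < u}. basis (edge a v)) * basis (edge u v) = basis (edge u v) * JM B u"
      unfolding JM_def sum_distrib_left sum_distrib_right basis_mult by (intro sum.cong refl) simp
    then show ?thesis unfolding JM_v by (simp add: distrib_right)
  qed
  have inv: "?S * csym (JM B) (pre @ u # v # post) r * ?S = csym (JM B) (pre @ u # v # post) r"
    by (rule csym_conj[OF S X u v comm D])
  let ?M = "mono_seqs B B r"
  have finM: "finite ?M" using B finite_mono_seqs by simp
  have eq: "(\<Sum>ps\<in>?M. basis (?\<sigma> + state_of ps + ?\<sigma>)) = (\<Sum>ps\<in>?M. basis (state_of ps))"
    using inv unfolding csym_JM[OF B(1) sorted] set conj .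
  have lookup: "Poly_Mapping.lookup (\<Sum>ps\<in>?M. basis (f ps)) k = int (card {ps\<in>?M. f ps = k})" for f k
  proof -
    have "{x \<in> ?M. k = f x} = {ps\<in>?M. f ps = k}" by auto
    then show ?thesis using finM by (simp add: lookup_sum lookup_single when_def sum.If_cases Int_def)
  qed
  \<comment> \<open>A coefficient counts the sequences with a given state, so equality in the
    algebra makes every property of states hold for equally many sequences before and after
    conjugation.\<close>
  have "image_mset (\<lambda>ps. ?\<sigma> + state_of ps + ?\<sigma>) (mset_set ?M) = mset_on state_of ?M"
  proof (rule multiset_eqI)
    fix k :: state
    have "count (mset_on f ?M) k = card {ps\<in>?M. f ps = k}" for f
    proof -
      have "f -` {k} \<inter> ?M = {ps\<in>?M. f ps = k}" by auto
      then show ?thesis using finM by (simp add: count_image_mset)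
    qed
    then show "count (image_mset (\<lambda>ps. ?\<sigma> + state_of ps + ?\<sigma>) (mset_set ?M)) k = count (mset_on state_of ?M) k"
      using arg_cong[OF eq, of "\<lambda>z. Poly_Mapping.lookup z k"] unfolding lookup by simp
  qed
  then have "size (filter_mset P (image_mset (\<lambda>ps. ?\<sigma> + state_of ps + ?\<sigma>) (mset_set ?M))) =
    size (filter_mset P (mset_on state_of ?M))" for P by simp
  then have card: "card {ps\<in>?M. P (?\<sigma> + state_of ps + ?\<sigma>)} = card {ps\<in>?M. P (state_of ps)}" for P
    using finM by (simp add: filter_mset_image_mset)
  have img: "tr u v ` C \<in> I \<longleftrightarrow> C \<in> (image (tr u v)) -` I" for C I by simp
  have inv2: "tr u v ` tr u v ` C = C" for C by (auto simp: image_iff transpose_eq_iff)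
  have Bimg: "tr u v ` B = B" using B by (intro tr_image_uncut) auto
  have sub: "B \<subseteq> tr u v ` C \<longleftrightarrow> B \<subseteq> C" for C
    by (metis Bimg inv2 image_mono)
  have dj: "B \<inter> tr u v ` C = {} \<longleftrightarrow> B \<inter> C = {}" for C
    by (metis Bimg inj_transpose image_Int image_is_empty)
  \<comment> \<open>\<open>tr u v\<close> maps \<open>B\<close> onto itself, so relabelling the
    family of uncut sets does not change whether \<open>B\<close> is connected.\<close>
  let ?P = "\<lambda>x. the_map x = tr u v \<circ> p \<circ> tr u v \<and> conn B (the_sets x)"
  have "?P (?\<sigma> + State q I + ?\<sigma>) \<longleftrightarrow> q = p \<and> conn B I" for q I
  proof -
    have "tr u v \<circ> q \<circ> tr u v = tr u v \<circ> p \<circ> tr u v \<longleftrightarrow> q = p"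
      by (metis comp_assoc transpose_comp_involutory comp_id id_comp)
    moreover have "conn B {C. tr u v ` C \<in> I} \<longleftrightarrow> conn B I"
      unfolding conn_def using sub dj inv2 by (metis mem_Collect_eq)
    ultimately show ?thesis by (simp add: plus_state_def)
  qed
  then have "card {ps\<in>?M. ?P (?\<sigma> + state_of ps + ?\<sigma>)} = fact_count r B p"
    unfolding state_of_eq fact_count_def by simp
  moreover have "card {ps\<in>?M. ?P (state_of ps)} = fact_count r B (tr u v \<circ> p \<circ> tr u v)"
    unfolding state_of_eq fact_count_def by simp
  ultimately show ?thesis using card[of ?P] by (simp only:)
qed

text \<open>If some z of \<open>B\<close> lies between u and v, then \<open>tr u v\<close> is the
  conjugate of \<open>tr z v\<close> by \<open>tr u z\<close>, both over shorter distances.\<close>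

lemma fact_count_conj:
  assumes B: "finite B" "u \<in> B" "v \<in> B"
  shows "fact_count r B (tr u v \<circ> p \<circ> tr u v) = fact_count r B p"
proof -
  have "fact_count r B (tr u v \<circ> p \<circ> tr u v) = fact_count r B p" if "u \<in> B" "v \<in> B" "u < v" for u v
    using that
  proof (induction "v - u" arbitrary: u v p rule: less_induct)
    case less
    show ?case
    proof (cases "\<exists>z\<in>B. u < z \<and> z < v")
      case False
      then show ?thesis using fact_count_conj_adjacent[OF B(1)] less.prems by blast
    next
      case True
      then obtain z where z: "z \<in> B" "u < z" "z < v" by blast
      have "tr u v = tr u z \<circ> tr z v \<circ> tr u z"
        using tr_conj[of u z z v] z by simp
      then have "tr u v \<circ> p \<circ> tr u v = tr u z \<circ> (tr z v \<circ> (tr u z \<circ> p \<circ> tr u z) \<circ> tr z v) \<circ> tr u z"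
        by (simp only: comp_assoc)
      then show ?thesis
        using less.hyps[of z u] less.hyps[of v z] less.prems z by simp
    qed
  qed
  then show ?thesis
    using B transpose_commute[of u v] by (cases u v rule: linorder_cases) (simp_all, metis)
qed

section \<open>Removing the last transposition\<close>

lemma uncut_append: "uncut (ps @ qs) = uncut ps \<inter> uncut qs"
  by (auto simp: uncut_def)

lemma uncut_filter: "C \<in> uncut ps \<Longrightarrow> C \<in> uncut (filter P ps)"
  by (auto simp: uncut_def)

lemma uncutD: "C \<in> uncut ps \<Longrightarrow> (a, b) \<in> set ps \<Longrightarrow> a \<in> C \<longleftrightarrow> b \<in> C"
  by (auto simp: uncut_def)

lemma uncutI: "(\<And>a b. (a, b) \<in> set ps \<Longrightarrow> a \<in> C \<longleftrightarrow> b \<in> C) \<Longrightarrow> C \<in> uncut ps"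
  by (auto simp: uncut_def)

lemma uncut_snoc: "C \<in> uncut (ps @ [(a, b)]) \<longleftrightarrow> C \<in> uncut ps \<and> (a \<in> C \<longleftrightarrow> b \<in> C)"
  by (auto simp: uncut_def)

lemma mono_seqsD:
  assumes "ps \<in> mono_seqs B U r"
  shows "length ps = r" "(a, b) \<in> set ps \<Longrightarrow> a \<in> B" "(a, b) \<in> set ps \<Longrightarrow> b \<in> U" "(a, b) \<in> set ps \<Longrightarrow> a < b"
    "sorted (map snd ps)"
  using assms by (auto simp: mono_seqs_def)

text \<open>Every edge lies inside C or inside its complement; dropping the latter keeps the action
  on C and makes it trivial elsewhere.\<close>

lemma tprod_filter:
  "C \<in> uncut qs \<Longrightarrow> tprod (filter (\<lambda>e. snd e \<in> C) qs) x = (if x \<in> C then tprod qs x else x)"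
proof (induction qs)
  case (Cons e qs)
  obtain a b where e: "e = (a, b)" by (cases e)
  have C: "C \<in> uncut qs" "a \<in> C \<longleftrightarrow> b \<in> C" using Cons.prems by (auto simp: uncut_def e)
  have IH: "tprod (filter (\<lambda>e. snd e \<in> C) qs) x = (if x \<in> C then tprod qs x else x)"
    using Cons.IH C(1) .
  have in_C: "tprod qs x \<in> C" if "x \<in> C" using tprod_image_uncut[OF C(1)] that by blast
  show ?case
  proof (cases "b \<in> C")
    case True
    then have "tr a b x = x" if "x \<notin> C" using C(2) that by (intro transpose_apply_other) auto
    then show ?thesis using True IH by (cases "x \<in> C") (simp_all add: e)
  next
    case False
    then have "tr a b (tprod qs x) = tprod qs x" if "x \<in> C"
      using C(2) in_C[OF that] by (intro transpose_apply_other) auto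
    then show ?thesis using False IH by (cases "x \<in> C") (simp_all add: e)
  qed
qed simp

lemma tprod_permutes:
  assumes "ps \<in> mono_seqs B B r"
  shows "tprod ps permutes B"
  using assms
proof (induction ps arbitrary: r)
  case (Cons e ps)
  obtain a b where e: "e = (a, b)" by (cases e)
  have "ps \<in> mono_seqs B B (length ps)" using Cons.prems by (auto simp: mono_seqs_def)
  then have "tprod ps permutes B" by (rule Cons.IH)
  moreover have "tr a b permutes B" using Cons.prems by (intro permutes_swap_id) (auto simp: mono_seqs_def e)
  ultimately show ?case unfolding e tprod_simps by (rule permutes_compose)
qed (simp add: permutes_id)

text \<open>The sequence is a shuffle of its edges inside and outside C. Monotonicity determines the
  shuffle: edges with equal larger endpoint lie on the same side, so a stable sort by this endpoint
  restores the sequence.\<close>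

lemma count_disconnected:
  assumes B: "finite B" "C \<subseteq> B" "p permutes B" "p ` C = C"
  shows "card {qs \<in> mono_seqs B B r. tprod qs = p \<and> C \<in> uncut qs \<and>
      conn C (uncut (filter (\<lambda>e. snd e \<in> C) qs)) \<and> conn (B - C) (uncut (filter (\<lambda>e. snd e \<notin> C) qs))} =
    (\<Sum>s\<le>r. fact_count s C (perm_restrict p C) * fact_count (r - s) (B - C) (perm_restrict p (B - C)))" (is "card ?L = _")
proof -
  define X where "X = (\<lambda>s. {ps \<in> mono_seqs C C s. tprod ps = perm_restrict p C \<and> conn C (uncut ps)})"
  define Y where "Y = (\<lambda>s. {ps \<in> mono_seqs (B - C) (B - C) s. tprod ps = perm_restrict p (B - C) \<and> conn (B - C) (uncut ps)})"
  define R where "R = (\<Union>s\<in>{..r}. X s \<times> Y (r - s))"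
  define f where "f = (\<lambda>qs :: (nat \<times> nat) list. (filter (\<lambda>e. snd e \<in> C) qs, filter (\<lambda>e. snd e \<notin> C) qs))"
  define g where "g = (\<lambda>(xs, ys). sort_key snd (xs @ ys :: (nat \<times> nat) list))"
  have finC: "finite C" using B finite_subset by blast
  have notC: "filter (\<lambda>e. snd e \<notin> C) qs = filter (\<lambda>e. snd e \<in> B - C) qs" if "qs \<in> mono_seqs B B r" for qs
    using that by (intro filter_cong) (auto simp: mono_seqs_def)
  have compl: "B - C \<in> uncut qs" if "qs \<in> mono_seqs B B r" "C \<in> uncut qs" for qs
    using mono_seqsD(2,3)[OF that(1)] uncutD[OF that(2)] unfolding uncut_def by blast
  have fL: "f qs \<in> R" if "qs \<in> ?L" for qs
  proof -
    let ?xs = "filter (\<lambda>e. snd e \<in> C) qs" and ?ys = "filter (\<lambda>e. snd e \<notin> C) qs"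
    have qs: "qs \<in> mono_seqs B B r" "tprod qs = p" "C \<in> uncut qs" "conn C (uncut ?xs)" "conn (B - C) (uncut ?ys)"
      using that by auto
    have len: "length ?xs + length ?ys = r" using qs(1) by (simp add: sum_length_filter_compl mono_seqs_def)
    have "tprod ?xs = perm_restrict p C"
      using tprod_filter[OF qs(3)] qs(2) by (auto simp: fun_eq_iff perm_restrict_def)
    moreover have "?xs \<in> mono_seqs C C (length ?xs)"
      using qs(1,3) by (auto simp: mono_seqs_def uncut_def sorted_filter)
    moreover have "tprod ?ys = perm_restrict p (B - C)"
      unfolding notC[OF qs(1)] using tprod_filter[OF compl[OF qs(1,3)]] qs(2) by (auto simp: fun_eq_iff perm_restrict_def)
    moreover have "?ys \<in> mono_seqs (B - C) (B - C) (length ?ys)"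
      using qs(1,3) by (auto simp: mono_seqs_def uncut_def sorted_filter)
    ultimately have "?xs \<in> X (length ?xs)" "?ys \<in> Y (r - length ?xs)"
      using qs(4,5) len unfolding X_def Y_def by auto
    then show ?thesis unfolding f_def R_def using len by auto
  qed
  have gf: "g (f qs) = qs" if "qs \<in> ?L" for qs
    unfolding f_def g_def prod.case
  proof (rule properties_for_sort_key)
    show "mset qs = mset (filter (\<lambda>e. snd e \<in> C) qs @ filter (\<lambda>e. snd e \<notin> C) qs)" by simp
    show "filter (\<lambda>x. snd k = snd x) qs = filter (\<lambda>x. snd k = snd x) (filter (\<lambda>e. snd e \<in> C) qs @ filter (\<lambda>e. snd e \<notin> C) qs)" for k
    proof (cases "snd k \<in> C")
      case True
      then have "filter (\<lambda>x. snd x \<in> C \<and> snd k = snd x) qs = filter (\<lambda>x. snd k = snd x) qs"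
        "filter (\<lambda>x. snd x \<notin> C \<and> snd k = snd x) qs = []"
        by (auto simp: filter_empty_conv intro!: filter_cong)
      then show ?thesis by simp
    next
      case False
      then have "filter (\<lambda>x. snd x \<notin> C \<and> snd k = snd x) qs = filter (\<lambda>x. snd k = snd x) qs"
        "filter (\<lambda>x. snd x \<in> C \<and> snd k = snd x) qs = []"
        by (auto simp: filter_empty_conv intro!: filter_cong)
      then show ?thesis by simp
    qed
    show "sorted (map snd qs)" using that by (auto simp: mono_seqs_def)
  qed
  have fg: "f z = (xs, ys)" "z \<in> ?L" if "xs \<in> X s" "ys \<in> Y (r - s)" "s \<le> r" "z = g (xs, ys)" for xs ys s z
  proof -
    have xs: "xs \<in> mono_seqs C C s" "tprod xs = perm_restrict p C" "conn C (uncut xs)" using that unfolding X_def by auto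
    have ys: "ys \<in> mono_seqs (B - C) (B - C) (r - s)" "tprod ys = perm_restrict p (B - C)" "conn (B - C) (uncut ys)"
      using that unfolding Y_def by auto
    have z: "z = sort_key snd (xs @ ys)" using that by (simp add: g_def)
    have "\<forall>e\<in>set xs. snd e \<in> C" "\<forall>e\<in>set ys. snd e \<notin> C"
      using mono_seqsD(3)[OF xs(1)] mono_seqsD(3)[OF ys(1)] by auto
    then have fC: "filter (\<lambda>e. snd e \<in> C) (xs @ ys) = xs" "filter (\<lambda>e. snd e \<notin> C) (xs @ ys) = ys"
      by (simp_all add: filter_empty_conv)
    have zx: "filter (\<lambda>e. snd e \<in> C) z = xs"
      unfolding z filter_sort fC using xs(1) by (simp add: mono_seqs_def sort_key_id_if_sorted)
    have zy: "filter (\<lambda>e. snd e \<notin> C) z = ys"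
      unfolding z filter_sort fC using ys(1) by (simp add: mono_seqs_def sort_key_id_if_sorted)
    show "f z = (xs, ys)" by (simp add: f_def zx zy)
    have zB: "z \<in> mono_seqs B B r"
      using xs(1) ys(1) that(3) B(2) unfolding z by (auto simp: mono_seqs_def)
    have zC: "C \<in> uncut z" using xs(1) ys(1) unfolding z by (auto simp: mono_seqs_def uncut_def)
    have "tprod z x = p x" for x
    proof -
      consider "x \<in> C" | "x \<in> B - C" | "x \<notin> B" by blast
      then show ?thesis
      proof cases
        case 1
        then show ?thesis using tprod_filter[OF zC, of x] xs(2) by (simp add: zx perm_restrict_def)
      next
        case 2
        then show ?thesis using tprod_filter[OF compl[OF zB zC], of x] ys(2)
          by (simp add: zy notC[OF zB, symmetric] perm_restrict_def del: Diff_iff)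
      next
        case 3
        then show ?thesis using tprod_permutes[OF zB] B(3) by (simp add: permutes_not_in)
      qed
    qed
    then show "z \<in> ?L" using zB zC xs(3) ys(3) zx zy by auto
  qed
  have "bij_betw f ?L R"
  proof (rule bij_betw_byWitness[where f' = g])
    show "\<forall>qs\<in>?L. g (f qs) = qs" using gf by blast
    show "\<forall>z\<in>R. f (g z) = z" using fg(1)[OF _ _ _ refl] unfolding R_def by auto
    show "f ` ?L \<subseteq> R" using fL by blast
    show "g ` R \<subseteq> ?L" using fg(2)[OF _ _ _ refl] unfolding R_def by auto
  qed
  then have "card ?L = card R" by (rule bij_betw_same_card)
  also have "card R = (\<Sum>s\<le>r. card (X s \<times> Y (r - s)))"
    unfolding R_def
  proof (rule card_UN_disjoint)
    show "\<forall>s\<in>{..r}. finite (X s \<times> Y (r - s))"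
    proof
      fix s
      have "finite (mono_seqs C C s)" "finite (mono_seqs (B - C) (B - C) (r - s))"
        using finC B by (auto intro!: finite_mono_seqs)
      then show "finite (X s \<times> Y (r - s))" unfolding X_def Y_def by simp
    qed
    show "\<forall>s\<in>{..r}. \<forall>t\<in>{..r}. s \<noteq> t \<longrightarrow> (X s \<times> Y (r - s)) \<inter> (X t \<times> Y (r - t)) = {}"
      unfolding X_def by (auto simp: mono_seqs_def)
  qed simp
  also have "\<dots> = (\<Sum>s\<le>r. fact_count s C (perm_restrict p C) * fact_count (r - s) (B - C) (perm_restrict p (B - C)))"
    unfolding card_cartesian_product X_def Y_def fact_count_def ..
  finally show ?thesis .
qed

lemma conn_mono: "conn B I \<Longrightarrow> J \<subseteq> I \<Longrightarrow> conn B J"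
  by (auto simp: conn_def)

text \<open>Without one edge, a connected graph has at most two components; if there are two, C is
  the one that contains m.\<close>

lemma conn_remove_edge:
  assumes qs: "qs \<in> mono_seqs B B r" and am: "a \<in> B" "m \<in> B"
  shows "conn B (uncut (qs @ [(a, m)])) \<and> \<not> conn B (uncut qs) \<longleftrightarrow>
    (\<exists>C. C \<subseteq> B \<and> m \<in> C \<and> a \<notin> C \<and> C \<in> uncut qs \<and>
      conn C (uncut (filter (\<lambda>e. snd e \<in> C) qs)) \<and> conn (B - C) (uncut (filter (\<lambda>e. snd e \<notin> C) qs)))" (is "?L \<longleftrightarrow> ?R")
proof
  assume L: ?L
  then obtain C0 where C0: "C0 \<in> uncut qs" "\<not> B \<subseteq> C0" "B \<inter> C0 \<noteq> {}"
    unfolding conn_def by blast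
  define C where "C = (if m \<in> C0 then B \<inter> C0 else B - C0)"
  have C: "C \<subseteq> B" "m \<in> C" "C \<noteq> B" using C0 am unfolding C_def by auto
  have CU: "C \<in> uncut qs"
  proof (rule uncutI)
    fix x y assume xy: "(x, y) \<in> set qs"
    then show "x \<in> C \<longleftrightarrow> y \<in> C"
      using uncutD[OF C0(1) xy] mono_seqsD(2,3)[OF qs xy] unfolding C_def by simp
  qed
  \<comment> \<open>A nonempty union of components avoiding both ends of the removed edge would
    still be cut off after restoring it. This forces both C and its complement to be
    connected.\<close>
  have small: "E = {}" if "E \<subseteq> B" "E \<in> uncut qs" "a \<notin> E" "m \<notin> E" for E
  proof -
    have "E \<in> uncut (qs @ [(a, m)])" using that by (simp add: uncut_snoc)
    then have "B \<subseteq> E \<or> B \<inter> E = {}" using L unfolding conn_def by blast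
    then show ?thesis using that am by blast
  qed
  have a: "a \<notin> C"
  proof
    assume "a \<in> C"
    then have "C \<in> uncut (qs @ [(a, m)])" using C CU by (simp add: uncut_snoc)
    then have "B \<subseteq> C \<or> B \<inter> C = {}" using L unfolding conn_def by blast
    then show False using C am by blast
  qed
  have "conn C (uncut (filter (\<lambda>e. snd e \<in> C) qs))"
    unfolding conn_def
  proof
    fix D assume D: "D \<in> uncut (filter (\<lambda>e. snd e \<in> C) qs)"
    have "x \<in> D \<longleftrightarrow> y \<in> D" if "(x, y) \<in> set qs" "y \<in> C" for x y
      using uncutD[OF D, of x y] that by simp
    note e = this uncutD[OF CU]
    have "C - D \<in> uncut qs" by (rule uncutI) (use e in blast)
    moreover have "C \<inter> D \<in> uncut qs" by (rule uncutI) (use e in blast)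
    ultimately show "C \<subseteq> D \<or> C \<inter> D = {}"
      using small[of "C - D"] small[of "C \<inter> D"] C(1,2) a by blast
  qed
  moreover have "conn (B - C) (uncut (filter (\<lambda>e. snd e \<notin> C) qs))"
    unfolding conn_def
  proof
    fix D assume D: "D \<in> uncut (filter (\<lambda>e. snd e \<notin> C) qs)"
    have "x \<in> D \<longleftrightarrow> y \<in> D" if "(x, y) \<in> set qs" "y \<notin> C" for x y
      using uncutD[OF D, of x y] that by simp
    note e = this uncutD[OF CU] mono_seqsD(2,3)[OF qs]
    have "B - C - D \<in> uncut qs" by (rule uncutI) (use e in blast)
    moreover have "(B - C) \<inter> D \<in> uncut qs" by (rule uncutI) (use e in blast)
    ultimately show "B - C \<subseteq> D \<or> (B - C) \<inter> D = {}"
      using small[of "B - C - D"] small[of "(B - C) \<inter> D"] C(2) by blast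
  qed
  ultimately show ?R using C CU a by blast
next
  assume ?R
  then obtain C where C: "C \<subseteq> B" "m \<in> C" "a \<notin> C" "C \<in> uncut qs"
    "conn C (uncut (filter (\<lambda>e. snd e \<in> C) qs))" "conn (B - C) (uncut (filter (\<lambda>e. snd e \<notin> C) qs))" by blast
  have "conn B (uncut (qs @ [(a, m)]))"
    unfolding conn_def
  proof
    fix E assume E: "E \<in> uncut (qs @ [(a, m)])"
    then have EU: "E \<in> uncut qs" and "a \<in> E \<longleftrightarrow> m \<in> E" by (simp_all add: uncut_snoc)
    have "C \<subseteq> E \<or> C \<inter> E = {}"
      by (rule C(5)[unfolded conn_def, rule_format], rule uncut_filter) fact
    moreover have "B - C \<subseteq> E \<or> (B - C) \<inter> E = {}"
      by (rule C(6)[unfolded conn_def, rule_format], rule uncut_filter) fact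
    ultimately show "B \<subseteq> E \<or> B \<inter> E = {}" using \<open>a \<in> E \<longleftrightarrow> m \<in> E\<close> C am by blast
  qed
  moreover have "\<not> conn B (uncut qs)" using C am unfolding conn_def by blast
  ultimately show ?L by blast
qed

text \<open>Connectedness makes the maximum an endpoint of some edge, necessarily the larger one,
  and monotonicity then makes it the larger endpoint of the last edge.\<close>

lemma fact_count_Suc:
  assumes B: "finite B" "B \<noteq> {}" and m: "m = Max B" and p: "p permutes B"
  shows "fact_count (Suc r) B p = (\<Sum>a\<in>B - {m}. fact_count r B (p \<circ> tr a m) +
    (\<Sum>C\<in>{C. C \<subseteq> B \<and> m \<in> C \<and> a \<notin> C \<and> (p \<circ> tr a m) ` C = C}. \<Sum>s\<le>r.
      fact_count s C (perm_restrict (p \<circ> tr a m) C) * fact_count (r - s) (B - C) (perm_restrict (p \<circ> tr a m) (B - C))))"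
proof -
  have mB: "m \<in> B" "\<And>x. x \<in> B \<Longrightarrow> x \<le> m" using B m by auto
  define A where "A = (\<lambda>a. {qs \<in> mono_seqs B B r. tprod qs = p \<circ> tr a m \<and> conn B (uncut (qs @ [(a, m)]))})"
  have "{ps \<in> mono_seqs B B (Suc r). tprod ps = p \<and> conn B (uncut ps)} = (\<Union>a\<in>B - {m}. (\<lambda>qs. qs @ [(a, m)]) ` A a)" (is "?L = ?R")
  proof
    show "?L \<subseteq> ?R"
    proof
      fix ps assume ps: "ps \<in> ?L"
      then have "ps \<noteq> []" by (auto simp: mono_seqs_def)
      then obtain qs a b where ps_eq: "ps = qs @ [(a, b)]" by (metis append_butlast_last_id surj_pair)
      have ab: "a \<in> B" "b \<in> B" "a < b" using ps by (auto simp: ps_eq mono_seqs_def)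
      have "\<not> B \<subseteq> {m}" using ab by auto
      then have "{m} \<notin> uncut ps" using ps mB(1) by (auto simp: conn_def)
      then obtain x y where "(x, y) \<in> set ps" "x = m \<longleftrightarrow> y \<noteq> m" by (auto simp: uncut_def)
      moreover then have "x \<in> B" "y \<in> B" "x < y" using ps by (auto simp: mono_seqs_def)
      ultimately have "(x, m) \<in> set ps" using mB(2)[of y] by auto
      then have "m \<le> b" using ps unfolding ps_eq by (auto simp: mono_seqs_def sorted_append)
      then have "b = m" using mB(2)[OF ab(2)] by simp
      have "qs \<in> A a"
      proof -
        have "tprod qs \<circ> tr a m = p" using ps \<open>b = m\<close> by (simp add: ps_eq tprod_append)
        then have "tprod qs = p \<circ> tr a m" by (auto simp: comp_assoc)
        then show ?thesis using ps \<open>b = m\<close> by (auto simp: A_def ps_eq mono_seqs_def sorted_append)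
      qed
      then show "ps \<in> ?R" using ab \<open>b = m\<close> by (auto simp: ps_eq)
    qed
    show "?R \<subseteq> ?L"
    proof
      fix ps assume "ps \<in> ?R"
      then obtain a qs where a: "a \<in> B" "a \<noteq> m" "qs \<in> A a" "ps = qs @ [(a, m)]" by auto
      have "a < m" using mB(2)[OF a(1)] a(2) by simp
      then show "ps \<in> ?L" using a mB unfolding A_def
        by (auto simp: mono_seqs_def sorted_append tprod_append comp_assoc)
    qed
  qed
  then have "fact_count (Suc r) B p = card (\<Union>a\<in>B - {m}. (\<lambda>qs. qs @ [(a, m)]) ` A a)"
    by (simp add: fact_count_def)
  also have "\<dots> = (\<Sum>a\<in>B - {m}. card ((\<lambda>qs. qs @ [(a, m)]) ` A a))"
    using B unfolding A_def by (intro card_UN_disjoint) (auto intro!: finite_imageI finite_mono_seqs)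
  also have "\<dots> = (\<Sum>a\<in>B - {m}. card (A a))"
    by (intro sum.cong refl card_image) (auto simp: inj_on_def)
  also have "\<dots> = (\<Sum>a\<in>B - {m}. fact_count r B (p \<circ> tr a m) +
    (\<Sum>C\<in>{C. C \<subseteq> B \<and> m \<in> C \<and> a \<notin> C \<and> (p \<circ> tr a m) ` C = C}. \<Sum>s\<le>r.
      fact_count s C (perm_restrict (p \<circ> tr a m) C) * fact_count (r - s) (B - C) (perm_restrict (p \<circ> tr a m) (B - C))))"
  proof (rule sum.cong[OF refl])
    fix a assume a: "a \<in> B - {m}"
    let ?p = "p \<circ> tr a m"
    have p': "?p permutes B" using a mB p by (intro permutes_compose permutes_swap_id) auto
    define E where "E = {qs \<in> mono_seqs B B r. tprod qs = ?p \<and> conn B (uncut qs)}"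
    define D where "D = (\<lambda>C. {qs \<in> mono_seqs B B r. tprod qs = ?p \<and> C \<in> uncut qs \<and>
      conn C (uncut (filter (\<lambda>e. snd e \<in> C) qs)) \<and> conn (B - C) (uncut (filter (\<lambda>e. snd e \<notin> C) qs))})"
    define K where "K = {C. C \<subseteq> B \<and> m \<in> C \<and> a \<notin> C \<and> ?p ` C = C}"
    have finK: "finite K" using B unfolding K_def by auto
    have finM: "finite (mono_seqs B B r)" using B finite_mono_seqs by blast
    have A: "A a = E \<union> (\<Union>C\<in>K. D C)"
    proof
      show "A a \<subseteq> E \<union> (\<Union>C\<in>K. D C)"
      proof
        fix qs assume qs: "qs \<in> A a"
        show "qs \<in> E \<union> (\<Union>C\<in>K. D C)"
        proof (cases "conn B (uncut qs)")
          case True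
          then show ?thesis using qs by (simp add: A_def E_def)
        next
          case False
          then obtain C where "C \<subseteq> B \<and> m \<in> C \<and> a \<notin> C \<and> C \<in> uncut qs \<and>
            conn C (uncut (filter (\<lambda>e. snd e \<in> C) qs)) \<and> conn (B - C) (uncut (filter (\<lambda>e. snd e \<notin> C) qs))"
            using conn_remove_edge[of qs B r a m] qs a mB(1) unfolding A_def by auto
          then show ?thesis using qs tprod_image_uncut[of C qs] by (auto simp: A_def D_def K_def)
        qed
      qed
      show "E \<union> (\<Union>C\<in>K. D C) \<subseteq> A a"
      proof
        fix qs assume "qs \<in> E \<union> (\<Union>C\<in>K. D C)"
        then consider "qs \<in> E" | C where "C \<in> K" "qs \<in> D C" by blast
        then show "qs \<in> A a"
        proof cases
          case 1
          then show ?thesis using conn_mono[of B "uncut qs"] by (auto simp: A_def E_def uncut_append)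
        next
          case 2
          then have "conn B (uncut (qs @ [(a, m)]))"
            using conn_remove_edge[of qs B r a m] a mB(1) unfolding K_def D_def by blast
          then show ?thesis using 2 by (simp add: A_def D_def)
        qed
      qed
    qed
    have "E \<inter> (\<Union>C\<in>K. D C) = {}"
    proof -
      have "qs \<notin> E" if "C \<in> K" "qs \<in> D C" for C qs
        using conn_remove_edge[of qs B r a m] a mB(1) that unfolding K_def D_def E_def by blast
      then show ?thesis by blast
    qed
    then have "card (A a) = card E + card (\<Union>C\<in>K. D C)"
      unfolding A using finK finM by (intro card_Un_disjoint) (auto simp: E_def D_def)
    also have "card E = fact_count r B ?p" by (simp add: E_def fact_count_def)
    also have "card (\<Union>C\<in>K. D C) = (\<Sum>C\<in>K. card (D C))"
    proof (rule card_UN_disjoint[OF finK])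
      show "\<forall>C\<in>K. finite (D C)" using finM by (auto simp: D_def)
      show "\<forall>C\<in>K. \<forall>C'\<in>K. C \<noteq> C' \<longrightarrow> D C \<inter> D C' = {}"
      proof (intro ballI impI, rule ccontr)
        fix C C' assume C: "C \<in> K" "C' \<in> K" "C \<noteq> C'" "D C \<inter> D C' \<noteq> {}"
        then obtain qs where qs: "qs \<in> D C" "qs \<in> D C'" by blast
        \<comment> \<open>Both sets contain m, and neither can cut the other one, which is
          connected.\<close>
        have "C \<subseteq> C'" if "qs \<in> D C" "qs \<in> D C'" "C \<in> K" "C' \<in> K" for C C'
        proof -
          have "C' \<in> uncut (filter (\<lambda>e. snd e \<in> C) qs)" using that(2) by (auto simp: D_def intro: uncut_filter)
          then have "C \<subseteq> C' \<or> C \<inter> C' = {}" using that(1) unfolding D_def conn_def by blast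
          then show ?thesis using that(3,4) unfolding K_def by blast
        qed
        then show False using qs C by blast
      qed
    qed
    also have "\<dots> = (\<Sum>C\<in>K. \<Sum>s\<le>r. fact_count s C (perm_restrict ?p C) * fact_count (r - s) (B - C) (perm_restrict ?p (B - C)))"
      unfolding D_def using B(1) p' by (intro sum.cong refl count_disconnected) (auto simp: K_def)
    finally show "card (A a) = fact_count r B ?p + (\<Sum>C\<in>{C. C \<subseteq> B \<and> m \<in> C \<and> a \<notin> C \<and> ?p ` C = C}. \<Sum>s\<le>r.
      fact_count s C (perm_restrict ?p C) * fact_count (r - s) (B - C) (perm_restrict ?p (B - C)))"
      unfolding K_def .
  qed
  finally show ?thesis .
qed

section \<open>The recursion in terms of cycle types\<close>

lemma orbit_period:
  assumes "(f ^^ i) a = a" "0 < i"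
  shows "orbit f a = (\<lambda>j. (f ^^ j) a) ` {1..i}"
proof -
  have "orbit f a = {(f ^^ m) a | m. m < i}" by (rule orbit_altdef_bounded[OF assms])
  also have "\<dots> = (\<lambda>j. (f ^^ j) a) ` {0..<i}" by auto
  also have "{0..<i} = insert 0 {1..<i}" using assms by auto
  also have "(\<lambda>j. (f ^^ j) a) ` insert 0 {1..<i} = (\<lambda>j. (f ^^ j) a) ` insert i {1..<i}" using assms by simp
  also have "insert i {1..<i} = {1..i}" using assms by auto
  finally show ?thesis .
qed

lemma permutation_cycle:
  fixes x :: 'a
  assumes "permutation p"
  defines "k \<equiv> card (orbit p x)"
  shows "(p ^^ k) x = x" "0 < k" "inj_on (\<lambda>j. (p ^^ j) x) {0..<k}"
proof -
  have x: "x \<in> orbit p x" using assms(1) by (rule permutation_self_in_orbit)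
  have inj: "inj_on (\<lambda>j. (p ^^ j) x) {0..<funpow_dist1 p x x}" using x by (rule inj_on_funpow_dist1)
  then have k: "k = funpow_dist1 p x x"
    unfolding k_def using orbit_conv_funpow_dist1[OF x] card_image by fastforce
  show "(p ^^ k) x = x" unfolding k using x by (rule funpow_dist1_prop)
  show "0 < k" unfolding k by simp
  show "inj_on (\<lambda>j. (p ^^ j) x) {0..<k}" unfolding k by (rule inj)
qed

lemma orbit_powers:
  fixes x :: 'a
  assumes "permutation p"
  defines "k \<equiv> card (orbit p x)"
  shows "orbit p x = (\<lambda>j. (p ^^ j) x) ` {1..k}" "inj_on (\<lambda>j. (p ^^ j) x) {1..k}"
proof -
  note c = permutation_cycle[OF assms(1), of x, folded k_def]
  show 1: "orbit p x = (\<lambda>j. (p ^^ j) x) ` {1..k}" using c by (intro orbit_period)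
  show "inj_on (\<lambda>j. (p ^^ j) x) {1..k}"
    by (rule eq_card_imp_inj_on) (simp, simp only: 1[symmetric], simp add: k_def)
qed

lemma orbit_minus_self:
  assumes "permutation p"
  shows "bij_betw (\<lambda>j. (p ^^ j) x) {1..<card (orbit p x)} (orbit p x - {x})"
proof -
  let ?k = "card (orbit p x)"
  note c = permutation_cycle[OF assms, of x] and o = orbit_powers[OF assms, of x]
  have "{1..?k} = insert ?k {1..<?k}" using c(2) by auto
  then have 1: "orbit p x = insert x ((\<lambda>j. (p ^^ j) x) ` {1..<?k})" using o(1) c(1) by simp
  have 2: "x \<notin> (\<lambda>j. (p ^^ j) x) ` {1..<?k}"
  proof
    assume "x \<in> (\<lambda>j. (p ^^ j) x) ` {1..<?k}"
    then obtain j where "j \<in> {1..<?k}" "(p ^^ j) x = (p ^^ 0) x" by auto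
    then show False using inj_onD[OF c(3), of j 0] by auto
  qed
  have "inj_on (\<lambda>j. (p ^^ j) x) {1..<?k}" using o(2) by (rule inj_on_subset) auto
  moreover have "(\<lambda>j. (p ^^ j) x) ` {1..<?k} = orbit p x - {x}"
    by (rule trans[OF arg_cong[OF 1, of "\<lambda>A. A - {x}"] Diff_insert_absorb[OF 2], symmetric])
  ultimately show ?thesis unfolding bij_betw_def by (rule conjI)
qed

lemma orbit_eq_iff: "permutation p \<Longrightarrow> y \<in> orbit p x \<Longrightarrow> orbit p y = orbit p x"
  using cyclic_on_orbit' orbit_cyclic_eq3 by metis

lemma orbits_disjoint: "permutation p \<Longrightarrow> orbit p x \<noteq> orbit p y \<Longrightarrow> orbit p x \<inter> orbit p y = {}"
  by (metis disjoint_iff orbit_eq_iff)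

text \<open>The new permutation maps a to the image of m and m to the image of a. So a runs through
  the iterates 1 to i of m, and m through the remaining ones.\<close>

lemma orbit_cut:
  assumes p: "permutation p" and i: "1 \<le> i" "i < card (orbit p m)"
  defines "a \<equiv> (p ^^ i) m" and "q \<equiv> p \<circ> tr ((p ^^ i) m) m"
  shows "card (orbit q a) = i" "card (orbit q m) = card (orbit p m) - i"
    "orbit q a \<union> orbit q m = orbit p m" "orbit q a \<inter> orbit q m = {}"
proof -
  define P where "P = (\<lambda>j. (p ^^ j) m)"
  define k where "k = card (orbit p m)"
  have op: "orbit p m = P ` {1..k}" and inj: "inj_on P {1..k}"
    using orbit_powers[OF p, of m] by (simp_all add: P_def k_def)
  have Pk: "P k = m" using permutation_cycle(1)[OF p, of m] by (simp add: P_def k_def)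
  have ik: "1 \<le> i" "i < k" using i by (simp_all add: k_def)
  have Pa: "P i = a" by (simp add: P_def a_def)
  have q: "q = p \<circ> tr a m" by (simp add: q_def a_def)
  have P_Suc: "p (P j) = P (Suc j)" for j by (simp add: P_def)
  have P0: "P 0 = m" by (simp add: P_def)
  have q_P: "q (P j) = P (Suc j)" if "1 \<le> j" "j < k" "j \<noteq> i" for j
  proof -
    have "P j \<noteq> a" using inj_onD[OF inj, of j i] that ik Pa by auto
    moreover have "P j \<noteq> m" using inj_onD[OF inj, of j k] that ik Pk by auto
    ultimately show ?thesis by (simp add: q P_Suc)
  qed
  have A: "(q ^^ Suc j) a = P (Suc j)" if "Suc j \<le> i" for j
    using that
  proof (induction j)
    case 0
    then show ?case using P_Suc[of 0] P0 by (simp add: q)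
  next
    case (Suc j)
    then show ?case using q_P[of "Suc j"] ik by simp
  qed
  have M: "(q ^^ Suc j) m = P (i + Suc j)" if "Suc j \<le> k - i" for j
    using that
  proof (induction j)
    case 0
    then show ?case using P_Suc[of i] Pa by (simp add: q)
  next
    case (Suc j)
    then show ?case using q_P[of "i + Suc j"] ik by simp
  qed
  have oa: "orbit q a = P ` {1..i}"
  proof -
    obtain i' where i': "i = Suc i'" using ik by (cases i) auto
    have "orbit q a = (\<lambda>j. (q ^^ j) a) ` {1..i}"
      using A[of i'] Pa i' by (intro orbit_period) simp_all
    also have "\<dots> = P ` {1..i}"
    proof (rule image_cong[OF refl])
      fix j assume "j \<in> {1..i}"
      then show "(q ^^ j) a = P j" using A[of "j - 1"] by simp
    qed
    finally show ?thesis .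
  qed
  have om: "orbit q m = P ` {i + 1..k}"
  proof -
    obtain d where d: "k - i = Suc d" using ik by (cases "k - i") auto
    have "(q ^^ (k - i)) m = m" using M[of d] Pk ik d by (metis le_refl le_add_diff_inverse less_imp_le_nat)
    then have "orbit q m = (\<lambda>j. (q ^^ j) m) ` {1..k - i}"
      using d by (intro orbit_period) simp_all
    also have "\<dots> = (\<lambda>j. P (i + j)) ` {1..k - i}"
    proof (rule image_cong[OF refl])
      fix j assume "j \<in> {1..k - i}"
      then show "(q ^^ j) m = P (i + j)" using M[of "j - 1"] by simp
    qed
    also have "\<dots> = P ` ((+) i ` {1..k - i})" by (simp only: image_image)
    also have "(+) i ` {1..k - i} = {i + 1..k}" using ik by (simp add: image_add_atLeastAtMost)
    finally show ?thesis .
  qed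
  have sub: "{1..i} \<subseteq> {1..k}" "{i + 1..k} \<subseteq> {1..k}" using ik by auto
  show "card (orbit q a) = i" unfolding oa by (subst card_image[OF inj_on_subset[OF inj sub(1)]]) simp
  show "card (orbit q m) = card (orbit p m) - i"
    unfolding om k_def[symmetric] by (subst card_image[OF inj_on_subset[OF inj sub(2)]]) simp
  have "{1..k} = {1..i} \<union> {i + 1..k}" using ik by auto
  then show "orbit q a \<union> orbit q m = orbit p m" unfolding oa om op by (simp add: image_Un)
  show "orbit q a \<inter> orbit q m = {}"
    unfolding oa om using inj_on_image_Int[OF inj sub] by simp
qed

lemma permutation_comp_tr: "permutation p \<Longrightarrow> permutation (p \<circ> tr a m)"
  by (intro permutation_compose permutation_swap_id)

lemma orbit_comp_tr_other:
  assumes "permutation p" "x \<notin> orbit p a" "x \<notin> orbit p m"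
  shows "orbit (p \<circ> tr a m) x = orbit p x"
proof (rule orbit_cong)
  show "x \<in> orbit p x" using assms(1) by (rule permutation_self_in_orbit)
  fix s assume s: "s \<in> orbit p x"
  have "s \<noteq> a" "s \<noteq> m" using orbit_eq_iff[OF assms(1) s] assms permutation_self_in_orbit[OF assms(1), of x] by auto
  then show "(p \<circ> tr a m) s = p s" by simp
qed

text \<open>Following m under q leads through the cycle of a. Once a lies in the new orbit of m, the
  same transposition cuts it back into the old orbits, and \<open>orbit_cut\<close> applies to
  q.\<close>

lemma orbit_join:
  assumes p: "permutation p" and a: "a \<notin> orbit p m"
  defines "q \<equiv> p \<circ> tr a m"
  shows "orbit q m = orbit p a \<union> orbit p m" "orbit q a = orbit p a \<union> orbit p m"
proof -
  have q: "permutation q" unfolding q_def using p by (rule permutation_comp_tr)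
  define k where "k = card (orbit p a)"
  have c: "(p ^^ k) a = a" "0 < k" "inj_on (\<lambda>j. (p ^^ j) a) {0..<k}"
    using permutation_cycle[OF p, of a] by (simp_all add: k_def)
  have self: "x \<in> orbit p x" for x using p by (rule permutation_self_in_orbit)
  have neq: "a \<noteq> m" using a self by auto
  have A: "(q ^^ Suc j) m = (p ^^ Suc j) a" if "Suc j \<le> k" for j
    using that
  proof (induction j)
    case 0
    then show ?case by (simp add: q_def)
  next
    case (Suc j)
    have "(p ^^ Suc j) a \<noteq> a" using inj_onD[OF c(3), of "Suc j" 0] Suc.prems by auto
    moreover have "(p ^^ Suc j) a \<noteq> m"
    proof
      assume "(p ^^ Suc j) a = m"
      then have "m \<in> orbit p a" using funpow_in_orbit[OF self[of a], of "Suc j"] by simp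
      then show False using orbit_eq_iff[OF p] a self by metis
    qed
    ultimately have "q ((p ^^ Suc j) a) = p ((p ^^ Suc j) a)" by (simp add: q_def)
    then show ?case using Suc by simp
  qed
  obtain k' where "k = Suc k'" using c by (cases k) auto
  then have "(q ^^ k) m = a" using A[of k'] c by simp
  then have a_in: "a \<in> orbit q m" using funpow_in_orbit[OF permutation_self_in_orbit[OF q], of k m] by simp
  then have "a \<in> orbit q m - {m}" using neq by simp
  then have "a \<in> (\<lambda>j. (q ^^ j) m) ` {1..<card (orbit q m)}"
    unfolding bij_betw_imp_surj_on[OF orbit_minus_self[OF q, of m]] .
  then obtain j where j: "a = (q ^^ j) m" "j \<in> {1..<card (orbit q m)}" by (rule imageE)
  then obtain i where i: "1 \<le> i" "i < card (orbit q m)" "(q ^^ i) m = a"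
    using that[of j] by simp
  have "q \<circ> tr a m = p" by (simp add: q_def comp_assoc)
  then show 1: "orbit q m = orbit p a \<union> orbit p m"
    using orbit_cut(3)[OF q i(1,2)] i(3) by simp
  then show "orbit q a = orbit p a \<union> orbit p m" using orbit_eq_iff[OF q a_in] by simp
qed

section \<open>Cycle types after a cut or a join\<close>

definition cycles :: "nat set \<Rightarrow> (nat \<Rightarrow> nat) \<Rightarrow> nat set set" where
  "cycles B p = orbit p ` B"

definition ctype :: "nat set \<Rightarrow> (nat \<Rightarrow> nat) \<Rightarrow> nat multiset" where
  "ctype B p = mset_on card (cycles B p)"

lemma permutes_permutation: "finite B \<Longrightarrow> p permutes B \<Longrightarrow> permutation p"
  using permutation_permutes by blast

lemma cycles_minus_2:
  assumes "permutation p" "a \<in> B" "m \<in> B"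
  shows "cycles B p - {orbit p a, orbit p m} = orbit p ` (B - (orbit p a \<union> orbit p m))"
  unfolding cycles_def using orbit_eq_iff[OF assms(1)] permutation_self_in_orbit[OF assms(1)] by blast

lemma cycles_other:
  assumes p: "permutation p" "a \<in> B" "m \<in> B"
    and Z: "orbit (p \<circ> tr a m) a \<union> orbit (p \<circ> tr a m) m = orbit p a \<union> orbit p m"
  shows "cycles B (p \<circ> tr a m) - {orbit (p \<circ> tr a m) a, orbit (p \<circ> tr a m) m} = cycles B p - {orbit p a, orbit p m}"
  unfolding cycles_minus_2[OF p] cycles_minus_2[OF permutation_comp_tr[OF p(1)] p(2,3)] Z
  using orbit_comp_tr_other[OF p(1)] by (intro image_cong) auto

lemma finite_cycles: "finite B \<Longrightarrow> finite (cycles B p)"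
  by (simp add: cycles_def)

lemma ctype_split:
  assumes "finite B" "x \<in> B"
  shows "ctype B p = add_mset (card (orbit p x)) (mset_on card (cycles B p - {orbit p x}))"
proof -
  have "orbit p x \<in> cycles B p" using assms by (simp add: cycles_def)
  then show ?thesis unfolding ctype_def using assms finite_cycles[of B p]
    by (subst mset_set.remove[of _ "orbit p x"]) simp_all
qed

lemma cycles_join:
  assumes "permutation p" "a \<in> B" "m \<in> B" "a \<notin> orbit p m"
  shows "cycles B (p \<circ> tr a m) - {orbit (p \<circ> tr a m) m} = (cycles B p - {orbit p m}) - {orbit p a}"
proof -
  note j = orbit_join[OF assms(1,4)]
  have "cycles B (p \<circ> tr a m) - {orbit (p \<circ> tr a m) a, orbit (p \<circ> tr a m) m} = cycles B p - {orbit p a, orbit p m}"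
    by (rule cycles_other[OF assms(1-3)]) (simp add: j)
  then show ?thesis unfolding j by auto
qed

lemma ctype_join:
  assumes "finite B" "p permutes B" "a \<in> B" "m \<in> B" "a \<notin> orbit p m"
  shows "ctype B (p \<circ> tr a m) = add_mset (card (orbit p m) + card (orbit p a))
    (mset_on card ((cycles B p - {orbit p m}) - {orbit p a}))"
proof -
  have p: "permutation p" using assms permutes_permutation by blast
  have "orbit p a \<noteq> orbit p m" using assms(5) permutation_self_in_orbit[OF p] by auto
  then have "orbit p a \<inter> orbit p m = {}" using orbits_disjoint[OF p] by blast
  moreover have "finite (orbit p x)" for x using finite_orbit permutation_self_in_orbit[OF p] by metis
  ultimately have "card (orbit (p \<circ> tr a m) m) = card (orbit p m) + card (orbit p a)"
    unfolding orbit_join(1)[OF p assms(5)] by (simp add: card_Un_disjoint)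
  then show ?thesis
    unfolding ctype_split[OF assms(1,4)] cycles_join[OF p assms(3-5)] by simp
qed

lemma cycles_cut:
  assumes p: "permutation p" "m \<in> B" "orbit p m \<subseteq> B" and i: "1 \<le> i" "i < card (orbit p m)"
  defines "a \<equiv> (p ^^ i) m" and "q \<equiv> p \<circ> tr ((p ^^ i) m) m"
  shows "cycles B q = insert (orbit q a) (insert (orbit q m) (cycles B p - {orbit p m}))"
    "orbit q a \<noteq> orbit q m" "orbit q a \<notin> cycles B p - {orbit p m}" "orbit q m \<notin> cycles B p - {orbit p m}"
proof -
  have qdef: "q = p \<circ> tr a m" by (simp add: q_def a_def)
  have a: "a \<in> orbit p m" unfolding a_def using funpow_in_orbit permutation_self_in_orbit[OF p(1)] by metis
  then have aB: "a \<in> B" using p by blast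
  have pa: "orbit p a = orbit p m" using orbit_eq_iff[OF p(1) a] .
  note c = orbit_cut[OF p(1) i, folded a_def, folded qdef]
  have e: "cycles B q - {orbit q a, orbit q m} = cycles B p - {orbit p m}"
    using cycles_other[OF p(1) aB p(2), folded qdef] c(3) pa by simp
  show "cycles B q = insert (orbit q a) (insert (orbit q m) (cycles B p - {orbit p m}))"
    unfolding e[symmetric] using aB p(2) by (auto simp: cycles_def)
  show "orbit q a \<noteq> orbit q m" using c(4) orbit_nonempty[of q a] by auto
  show "orbit q a \<notin> cycles B p - {orbit p m}" "orbit q m \<notin> cycles B p - {orbit p m}" unfolding e[symmetric] by auto
qed

lemma ctype_cut:
  assumes B: "finite B" "p permutes B" "m \<in> B" and i: "1 \<le> i" "i < card (orbit p m)"
  shows "ctype B (p \<circ> tr ((p ^^ i) m) m) = add_mset i (add_mset (card (orbit p m) - i) (mset_on card (cycles B p - {orbit p m})))"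
proof -
  have p: "permutation p" using B permutes_permutation by blast
  have sub: "orbit p m \<subseteq> B" using B by (simp add: permutes_orbit_subset)
  have fin: "finite (cycles B p - {orbit p m})" using B finite_cycles by blast
  show ?thesis
    unfolding ctype_def cycles_cut(1)[OF p B(3) sub i]
    using cycles_cut(2-4)[OF p B(3) sub i] orbit_cut(1,2)[OF p i] fin by simp
qed

lemma orbit_perm_restrict:
  assumes "permutation p" "x \<in> C" "p ` C \<subseteq> C"
  shows "orbit (perm_restrict p C) x = orbit p x"
  by (rule orbit_cong0[of x C]) (use assms in \<open>auto simp: perm_restrict_def image_subset_iff\<close>)

lemma ctype_restrict:
  assumes "permutation p" "p ` C \<subseteq> C"
  shows "ctype C (perm_restrict p C) = mset_on card (cycles C p)"
  unfolding ctype_def cycles_def using orbit_perm_restrict[OF assms(1) _ assms(2)] by (simp cong: image_cong)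

section \<open>Counts indexed by cycle type\<close>

definition perm_on :: "nat set \<Rightarrow> (nat \<Rightarrow> nat) \<Rightarrow> bool" where
  "perm_on B p \<longleftrightarrow> finite B \<and> B \<noteq> {} \<and> p permutes B"

text \<open>The count for a chosen representative; independence of the choice is
  \<open>fact_count_eq_fact_number\<close>.\<close>

definition fact_number :: "nat \<Rightarrow> nat multiset \<Rightarrow> nat" where
  "fact_number r M = (let (B, p) = (SOME (B, p). perm_on B p \<and> ctype B p = M) in fact_count r B p)"

lemma Union_cycles:
  assumes "permutation p" "p ` B \<subseteq> B"
  shows "\<Union> (cycles B p) = B"
proof -
  have "orbit p x \<subseteq> B" if "x \<in> B" for x
  proof
    fix y assume "y \<in> orbit p x"
    then show "y \<in> B" using that assms(2) by induction blast+
  qed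
  then show ?thesis unfolding cycles_def using permutation_self_in_orbit[OF assms(1)] by blast
qed

lemma card_cycle_pos: "permutation p \<Longrightarrow> card (orbit p x) > 0"
  by (rule permutation_cycle(2))

lemma card_ctype:
  assumes "finite B" "p permutes B"
  shows "sum_mset (ctype B p) = card B"
proof -
  have p: "permutation p" using assms permutes_permutation by blast
  have B: "\<Union> (cycles B p) = B" using permutes_image[OF assms(2)] by (intro Union_cycles[OF p]) simp
  have "card (\<Union> (cycles B p)) = (\<Sum>Z\<in>cycles B p. card Z)"
  proof (rule card_Union_disjoint)
    show "pairwise disjnt (cycles B p)"
      unfolding cycles_def pairwise_def disjnt_def using orbits_disjoint[OF p] by blast
    show "finite Z" if "Z \<in> cycles B p" for Z
    proof -
      have "Z \<subseteq> B" using B that by blast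
      then show ?thesis using assms(1) by (rule finite_subset)
    qed
  qed
  then show ?thesis unfolding B ctype_def by (simp add: sum_unfold_sum_mset)
qed

lemma ctype_singleton: "perm_on B p \<Longrightarrow> ctype B p = {#1#} \<longleftrightarrow> (\<exists>x. B = {x})"
proof
  assume B: "perm_on B p" and "ctype B p = {#1#}"
  then have "card B = 1" using card_ctype[of B p] by (simp add: perm_on_def)
  then show "\<exists>x. B = {x}" by (rule card_1_singletonE) blast
next
  assume B: "perm_on B p" and "\<exists>x. B = {x}"
  then obtain x where x: "B = {x}" by blast
  then have "p = id" using B by (simp add: perm_on_def)
  then have "p x = x" by simp
  then have "orbit p x = {x}" by (simp add: orbit_eq_singleton_iff)
  then show "ctype B p = {#1#}" unfolding ctype_def cycles_def x by simp
qed

lemma fact_count_0_conn: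
  "fact_count 0 B p = (if p = id \<and> conn B UNIV then 1 else 0)"
proof -
  have "{ps \<in> mono_seqs B B 0. tprod ps = p \<and> conn B (uncut ps)} = (if p = id \<and> conn B UNIV then {[]} else {})"
    unfolding mono_seqs_0 by (auto simp: uncut_def)
  then show ?thesis unfolding fact_count_def by simp
qed

text \<open>With no edges every singleton is uncut, so a nonempty set is connected only if it is a
  point.\<close>

lemma fact_count_0:
  assumes "perm_on B p"
  shows "fact_count 0 B p = (if ctype B p = {#1#} then 1 else 0)"
proof (cases "\<exists>x. B = {x}")
  case True
  then obtain x where x: "B = {x}" by blast
  have "p = id" using assms x by (simp add: perm_on_def)
  moreover have "conn B UNIV" unfolding conn_def x by blast
  moreover have "ctype B p = {#1#}" using True ctype_singleton[OF assms] by blast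
  ultimately show ?thesis by (simp add: fact_count_0_conn)
next
  case False
  have "\<not> conn B UNIV"
  proof
    assume c: "conn B UNIV"
    obtain x where x: "x \<in> B" using assms unfolding perm_on_def by blast
    have "B \<subseteq> {x} \<or> B \<inter> {x} = {}" by (rule c[unfolded conn_def, rule_format]) simp
    then have "B = {x}" using x by blast
    then show False using False by blast
  qed
  moreover have "ctype B p \<noteq> {#1#}" using False ctype_singleton[OF assms] by blast
  ultimately show ?thesis by (simp add: fact_count_0_conn)
qed

text \<open>The label type is arbitrary: labels are first the cycles themselves with their sizes,
  later numbers. The grading is still by transpositions instead of genus.\<close>

definition rec_rhs :: "nat \<Rightarrow> nat \<Rightarrow> 'b set \<Rightarrow> ('b \<Rightarrow> nat) \<Rightarrow> nat" where
  "rec_rhs r k S c =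
    (\<Sum>j\<in>S. c j * fact_number r (add_mset (k + c j) (mset_on c (S - {j})))) +
    (\<Sum>i\<in>{1..<k}. fact_number r (add_mset i (add_mset (k - i) (mset_on c S))) +
      (\<Sum>I\<in>Pow S. \<Sum>s\<le>r. fact_number s (add_mset (k - i) (mset_on c I)) *
        fact_number (r - s) (add_mset i (mset_on c (S - I)))))"

lemma image_mset_bij:
  assumes "bij_betw h S S'" "\<And>j. j \<in> S \<Longrightarrow> c' (h j) = c j" "I \<subseteq> S"
  shows "mset_on c' (h ` I) = mset_on c I"
proof -
  have "inj_on h I" using assms by (meson bij_betw_def inj_on_subset)
  then have "mset_on c' (h ` I) = image_mset (c' \<circ> h) (mset_set I)"
    by (simp add: image_mset_mset_set[symmetric] multiset.map_comp)
  also have "\<dots> = mset_on c I"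
    using assms(2,3) by (cases "finite I") (auto intro!: image_mset_cong)
  finally show ?thesis .
qed

lemma rec_rhs_bij:
  assumes h: "bij_betw h S S'" and c: "\<And>j. j \<in> S \<Longrightarrow> c' (h j) = c j"
  shows "rec_rhs r k S' c' = rec_rhs r k S c"
proof -
  note im = image_mset_bij[where c' = c' and c = c, OF h c]
  have S': "S' = h ` S" and inj: "inj_on h S" using h by (auto simp: bij_betw_def)
  have d: "h ` S - h ` I = h ` (S - I)" if "I \<subseteq> S" for I
    using inj that by (simp add: inj_on_image_set_diff)
  have 1: "(\<Sum>j\<in>S'. c' j * fact_number r (add_mset (k + c' j) (mset_on c' (S' - {j})))) =
    (\<Sum>j\<in>S. c j * fact_number r (add_mset (k + c j) (mset_on c (S - {j}))))"
    unfolding S' sum.reindex[OF inj]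
  proof (rule sum.cong[OF refl])
    fix j assume j: "j \<in> S"
    have "h ` S - {h j} = h ` (S - {j})" using d[of "{j}"] j by simp
    then show "((\<lambda>j. c' j * fact_number r (add_mset (k + c' j) (mset_on c' (h ` S - {j})))) \<circ> h) j =
      c j * fact_number r (add_mset (k + c j) (mset_on c (S - {j})))"
      using im[of "S - {j}"] c[OF j] by simp
  qed
  have pow: "Pow S' = (`) h ` Pow S" unfolding S' by (rule image_Pow_surj[symmetric]) simp
  have injP: "inj_on ((`) h) (Pow S)" using inj by (rule inj_on_image_Pow)
  have 2: "(\<Sum>I\<in>Pow S'. \<Sum>s\<le>r. fact_number s (add_mset (k - i) (mset_on c' I)) * fact_number (r - s) (add_mset i (mset_on c' (S' - I)))) =
    (\<Sum>I\<in>Pow S. \<Sum>s\<le>r. fact_number s (add_mset (k - i) (mset_on c I)) * fact_number (r - s) (add_mset i (mset_on c (S - I))))" for i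
    unfolding pow sum.reindex[OF injP]
  proof (rule sum.cong[OF refl])
    fix I assume I: "I \<in> Pow S"
    have "S' - h ` I = h ` (S - I)" using d[of I] I S' by simp
    then show "((\<lambda>I. \<Sum>s\<le>r. fact_number s (add_mset (k - i) (mset_on c' I)) * fact_number (r - s) (add_mset i (mset_on c' (S' - I)))) \<circ> (`) h) I =
      (\<Sum>s\<le>r. fact_number s (add_mset (k - i) (mset_on c I)) * fact_number (r - s) (add_mset i (mset_on c (S - I))))"
      using im[of I] im[of "S - I"] I by simp
  qed
  have 3: "mset_on c' S' = mset_on c S" unfolding S' using im[of S] by simp
  show ?thesis unfolding rec_rhs_def 1 2 3 ..
qed

lemma image_mset_eq_bij:
  assumes "finite S" "finite S'" "mset_on c S = mset_on c' S'"
  shows "\<exists>h. bij_betw h S S' \<and> (\<forall>j\<in>S. c' (h j) = c j)"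
  using assms
proof (induction S arbitrary: S' rule: finite_induct)
  case empty
  then have "S' = {}" by (simp add: mset_set_empty_iff)
  then show ?case by (simp add: bij_betw_def)
next
  case (insert x F)
  then have "c x \<in># mset_on c' S'" by (metis image_mset_add_mset mset_set.insert union_single_eq_member)
  then obtain y where y: "y \<in> S'" "c' y = c x" using insert.prems(1) by auto
  have "mset_set S' = add_mset y (mset_set (S' - {y}))" using y insert.prems(1) by (simp add: mset_set.remove)
  then have "mset_on c F = mset_on c' (S' - {y})"
    using insert y by simp
  then obtain h where h: "bij_betw h F (S' - {y})" "\<forall>j\<in>F. c' (h j) = c j"
    using insert.IH[of "S' - {y}"] insert.prems(1) by auto
  have "bij_betw (h(x := y)) F (S' - {y})"
    using h(1) insert.hyps(2) by (subst bij_betw_cong[where g = h]) auto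
  then have "bij_betw (h(x := y)) (F \<union> {x}) (S' - {y} \<union> {(h(x := y)) x})"
    using insert.hyps(2) by (intro notIn_Un_bij_betw) auto
  then have "bij_betw (h(x := y)) (insert x F) (insert y (S' - {y}))" by simp
  moreover have "insert y (S' - {y}) = S'" using y by auto
  moreover have "\<forall>j\<in>insert x F. c' ((h(x := y)) j) = c j" using h(2) y insert.hyps(2) by auto
  ultimately show ?case by metis
qed

section \<open>Invariant sets as unions of cycles\<close>

lemma perm_restrict_permutes:
  assumes "p permutes B" "p ` C = C"
  shows "perm_restrict p C permutes C"
proof (rule bij_imp_permutes)
  have "inj_on p C" using assms(1) by (meson permutes_inj inj_on_subset subset_UNIV)
  then have "bij_betw p C C" using assms(2) by (simp add: bij_betw_def)
  then show "bij_betw (perm_restrict p C) C C" by (rule bij_betw_cong[THEN iffD1, rotated]) (simp add: perm_restrict_def)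
qed (simp add: perm_restrict_def)

lemma cycles_Union:
  assumes p: "permutation p" and X: "X \<subseteq> cycles B p"
  shows "cycles (\<Union>X) p = X" "p ` \<Union>X = \<Union>X"
proof -
  have self: "x \<in> orbit p x" for x using p by (rule permutation_self_in_orbit)
  have orb: "orbit p x = Z" if Z: "Z \<in> X" "x \<in> Z" for Z x
  proof -
    obtain y where "Z = orbit p y" using Z(1) X unfolding cycles_def by blast
    then show ?thesis using orbit_eq_iff[OF p] Z(2) by blast
  qed
  have ne: "\<exists>x. x \<in> Z" if "Z \<in> X" for Z using that X self unfolding cycles_def by blast
  show "cycles (\<Union>X) p = X"
  proof
    show "cycles (\<Union>X) p \<subseteq> X"
    proof
      fix Y assume "Y \<in> cycles (\<Union>X) p"
      then obtain x Z where "Y = orbit p x" "x \<in> Z" "Z \<in> X" unfolding cycles_def by blast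
      then show "Y \<in> X" using orb[of Z x] by simp
    qed
    show "X \<subseteq> cycles (\<Union>X) p"
    proof
      fix Z assume Z: "Z \<in> X"
      then obtain x where "x \<in> Z" using ne by blast
      then show "Z \<in> cycles (\<Union>X) p" unfolding cycles_def using orb[OF Z] Z by blast
    qed
  qed
  have sub: "p ` \<Union>X \<subseteq> \<Union>X"
  proof
    fix y assume "y \<in> p ` \<Union>X"
    then obtain x Z where x: "y = p x" "x \<in> Z" "Z \<in> X" by auto
    then have "y \<in> Z" using orb[OF x(3,2)] orbit.base[of p x] by simp
    then show "y \<in> \<Union>X" using x by blast
  qed
  moreover have "\<Union>X \<subseteq> p ` \<Union>X"
  proof
    fix y assume "y \<in> \<Union>X"
    then obtain Z where Z: "y \<in> Z" "Z \<in> X" by blast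
    then have "y \<in> orbit p y" using self by blast
    then obtain n where n: "0 < n" "y = (p ^^ n) y" unfolding orbit_altdef by blast
    obtain n' where "n = Suc n'" using n(1) gr0_implies_Suc by blast
    with n(2) have "(p ^^ Suc n') y = y" by (simp only:)
    then have n': "p ((p ^^ n') y) = y" by (simp only: funpow.simps o_apply)
    have "(p ^^ n') y \<in> orbit p y" using self by (rule funpow_in_orbit)
    then have "(p ^^ n') y \<in> \<Union>X" using orb[OF Z(2,1)] Z(2) by blast
    then show "y \<in> p ` \<Union>X" using imageI[of "(p ^^ n') y" "\<Union>X" p] n' by (simp only:)
  qed
  ultimately show "p ` \<Union>X = \<Union>X" by blast
qed

lemma Union_cycles_diff:
  assumes p: "permutation p" and B: "p ` B \<subseteq> B" and X: "X \<subseteq> cycles B p"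
  shows "B - \<Union>X = \<Union>(cycles B p - X)"
proof -
  have "Y \<inter> Z = {}" if "Y \<in> cycles B p" "Z \<in> cycles B p" "Y \<noteq> Z" for Y Z
    using that orbits_disjoint[OF p] unfolding cycles_def by blast
  then have "Y \<inter> Z = {}" if "Y \<in> X" "Z \<in> cycles B p - X" for Y Z
    using that X by blast
  then have "\<Union>X \<inter> \<Union>(cycles B p - X) = {}" by blast
  moreover have "\<Union>X \<union> \<Union>(cycles B p - X) = B" using Union_cycles[OF p B] X by blast
  ultimately show ?thesis by blast
qed

lemma not_emptyI: "x \<in> A \<Longrightarrow> A \<noteq> {}"
  by blast

text \<open>If a lies off the cycle of m, the joined cycle contains both, so no invariant set
  separates them; the cycle Z of a contributes card Z equal terms. If a lies on the cycle of m, a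
  separating invariant set amounts to a choice of the untouched cycles that accompany m.\<close>

lemma fact_count_Suc_eq_rec_rhs:
  assumes B: "perm_on B p"
    and IH: "\<And>s B p. s \<le> r \<Longrightarrow> perm_on B p \<Longrightarrow> fact_count s B p = fact_number s (ctype B p)"
  shows "fact_count (Suc r) B p =
    rec_rhs r (card (orbit p (Max B))) (cycles B p - {orbit p (Max B)}) card"
proof -
  define m where "m = Max B"
  define S where "S = cycles B p - {orbit p m}"
  define k where "k = card (orbit p m)"
  define T where "T = (\<lambda>a. fact_count r B (p \<circ> tr a m) +
    (\<Sum>C\<in>{C. C \<subseteq> B \<and> m \<in> C \<and> a \<notin> C \<and> (p \<circ> tr a m) ` C = C}. \<Sum>s\<le>r.
      fact_count s C (perm_restrict (p \<circ> tr a m) C) * fact_count (r - s) (B - C) (perm_restrict (p \<circ> tr a m) (B - C))))"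
  have B': "finite B" "B \<noteq> {}" "p permutes B" using B by (auto simp: perm_on_def)
  have p: "permutation p" using B' permutes_permutation by blast
  have self: "x \<in> orbit p x" for x using p by (rule permutation_self_in_orbit)
  have m: "m \<in> B" using B' by (simp add: m_def)
  have q: "perm_on B (p \<circ> tr a m)" if "a \<in> B" for a
    using B' m that unfolding perm_on_def by (auto intro!: permutes_compose permutes_swap_id)
  have om: "orbit p m \<in> cycles B p" using m by (simp add: cycles_def)
  have BS: "B - orbit p m = \<Union>S"
    using Union_cycles_diff[OF p, of B "{orbit p m}"] om permutes_image[OF B'(3)] by (simp add: S_def)
  have omB: "orbit p m \<subseteq> B" using permutes_orbit_subset[OF B'(3) m] .
  have finS: "finite S" using B' finite_cycles by (simp add: S_def)
  have finO: "finite Z" if "Z \<in> S" for Z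
  proof -
    have "Z \<subseteq> B" using BS that by blast
    then show ?thesis using B'(1) by (rule finite_subset)
  qed
  have join: "T a = fact_number r (add_mset (k + card Z) (mset_on card (S - {Z})))"
    if Z: "Z \<in> S" and a: "a \<in> Z" for Z a
  proof -
    have aB: "a \<in> B" using BS Z a by blast
    have am: "a \<notin> orbit p m" using BS Z a by blast
    have Oa: "orbit p a = Z" using Z a orbit_eq_iff[OF p] unfolding S_def cycles_def by blast
    have "C \<notin> {C. C \<subseteq> B \<and> m \<in> C \<and> a \<notin> C \<and> (p \<circ> tr a m) ` C = C}" for C
    proof
      assume C: "C \<in> {C. C \<subseteq> B \<and> m \<in> C \<and> a \<notin> C \<and> (p \<circ> tr a m) ` C = C}"
      have "a \<in> orbit (p \<circ> tr a m) m" using orbit_join(1)[OF p am] self by blast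
      moreover have "orbit (p \<circ> tr a m) m \<subseteq> C"
      proof -
        have "\<Union> (cycles C (p \<circ> tr a m)) = C" using C by (intro Union_cycles permutation_comp_tr p) simp
        then show ?thesis using C unfolding cycles_def by blast
      qed
      ultimately show False using C by blast
    qed
    then have e: "{C. C \<subseteq> B \<and> m \<in> C \<and> a \<notin> C \<and> (p \<circ> tr a m) ` C = C} = {}" by blast
    have "T a = fact_number r (ctype B (p \<circ> tr a m))"
      unfolding T_def e using IH[OF le_refl q[OF aB]] by simp
    then show ?thesis unfolding ctype_join[OF B'(1,3) aB m am] Oa k_def S_def .
  qed
  have cut: "T ((p ^^ i) m) = fact_number r (add_mset i (add_mset (k - i) (mset_on card S))) +
      (\<Sum>I\<in>Pow S. \<Sum>s\<le>r. fact_number s (add_mset (k - i) (mset_on card I)) *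
        fact_number (r - s) (add_mset i (mset_on card (S - I))))" if i: "i \<in> {1..<k}" for i
  proof -
    define a where "a = (p ^^ i) m"
    define q where "q = p \<circ> tr a m"
    have ik: "1 \<le> i" "i < card (orbit p m)" using i by (simp_all add: k_def)
    have "a \<in> orbit p m" unfolding a_def using funpow_in_orbit[OF self] .
    then have aB: "a \<in> B" using omB by blast
    have qp: "perm_on B q" unfolding q_def using \<open>a \<in> B\<close> by (rule q)
    then have qB: "q permutes B" by (simp add: perm_on_def)
    have qperm: "permutation q" unfolding q_def using p by (rule permutation_comp_tr)
    have selfq: "x \<in> orbit q x" for x using qperm by (rule permutation_self_in_orbit)
    note cc = cycles_cut[OF p m omB ik, folded a_def, folded q_def S_def]
    note oc = orbit_cut[OF p ik, folded a_def, folded q_def k_def]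
    have qi: "q ` B \<subseteq> B" using permutes_image[OF qB] by simp
    let ?C = "\<lambda>I. \<Union>(insert (orbit q m) I)"
    have sub: "insert (orbit q m) I \<subseteq> cycles B q" "insert (orbit q a) (S - I) \<subseteq> cycles B q" if "I \<in> Pow S" for I
      using that cc(1) by auto
    have comp: "B - ?C I = \<Union>(insert (orbit q a) (S - I))" if "I \<in> Pow S" for I
    proof -
      have "cycles B q - insert (orbit q m) I = insert (orbit q a) (S - I)"
        unfolding cc(1) using cc(2-4) that by blast
      then show ?thesis using Union_cycles_diff[OF qperm qi sub(1)[OF that]] by simp
    qed
    have K: "{C. C \<subseteq> B \<and> m \<in> C \<and> a \<notin> C \<and> q ` C = C} = ?C ` Pow S"
    proof
      show "{C. C \<subseteq> B \<and> m \<in> C \<and> a \<notin> C \<and> q ` C = C} \<subseteq> ?C ` Pow S"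
      proof
        fix C assume "C \<in> {C. C \<subseteq> B \<and> m \<in> C \<and> a \<notin> C \<and> q ` C = C}"
        then have C: "C \<subseteq> B" "m \<in> C" "a \<notin> C" "q ` C = C" by auto
        have U: "\<Union>(cycles C q) = C" using C by (intro Union_cycles qperm) simp
        have "cycles C q \<subseteq> cycles B q" using C(1) by (auto simp: cycles_def)
        moreover have "orbit q a \<notin> cycles C q" using U C(3) selfq by blast
        moreover have "orbit q m \<in> cycles C q" using C(2) by (simp add: cycles_def)
        ultimately have "cycles C q - {orbit q m} \<in> Pow S" "insert (orbit q m) (cycles C q - {orbit q m}) = cycles C q"
          unfolding cc(1) by blast+
        then show "C \<in> ?C ` Pow S" using U by (intro image_eqI[of C ?C "cycles C q - {orbit q m}"]) simp_all
      qed
      show "?C ` Pow S \<subseteq> {C. C \<subseteq> B \<and> m \<in> C \<and> a \<notin> C \<and> q ` C = C}"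
      proof
        fix C assume "C \<in> ?C ` Pow S"
        then obtain I where I: "C = ?C I" "I \<in> Pow S" by (rule imageE)
        have "C \<subseteq> \<Union>(cycles B q)" unfolding I(1) using sub(1)[OF I(2)] by (rule Union_mono)
        then have "C \<subseteq> B" unfolding Union_cycles[OF qperm qi] .
        moreover have "m \<in> C" unfolding I(1) by (rule UnionI[OF insertI1 selfq])
        moreover have "a \<notin> C"
        proof -
          have "a \<in> \<Union>(insert (orbit q a) (S - I))" by (rule UnionI[OF insertI1 selfq])
          then have "a \<in> B - ?C I" unfolding comp[OF I(2)] .
          then show ?thesis unfolding I(1) by (simp only: Diff_iff not_False_eq_True)
        qed
        moreover have "q ` C = C" unfolding I(1) by (rule cycles_Union(2)[OF qperm sub(1)[OF I(2)]])
        ultimately show "C \<in> {C. C \<subseteq> B \<and> m \<in> C \<and> a \<notin> C \<and> q ` C = C}" by simp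
      qed
    qed
    have inj: "inj_on ?C (Pow S)"
    proof (rule inj_onI)
      fix I J assume IJ: "I \<in> Pow S" "J \<in> Pow S" "?C I = ?C J"
      have "insert (orbit q m) I = cycles (?C I) q" by (rule cycles_Union(1)[OF qperm sub(1)[OF IJ(1)], symmetric])
      also have "\<dots> = insert (orbit q m) J" unfolding IJ(3) by (rule cycles_Union(1)[OF qperm sub(1)[OF IJ(2)]])
      finally have e: "insert (orbit q m) I = insert (orbit q m) J" .
      have "orbit q m \<notin> I" "orbit q m \<notin> J" using cc(4) IJ(1,2) by blast+
      from insert_ident[OF this] e show "I = J" by (rule iffD1)
    qed
    have F: "fact_count s (?C I) (perm_restrict q (?C I)) = fact_number s (add_mset (k - i) (mset_on card I))"
      if "I \<in> Pow S" "s \<le> r" for I s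
    proof -
      have inv: "q ` ?C I = ?C I" by (rule cycles_Union(2)[OF qperm sub(1)[OF that(1)]])
      have "?C I \<subseteq> \<Union>(cycles B q)" using sub(1)[OF that(1)] by (rule Union_mono)
      then have "?C I \<subseteq> B" unfolding Union_cycles[OF qperm qi] .
      then have "finite (?C I)" using B'(1) by (rule finite_subset)
      moreover have "?C I \<noteq> {}"
      proof -
        have "m \<in> ?C I" by (rule UnionI[OF insertI1 selfq])
        then show ?thesis by (rule not_emptyI)
      qed
      ultimately have perm: "perm_on (?C I) (perm_restrict q (?C I))"
        unfolding perm_on_def using perm_restrict_permutes[OF qB inv] by (intro conjI)
      have "ctype (?C I) (perm_restrict q (?C I)) = add_mset (k - i) (mset_on card I)"
      proof -
        have "orbit q m \<notin> I" using cc(4) that(1) by blast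
        moreover have "finite I" using that(1) finS by (simp add: finite_subset)
        ultimately have "mset_on card (insert (orbit q m) I) = add_mset (k - i) (mset_on card I)"
          using oc(2) by simp
        then show ?thesis
          unfolding ctype_restrict[OF qperm equalityD1[OF inv]] cycles_Union(1)[OF qperm sub(1)[OF that(1)]] .
      qed
      then show ?thesis using IH[OF that(2) perm] by (simp only:)
    qed
    have G: "fact_count s (B - ?C I) (perm_restrict q (B - ?C I)) = fact_number s (add_mset i (mset_on card (S - I)))"
      if "I \<in> Pow S" "s \<le> r" for I s
    proof -
      let ?D = "\<Union>(insert (orbit q a) (S - I))"
      have inv: "q ` ?D = ?D" by (rule cycles_Union(2)[OF qperm sub(2)[OF that(1)]])
      have "?D \<subseteq> B" unfolding comp[OF that(1), symmetric] by (rule Diff_subset)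
      then have "finite ?D" using B'(1) by (rule finite_subset)
      moreover have "?D \<noteq> {}"
      proof -
        have "a \<in> ?D" by (rule UnionI[OF insertI1 selfq])
        then show ?thesis by (rule not_emptyI)
      qed
      ultimately have perm: "perm_on ?D (perm_restrict q ?D)"
        unfolding perm_on_def using perm_restrict_permutes[OF qB inv] by (intro conjI)
      have "ctype ?D (perm_restrict q ?D) = add_mset i (mset_on card (S - I))"
      proof -
        have "orbit q a \<notin> S - I" "finite (S - I)" using cc(3) finS by auto
        then show ?thesis
          unfolding ctype_restrict[OF qperm equalityD1[OF inv]] cycles_Union(1)[OF qperm sub(2)[OF that(1)]]
          using oc(1) by simp
      qed
      then show ?thesis unfolding comp[OF that(1)] using IH[OF that(2) perm] by (simp only:)
    qed
    have "T a = fact_count r B q + (\<Sum>C\<in>?C ` Pow S. \<Sum>s\<le>r.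
      fact_count s C (perm_restrict q C) * fact_count (r - s) (B - C) (perm_restrict q (B - C)))"
      unfolding T_def q_def[symmetric] K ..
    also have "fact_count r B q = fact_number r (add_mset i (add_mset (k - i) (mset_on card S)))"
      using IH[OF le_refl qp] ctype_cut[OF B'(1,3) m ik, folded a_def, folded q_def k_def S_def] by (simp only:)
    also have "(\<Sum>C\<in>?C ` Pow S. \<Sum>s\<le>r. fact_count s C (perm_restrict q C) * fact_count (r - s) (B - C) (perm_restrict q (B - C))) =
      (\<Sum>I\<in>Pow S. \<Sum>s\<le>r. fact_number s (add_mset (k - i) (mset_on card I)) * fact_number (r - s) (add_mset i (mset_on card (S - I))))"
      unfolding sum.reindex[OF inj] comp_def
    proof (intro sum.cong refl)
      fix I s assume "I \<in> Pow S" "s \<in> {..r}"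
      then show "fact_count s (?C I) (perm_restrict q (?C I)) * fact_count (r - s) (B - ?C I) (perm_restrict q (B - ?C I)) =
        fact_number s (add_mset (k - i) (mset_on card I)) * fact_number (r - s) (add_mset i (mset_on card (S - I)))"
        using F[of I s] G[of I "r - s"] by simp
    qed
    finally show ?thesis unfolding a_def .
  qed
  have split: "B - {m} = (orbit p m - {m}) \<union> \<Union>S" using BS omB self[of m] by blast
  have "fact_count (Suc r) B p = (\<Sum>a\<in>B - {m}. T a)"
    unfolding T_def by (rule fact_count_Suc[OF B'(1,2) m_def B'(3)])
  also have "\<dots> = (\<Sum>a\<in>orbit p m - {m}. T a) + (\<Sum>a\<in>\<Union>S. T a)"
    unfolding split
  proof (rule sum.union_disjoint)
    show "finite (orbit p m - {m})" using finite_subset[OF omB B'(1)] by simp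
    show "finite (\<Union>S)" unfolding BS[symmetric] using B'(1) by simp
    show "(orbit p m - {m}) \<inter> \<Union>S = {}" using BS by blast
  qed
  also have "(\<Sum>a\<in>orbit p m - {m}. T a) = (\<Sum>i\<in>{1..<k}. T ((p ^^ i) m))"
    unfolding k_def by (rule sum.reindex_bij_betw[OF orbit_minus_self[OF p], symmetric])
  also have "(\<Sum>a\<in>\<Union>S. T a) = (\<Sum>Z\<in>S. \<Sum>a\<in>Z. T a)"
  proof (subst sum.Union_disjoint)
    show "\<forall>A\<in>S. finite A" using finO by blast
    show "\<forall>A\<in>S. \<forall>A'\<in>S. A \<noteq> A' \<longrightarrow> A \<inter> A' = {}"
      using orbits_disjoint[OF p] unfolding S_def cycles_def by blast
  qed simp
  also have "\<dots> = (\<Sum>Z\<in>S. card Z * fact_number r (add_mset (k + card Z) (mset_on card (S - {Z}))))"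
    by (intro sum.cong refl) (simp add: join)
  finally show ?thesis
    unfolding rec_rhs_def S_def[symmetric] m_def[symmetric] k_def[symmetric]
    by (simp only: add.commute[of "\<Sum>i\<in>{1..<k}. T ((p ^^ i) m)"] cut cong: sum.cong)
qed

section \<open>Independence of the representative\<close>

lemma fact_number_eqI:
  assumes "perm_on B p" and "\<And>B' p'. perm_on B' p' \<Longrightarrow> ctype B' p' = ctype B p \<Longrightarrow> fact_count r B' p' = v"
  shows "fact_number r (ctype B p) = v"
proof -
  define Q where "Q = (\<lambda>(B', p'). perm_on B' p' \<and> ctype B' p' = ctype B p)"
  obtain B' p' where e: "(SOME x. Q x) = (B', p')" by (cases "SOME x. Q x")
  have "Q (B, p)" using assms(1) by (simp add: Q_def)
  then have "Q (SOME x. Q x)" by (rule someI)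
  then have "perm_on B' p'" "ctype B' p' = ctype B p" unfolding e by (simp_all add: Q_def)
  then have "fact_count r B' p' = v" by (rule assms(2))
  then show ?thesis unfolding fact_number_def Q_def[symmetric] e by simp
qed

lemma orbit_conj:
  "orbit (tr u v \<circ> p \<circ> tr u v) x = tr u v ` orbit p (tr u v x)"
proof -
  have "((tr u v \<circ> p \<circ> tr u v) ^^ n) x = tr u v ((p ^^ n) (tr u v x))" for n
    by (induction n) simp_all
  then show ?thesis unfolding orbit_altdef by auto
qed

lemma perm_on_conj:
  assumes "perm_on B p" "u \<in> B" "v \<in> B"
  shows "perm_on B (tr u v \<circ> p \<circ> tr u v)" "ctype B (tr u v \<circ> p \<circ> tr u v) = ctype B p"
proof -
  have t: "tr u v permutes B" using assms by (intro permutes_swap_id)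
  show "perm_on B (tr u v \<circ> p \<circ> tr u v)"
    using assms(1) permutes_compose[OF t permutes_compose[OF _ t]] unfolding perm_on_def by (simp add: comp_assoc)
  have "cycles B (tr u v \<circ> p \<circ> tr u v) = (\<lambda>x. tr u v ` orbit p x) ` (tr u v ` B)"
    unfolding cycles_def orbit_conj image_image ..
  also have "\<dots> = (`) (tr u v) ` cycles B p"
    unfolding permutes_image[OF t] cycles_def image_image ..
  finally have c: "cycles B (tr u v \<circ> p \<circ> tr u v) = (`) (tr u v) ` cycles B p" .
  have inj: "inj_on ((`) (tr u v)) (cycles B p)"
    by (rule inj_on_subset[OF inj_on_image_Pow[OF inj_on_transpose[of u v UNIV]]]) simp
  have "ctype B (tr u v \<circ> p \<circ> tr u v) = image_mset (card \<circ> (`) (tr u v)) (mset_set (cycles B p))"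
    unfolding ctype_def c image_mset_mset_set[OF inj, symmetric] by (simp add: multiset.map_comp)
  also have "\<dots> = ctype B p"
    unfolding ctype_def by (intro image_mset_cong) (simp add: card_image)
  finally show "ctype B (tr u v \<circ> p \<circ> tr u v) = ctype B p" .
qed

text \<open>Conjugation can move the maximum into any chosen cycle, so the recursion may single out
  any part.\<close>

lemma ctype_Max_cycle:
  assumes B: "perm_on B p" and k: "k \<in># ctype B p"
  shows "\<exists>p'. perm_on B p' \<and> ctype B p' = ctype B p \<and> (\<forall>r. fact_count r B p' = fact_count r B p) \<and> card (orbit p' (Max B)) = k"
proof -
  have B': "finite B" "B \<noteq> {}" using B by (simp_all add: perm_on_def)
  have "k \<in> card ` cycles B p" using k B' finite_cycles[of B p] by (simp add: ctype_def)
  then obtain y where y: "y \<in> B" "k = card (orbit p y)" unfolding cycles_def by blast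
  let ?t = "tr (Max B) y"
  have M: "Max B \<in> B" using B' by simp
  have "card (orbit (?t \<circ> p \<circ> ?t) (Max B)) = k"
    unfolding orbit_conj y(2) by (simp add: card_image)
  then show ?thesis
    using perm_on_conj[OF B M y(1)] fact_count_conj[OF B'(1) M y(1)] by blast
qed

lemma fact_count_Suc_type:
  assumes B: "perm_on B p"
    and IH: "\<And>s B p. s \<le> r \<Longrightarrow> perm_on B p \<Longrightarrow> fact_count s B p = fact_number s (ctype B p)"
    and S: "finite S" "ctype B p = add_mset k (mset_on c S)"
  shows "fact_count (Suc r) B p = rec_rhs r k S c"
proof -
  obtain p' where p': "perm_on B p'" "ctype B p' = ctype B p" "fact_count (Suc r) B p' = fact_count (Suc r) B p"
    "card (orbit p' (Max B)) = k"
    using ctype_Max_cycle[OF B, of k] S(2) by auto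
  let ?S = "cycles B p' - {orbit p' (Max B)}"
  have fin: "finite B" "Max B \<in> B" using B by (simp_all add: perm_on_def)
  have "mset_on c S = mset_on card ?S"
    using ctype_split[OF fin, of p'] p'(2,4) S(2) by simp
  then obtain h where "bij_betw h S ?S" "\<forall>j\<in>S. card (h j) = c j"
    using image_mset_eq_bij[of S ?S c card] S(1) finite_cycles[OF fin(1), of p'] by auto
  then have "rec_rhs r k ?S card = rec_rhs r k S c" by (intro rec_rhs_bij) auto
  then show ?thesis using fact_count_Suc_eq_rec_rhs[OF p'(1) IH] p'(3,4) by simp
qed

lemma fact_count_eq_fact_number: "perm_on B p \<Longrightarrow> fact_count r B p = fact_number r (ctype B p)"
proof (induction r arbitrary: B p rule: less_induct)
  case (less r)
  show ?case
  proof (cases r)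
    case 0
    have "fact_number 0 (ctype B p) = fact_count 0 B p"
      by (rule fact_number_eqI[OF less.prems]) (simp add: fact_count_0 less.prems)
    then show ?thesis using 0 by simp
  next
    case (Suc r')
    have fin: "finite B" "Max B \<in> B" using less.prems by (simp_all add: perm_on_def)
    have IH: "\<And>s B p. s \<le> r' \<Longrightarrow> perm_on B p \<Longrightarrow> fact_count s B p = fact_number s (ctype B p)"
      using less.IH Suc by simp
    let ?S = "cycles B p - {orbit p (Max B)}"
    let ?v = "rec_rhs r' (card (orbit p (Max B))) ?S card"
    have finS: "finite ?S" using finite_cycles[OF fin(1), of p] by simp
    \<comment> \<open>The recursion for the other permutation is started at the same part, so both
      counts equal one expression in the cycle type.\<close>
    have v: "fact_count (Suc r') B' p' = ?v" if "perm_on B' p'" "ctype B' p' = ctype B p" for B' p'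
      using fact_count_Suc_type[OF that(1) IH finS] that(2) ctype_split[OF fin, of p] by simp
    have "fact_number (Suc r') (ctype B p) = ?v" by (rule fact_number_eqI[OF less.prems v])
    then show ?thesis using v[OF less.prems refl] Suc by simp
  qed
qed

text \<open>Since q fixes the new point z, composing with \<open>tr z x\<close> inserts z into the
  cycle of x.\<close>

lemma ctype_insert:
  assumes B: "finite B" "q permutes B" and z: "z \<notin> B"
  shows "ctype (insert z B) q = add_mset 1 (ctype B q)"
    and "x \<in> B \<Longrightarrow> ctype (insert z B) (q \<circ> tr z x) = add_mset (card (orbit q x) + 1) (ctype B q - {#card (orbit q x)#})"
proof -
  have q: "permutation q" using B permutes_permutation by blast
  have oz: "orbit q z = {z}" using permutes_not_in[OF B(2) z] by (simp add: orbit_eq_singleton_iff)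
  have c: "cycles (insert z B) q = insert {z} (cycles B q)" by (simp add: cycles_def oz)
  have notin: "{z} \<notin> cycles B q"
  proof
    assume "{z} \<in> cycles B q"
    then obtain y where "y \<in> B" "orbit q y = {z}" unfolding cycles_def by auto
    then have "{z} \<subseteq> B" using permutes_orbit_subset[OF B(2), of y] by simp
    then show False using z by simp
  qed
  show 1: "ctype (insert z B) q = add_mset 1 (ctype B q)"
    unfolding ctype_def c using notin finite_cycles[OF B(1), of q] by simp
  assume x: "x \<in> B"
  have oxB: "orbit q x \<subseteq> B" using permutes_orbit_subset[OF B(2) x] .
  have zx: "z \<notin> orbit q x" using oxB z by blast
  have qz: "q permutes insert z B" using B(2) by (rule permutes_subset) blast
  have "(cycles (insert z B) q - {orbit q x}) - {orbit q z} = cycles B q - {orbit q x}"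
    unfolding c oz using notin by auto
  then have "ctype (insert z B) (q \<circ> tr z x) = add_mset (card (orbit q x) + card {z}) (mset_on card (cycles B q - {orbit q x}))"
    using ctype_join[of "insert z B" q z x] B(1) qz x zx by (simp add: oz)
  moreover have "mset_on card (cycles B q - {orbit q x}) = ctype B q - {#card (orbit q x)#}"
    using ctype_split[OF B(1) x, of q] by simp
  ultimately show "ctype (insert z B) (q \<circ> tr z x) = add_mset (card (orbit q x) + 1) (ctype B q - {#card (orbit q x)#})"
    by simp
qed

lemma ctype_exists:
  "M \<noteq> {#} \<Longrightarrow> 0 \<notin># M \<Longrightarrow> \<exists>B p. perm_on B p \<and> ctype B p = M"
proof (induction "sum_mset M" arbitrary: M rule: less_induct)
  case less
  obtain k M' where M: "M = add_mset k M'" using less.prems(1) by (cases M) auto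
  have k: "k > 0" using less.prems(2) M by auto
  show ?case
  proof (cases "k = 1")
    case True
    show ?thesis
    proof (cases "M' = {#}")
      case True
      have "perm_on {0} id" by (simp add: perm_on_def permutes_id)
      moreover have "ctype {0} id = {#1#}"
        using ctype_singleton[OF \<open>perm_on {0} id\<close>] by blast
      ultimately show ?thesis using True M \<open>k = 1\<close> by auto
    next
      case False
      have "sum_mset M' < sum_mset M" unfolding M using k by simp
      then obtain B p where B: "perm_on B p" "ctype B p = M'"
        using less.hyps[of M'] False less.prems(2) M by auto
      obtain z where z: "z \<notin> B" using B(1) ex_new_if_finite[of B] by (auto simp: perm_on_def)
      have "perm_on (insert z B) p"
        using B(1) permutes_subset[of p B "insert z B"] by (auto simp: perm_on_def)
      moreover have "ctype (insert z B) p = M"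
        using ctype_insert(1)[of B p z] B z M True by (simp add: perm_on_def)
      ultimately show ?thesis by blast
    qed
  next
    case False
    have "sum_mset (add_mset (k - 1) M') < sum_mset M" unfolding M using k by simp
    then obtain B p where B: "perm_on B p" "ctype B p = add_mset (k - 1) M'"
      using less.hyps[of "add_mset (k - 1) M'"] False k less.prems(2) M by auto
    have B': "finite B" "p permutes B" using B(1) by (simp_all add: perm_on_def)
    have "k - 1 \<in># ctype B p" using B(2) by simp
    then have "k - 1 \<in> card ` cycles B p"
      using finite_cycles[OF B'(1), of p] by (simp add: ctype_def)
    then obtain x where x: "x \<in> B" "card (orbit p x) = k - 1" unfolding cycles_def by auto
    obtain z where z: "z \<notin> B" using B' ex_new_if_finite[of B] by auto
    have "p permutes insert z B" using B'(2) by (rule permutes_subset) blast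
    then have "perm_on (insert z B) (p \<circ> tr z x)"
      using B' x unfolding perm_on_def by (auto intro!: permutes_compose permutes_swap_id)
    moreover have "ctype (insert z B) (p \<circ> tr z x) = M"
      using ctype_insert(2)[OF B' z x(1)] x(2) B(2) M k by simp
    ultimately show ?thesis by blast
  qed
qed

lemma fact_number_Suc:
  assumes "finite S" "k > 0" "\<forall>j\<in>S. c j > 0"
  shows "fact_number (Suc r) (add_mset k (mset_on c S)) = rec_rhs r k S c"
proof -
  have "0 \<notin># add_mset k (mset_on c S)" using assms by auto
  then obtain B p where B: "perm_on B p" "ctype B p = add_mset k (mset_on c S)"
    using ctype_exists[of "add_mset k (mset_on c S)"] by auto
  have "fact_count (Suc r) B p = rec_rhs r k S c"
    by (rule fact_count_Suc_type[OF B(1) fact_count_eq_fact_number assms(1) B(2)])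
  then show ?thesis using fact_count_eq_fact_number[OF B(1)] B(2) by simp
qed

lemma fact_number_0:
  assumes "M \<noteq> {#}" "0 \<notin># M"
  shows "fact_number 0 M = (if M = {#1#} then 1 else 0)"
proof -
  obtain B p where "perm_on B p" "ctype B p = M" using ctype_exists[OF assms] by blast
  then show ?thesis using fact_count_eq_fact_number[of B p 0] fact_count_0[of B p] by simp
qed

section \<open>Permutations of given cycle type\<close>

text \<open>The order of the centralizer of a permutation of cycle type M.\<close>

definition zprod :: "nat multiset \<Rightarrow> nat" where
  "zprod M = (\<Prod>k\<in>set_mset M. k ^ count M k * fact (count M k))"

lemma zprod_add: "zprod (add_mset k M) = zprod M * (k * (count M k + 1))"
proof -
  let ?f = "\<lambda>M k. k ^ count M k * fact (count M k)"
  have sup: "zprod N = (\<Prod>k\<in>A. ?f N k)" if "finite A" "set_mset N \<subseteq> A" for A N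
    unfolding zprod_def using that by (intro prod.mono_neutral_left) (auto simp: not_in_iff)
  let ?A = "insert k (set_mset M)"
  have "zprod (add_mset k M) = ?f (add_mset k M) k * (\<Prod>j\<in>?A - {k}. ?f (add_mset k M) j)"
    by (rule trans[OF sup prod.remove[of ?A k]]) auto
  also have "(\<Prod>j\<in>?A - {k}. ?f (add_mset k M) j) = (\<Prod>j\<in>?A - {k}. ?f M j)"
    by (rule prod.cong) auto
  also have "?f (add_mset k M) k = ?f M k * (k * (count M k + 1))" by (simp add: algebra_simps)
  finally have "zprod (add_mset k M) = (?f M k * (\<Prod>j\<in>?A - {k}. ?f M j)) * (k * (count M k + 1))"
    by (simp only: mult_ac)
  also have "?f M k * (\<Prod>j\<in>?A - {k}. ?f M j) = (\<Prod>j\<in>?A. ?f M j)"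
    by (rule prod.remove[symmetric]) auto
  also have "\<dots> = zprod M" by (rule sup[symmetric]) auto
  finally show ?thesis .
qed

lemma sum_count_mset: "(\<Sum>k\<in>set_mset M. k * count M k) = sum_mset M"
proof (induction M)
  case (add x M)
  let ?A = "insert x (set_mset M)"
  have sup: "(\<Sum>k\<in>set_mset M. k * count M k) = (\<Sum>k\<in>?A. k * count M k)"
    by (rule sum.mono_neutral_left) (auto simp: not_in_iff)
  have "(\<Sum>k\<in>?A. k * count (add_mset x M) k) = (\<Sum>k\<in>?A. k * count M k + (if k = x then x else 0))"
    by (rule sum.cong) auto
  also have "\<dots> = (\<Sum>k\<in>?A. k * count M k) + x" unfolding sum.distrib by simp
  finally show ?case using add.IH sup by simp
qed simp

lemma card_in_cycles_of_size:
  assumes "finite B" "q permutes B"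
  shows "card {x\<in>B. card (orbit q x) = j} = j * count (ctype B q) j"
proof -
  have q: "permutation q" using assms permutes_permutation by blast
  let ?X = "{Z\<in>cycles B q. card Z = j}"
  have sub: "?X \<subseteq> cycles B q" by blast
  have "{x\<in>B. card (orbit q x) = j} = \<Union>?X"
  proof
    show "{x\<in>B. card (orbit q x) = j} \<subseteq> \<Union>?X"
    proof
      fix x assume "x \<in> {x\<in>B. card (orbit q x) = j}"
      then have "orbit q x \<in> ?X" by (simp add: cycles_def)
      then show "x \<in> \<Union>?X" using permutation_self_in_orbit[OF q, of x] by (rule UnionI)
    qed
    show "\<Union>?X \<subseteq> {x\<in>B. card (orbit q x) = j}"
    proof
      fix x assume "x \<in> \<Union>?X"
      then obtain y where y: "y \<in> B" "x \<in> orbit q y" "card (orbit q y) = j" unfolding cycles_def by blast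
      moreover have "orbit q x = orbit q y" using orbit_eq_iff[OF q y(2)] .
      moreover have "x \<in> B" using permutes_orbit_subset[OF assms(2) y(1)] y(2) by (rule subsetD)
      ultimately show "x \<in> {x\<in>B. card (orbit q x) = j}" by simp
    qed
  qed
  also have "card (\<Union>?X) = (\<Sum>Z\<in>?X. card Z)"
  proof (rule card_Union_disjoint)
    show "pairwise disjnt ?X"
      unfolding cycles_def pairwise_def disjnt_def using orbits_disjoint[OF q] by blast
    show "finite Z" if "Z \<in> ?X" for Z
    proof -
      have "Z \<subseteq> B" using that permutes_orbit_subset[OF assms(2)] unfolding cycles_def by blast
      then show ?thesis using assms(1) by (rule finite_subset)
    qed
  qed
  also have "\<dots> = j * card ?X" by simp
  also have "card ?X = count (ctype B q) j"
  proof -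
    have "card -` {j} \<inter> cycles B q = ?X" by auto
    then show ?thesis unfolding ctype_def using finite_cycles[OF assms(1), of q] by (simp add: count_image_mset)
  qed
  finally show ?thesis .
qed

definition perms_of_type :: "nat set \<Rightarrow> nat multiset \<Rightarrow> (nat \<Rightarrow> nat) set" where
  "perms_of_type B M = {p. p permutes B \<and> ctype B p = M}"

lemma finite_perms_of_type: "finite B \<Longrightarrow> finite (perms_of_type B M)"
  unfolding perms_of_type_def by (rule finite_subset[OF _ finite_permutations[of B]]) auto

text \<open>Here x is the point that the permutation sends to z; composing with
  \<open>tr z x\<close> makes z a fixed point.\<close>

lemma permutes_insert_right:
  assumes "z \<notin> B"
  shows "bij_betw (\<lambda>(x, q). q \<circ> tr z x) (insert z B \<times> {q. q permutes B}) {p. p permutes insert z B}"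
  unfolding bij_betw_def
proof
  show "inj_on (\<lambda>(x, q). q \<circ> tr z x) (insert z B \<times> {q. q permutes B})"
  proof (rule inj_onI, clarify)
    fix x q x' q' assume q: "q permutes B" "q' permutes B" and e: "q \<circ> tr z x = q' \<circ> tr z x'"
    have qz: "q z = z" "q' z = z" using q assms by (simp_all add: permutes_not_in)
    have "q' (tr z x' x) = z" using fun_cong[OF e, of x] qz by simp
    then have "q' (tr z x' x) = q' z" using qz by simp
    then have "tr z x' x = z" using permutes_inj[OF q(2)] by (rule injD[rotated])
    then have x: "x = x'" by (auto simp: transpose_eq_iff)
    have "q = (q \<circ> tr z x) \<circ> tr z x" by (simp add: comp_assoc)
    also have "\<dots> = q'" unfolding e unfolding x by (simp add: comp_assoc)
    finally show "x = x' \<and> q = q'" using x by simp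
  qed
  show "(\<lambda>(x, q). q \<circ> tr z x) ` (insert z B \<times> {q. q permutes B}) = {p. p permutes insert z B}"
  proof
    show "(\<lambda>(x, q). q \<circ> tr z x) ` (insert z B \<times> {q. q permutes B}) \<subseteq> {p. p permutes insert z B}"
      using permutes_subset[of _ B "insert z B"] by (auto intro!: permutes_compose permutes_swap_id)
    show "{p. p permutes insert z B} \<subseteq> (\<lambda>(x, q). q \<circ> tr z x) ` (insert z B \<times> {q. q permutes B})"
    proof
      fix p assume "p \<in> {p. p permutes insert z B}"
      then have p: "p permutes insert z B" by simp
      define x where "x = Hilbert_Choice.inv p z"
      have x: "x \<in> insert z B" unfolding x_def using permutes_in_image[OF permutes_inv[OF p]] by simp
      have px: "p x = z" unfolding x_def using permutes_inverses(1)[OF p] .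
      have "p \<circ> tr z x permutes insert z B" using p x by (intro permutes_compose permutes_swap_id) auto
      then have "p \<circ> tr z x permutes B" by (rule permutes_superset) (use px in auto)
      moreover have "p = (p \<circ> tr z x) \<circ> tr z x" by (simp add: comp_assoc)
      ultimately show "p \<in> (\<lambda>(x, q). q \<circ> tr z x) ` (insert z B \<times> {q. q permutes B})"
        using x by (intro image_eqI[of p _ "(x, p \<circ> tr z x)"]) auto
    qed
  qed
qed

lemma add_mset_eq_iff: "add_mset x T = M \<longleftrightarrow> x \<in># M \<and> T = M - {#x#}"
proof
  assume "add_mset x T = M"
  then show "x \<in># M \<and> T = M - {#x#}" by (intro conjI) (simp_all flip: \<open>add_mset x T = M\<close>)
next
  assume "x \<in># M \<and> T = M - {#x#}"
  then show "add_mset x T = M" by simp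
qed

text \<open>The index k is the length of the cycle of z. Removing z shortens this cycle or deletes
  it, and conversely z can be inserted next to each point on a cycle of length k - 1.\<close>

lemma card_perms_of_type_insert:
  assumes B: "finite B" "z \<notin> B" and M: "0 \<notin># M"
  shows "card (perms_of_type (insert z B) M) = (\<Sum>k\<in>set_mset M.
    if k = 1 then card (perms_of_type B (M - {#1#}))
    else card (perms_of_type B (add_mset (k - 1) (M - {#k#}))) * ((k - 1) * (count (M - {#k#}) (k - 1) + 1)))"
proof -
  let ?g = "\<lambda>(x, q). q \<circ> tr z x"
  let ?D = "insert z B \<times> {q. q permutes B}"
  define D where "D = (\<lambda>k. if k = 1 then {z} \<times> perms_of_type B (M - {#1#})
    else {(x, q). x \<in> B \<and> q \<in> perms_of_type B (add_mset (k - 1) (M - {#k#})) \<and> card (orbit q x) = k - 1})"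
  have bij: "bij_betw ?g ?D {p. p permutes insert z B}" by (rule permutes_insert_right[OF B(2)])
  have "{y \<in> ?D. ctype (insert z B) (?g y) = M} = (\<Union>k\<in>set_mset M. D k)"
  proof (rule Set.set_eqI)
    fix y :: "nat \<times> (nat \<Rightarrow> nat)"
    obtain x q where y: "y = (x, q)" by (cases y)
    have "(x, q) \<in> {y \<in> ?D. ctype (insert z B) (?g y) = M} \<longleftrightarrow> (x, q) \<in> (\<Union>k\<in>set_mset M. D k)"
    proof (cases "q permutes B")
      case False
      then have "(x, q) \<notin> D k" for k by (cases "k = 1") (simp_all add: D_def perms_of_type_def)
      then show ?thesis using False by simp
    next
      case q: True
      note ins = ctype_insert[OF B(1) q B(2)]
      show ?thesis
      proof (cases "x = z")
        case True
        have "(x, q) \<in> (\<Union>k\<in>set_mset M. D k) \<longleftrightarrow> 1 \<in># M \<and> ctype B q = M - {#1#}"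
        proof -
          have "(x, q) \<in> D k \<longleftrightarrow> k = 1 \<and> ctype B q = M - {#1#}" for k
            using True q B(2) by (cases "k = 1") (simp_all add: D_def perms_of_type_def)
          then show ?thesis by simp
        qed
        also have "\<dots> \<longleftrightarrow> add_mset 1 (ctype B q) = M" by (rule add_mset_eq_iff[symmetric])
        finally show ?thesis using True q ins(1) by simp
      next
        case False
        let ?j = "card (orbit q x)"
        have pos: "?j > 0" by (rule card_cycle_pos[OF permutes_permutation[OF B(1) q]])
        have "(x, q) \<in> (\<Union>k\<in>set_mset M. D k) \<longleftrightarrow>
          x \<in> B \<and> (\<exists>k\<in>#M. k \<noteq> 1 \<and> ctype B q = add_mset (k - 1) (M - {#k#}) \<and> ?j = k - 1)"
        proof -
          have "(x, q) \<in> D k \<longleftrightarrow> x \<in> B \<and> k \<noteq> 1 \<and> ctype B q = add_mset (k - 1) (M - {#k#}) \<and> ?j = k - 1" for k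
            using False q by (cases "k = 1") (simp_all add: D_def perms_of_type_def)
          then show ?thesis by (simp only: UN_iff) blast
        qed
        also have "\<dots> \<longleftrightarrow> x \<in> B \<and> ?j + 1 \<in># M \<and> ctype B q = add_mset ?j (M - {#?j + 1#})"
        proof -
          have k: "k \<noteq> 1 \<and> C \<and> ?j = k - 1 \<longleftrightarrow> k = ?j + 1 \<and> C" for k C
            using pos by (cases k) auto
          show ?thesis unfolding k by auto
        qed
        also have "\<dots> \<longleftrightarrow> x \<in> B \<and> add_mset (?j + 1) (ctype B q - {#?j#}) = M"
        proof (cases "x \<in> B")
          case True
          have "?j \<in># ctype B q" using ctype_split[OF B(1) True, of q] by simp
          then obtain T where "ctype B q = add_mset ?j T" by (rule mset_add)
          then show ?thesis using True by (simp add: add_mset_eq_iff)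
        qed simp
        finally show ?thesis using False q ins(2)[of x] by auto
      qed
    qed
    then show "y \<in> {y \<in> ?D. ctype (insert z B) (?g y) = M} \<longleftrightarrow> y \<in> (\<Union>k\<in>set_mset M. D k)"
      unfolding y .
  qed
  moreover have "perms_of_type (insert z B) M = ?g ` {y \<in> ?D. ctype (insert z B) (?g y) = M}"
  proof -
    have "{p. p permutes insert z B} = ?g ` ?D" using bij by (simp only: bij_betw_def)
    then have "perms_of_type (insert z B) M = {p \<in> ?g ` ?D. ctype (insert z B) p = M}"
      unfolding perms_of_type_def by blast
    also have "\<dots> = ?g ` {y \<in> ?D. ctype (insert z B) (?g y) = M}" by blast
    finally show ?thesis .
  qed
  moreover have "inj_on ?g {y \<in> ?D. ctype (insert z B) (?g y) = M}"
    using bij unfolding bij_betw_def by (elim conjE, elim inj_on_subset) blast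
  ultimately have "card (perms_of_type (insert z B) M) = card (\<Union>k\<in>set_mset M. D k)"
    by (simp only: card_image)
  also have "\<dots> = (\<Sum>k\<in>set_mset M. card (D k))"
  proof (rule card_UN_disjoint)
    show "\<forall>k\<in>set_mset M. finite (D k)"
    proof
      fix k
      have "D k \<subseteq> insert z B \<times> (perms_of_type B (M - {#1#}) \<union> perms_of_type B (add_mset (k - 1) (M - {#k#})))"
        unfolding D_def by auto
      then show "finite (D k)" by (rule finite_subset) (use B finite_perms_of_type in auto)
    qed
    show "\<forall>k\<in>set_mset M. \<forall>k'\<in>set_mset M. k \<noteq> k' \<longrightarrow> D k \<inter> D k' = {}"
    proof (intro ballI impI)
      fix k k' assume k: "k \<in># M" "k' \<in># M" "k \<noteq> k'"
      then have "k \<noteq> 0" "k' \<noteq> 0" using M by metis+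
      then show "D k \<inter> D k' = {}" using k(3) B(2) unfolding D_def by auto
    qed
  qed simp
  also have "\<dots> = (\<Sum>k\<in>set_mset M. if k = 1 then card (perms_of_type B (M - {#1#}))
    else card (perms_of_type B (add_mset (k - 1) (M - {#k#}))) * ((k - 1) * (count (M - {#k#}) (k - 1) + 1)))"
  proof (rule sum.cong[OF refl])
    fix k assume "k \<in># M"
    show "card (D k) = (if k = 1 then card (perms_of_type B (M - {#1#}))
      else card (perms_of_type B (add_mset (k - 1) (M - {#k#}))) * ((k - 1) * (count (M - {#k#}) (k - 1) + 1)))"
    proof (cases "k = 1")
      case True
      then show ?thesis by (simp add: D_def card_cartesian_product)
    next
      case False
      let ?N = "add_mset (k - 1) (M - {#k#})"
      have "D k = prod.swap ` (SIGMA q:perms_of_type B ?N. {x\<in>B. card (orbit q x) = k - 1})"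
        using False by (auto simp: D_def image_iff)
      then have "card (D k) = card (SIGMA q:perms_of_type B ?N. {x\<in>B. card (orbit q x) = k - 1})"
        by (simp only: card_image inj_swap)
      also have "\<dots> = (\<Sum>q\<in>perms_of_type B ?N. card {x\<in>B. card (orbit q x) = k - 1})"
        using B finite_perms_of_type by (intro card_SigmaI) auto
      also have "\<dots> = (\<Sum>q\<in>perms_of_type B ?N. (k - 1) * (count (M - {#k#}) (k - 1) + 1))"
      proof (rule sum.cong[OF refl])
        fix q assume q: "q \<in> perms_of_type B ?N"
        then show "card {x\<in>B. card (orbit q x) = k - 1} = (k - 1) * (count (M - {#k#}) (k - 1) + 1)"
          using card_in_cycles_of_size[OF B(1), of q "k - 1"] by (simp add: perms_of_type_def)
      qed
      finally show ?thesis using False by simp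
    qed
  qed
  finally show ?thesis .
qed

text \<open>After multiplication by \<open>zprod M\<close>, the term of length k becomes (card B)!
  times k m_k, and the numbers k m_k add up to card B + 1.\<close>

lemma card_perms_of_type:
  assumes "finite B" "0 \<notin># M" "sum_mset M = card B"
  shows "card (perms_of_type B M) * zprod M = fact (card B)"
  using assms
proof (induction B arbitrary: M rule: finite_induct)
  case empty
  have "M = {#}" using empty by (cases M) auto
  moreover have "perms_of_type {} {#} = {id}" by (auto simp: perms_of_type_def ctype_def cycles_def)
  ultimately show ?case by (simp add: zprod_def)
next
  case (insert z B)
  let ?c = "\<lambda>k. if k = 1 then card (perms_of_type B (M - {#1#}))
    else card (perms_of_type B (add_mset (k - 1) (M - {#k#}))) * ((k - 1) * (count (M - {#k#}) (k - 1) + 1))"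
  have sum: "sum_mset M = Suc (card B)" using insert by simp
  have "?c k * zprod M = fact (card B) * (k * count M k)" if k: "k \<in># M" for k
  proof -
    obtain N where N: "M = add_mset k N" using k by (metis multi_member_split)
    have zM: "zprod M = zprod N * (k * count M k)" unfolding N zprod_add by simp
    have MN: "M - {#k#} = N" using N by simp
    show ?thesis
    proof (cases "k = 1")
      case True
      have "card (perms_of_type B N) * zprod N = fact (card B)"
        using insert.prems sum N True by (intro insert.IH) auto
      then show ?thesis using True zM MN by (simp add: mult.assoc[symmetric])
    next
      case False
      have "k \<noteq> 0" using k insert.prems(1) by metis
      then have "card (perms_of_type B (add_mset (k - 1) N)) * zprod (add_mset (k - 1) N) = fact (card B)"
        using insert.prems(1) sum N False by (intro insert.IH) auto
      then have IH: "card (perms_of_type B (add_mset (k - 1) N)) * (zprod N * ((k - 1) * (count N (k - 1) + 1))) = fact (card B)"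
        unfolding zprod_add .
      have "?c k * zprod M = (card (perms_of_type B (add_mset (k - 1) N)) * (zprod N * ((k - 1) * (count N (k - 1) + 1)))) * (k * count M k)"
        unfolding MN zM using False by simp
      then show ?thesis unfolding IH .
    qed
  qed
  then have "(\<Sum>k\<in>set_mset M. ?c k) * zprod M = (\<Sum>k\<in>set_mset M. fact (card B) * (k * count M k))"
    unfolding sum_distrib_right by (rule sum.cong[OF refl])
  also have "\<dots> = fact (card B) * Suc (card B)"
    unfolding sum_distrib_left[symmetric] sum_count_mset sum ..
  finally show ?case
    using card_perms_of_type_insert[OF insert.hyps(1,2) insert.prems(1)] insert.hyps by (simp add: mult.commute)
qed

section \<open>Monotone Hurwitz numbers\<close>

text \<open>The points moved by a transposition determine the ordered pair.\<close>

lemma inj_on_tr: "inj_on (\<lambda>(a, b). tr a b) {(a, b). a < b}"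
proof (rule inj_onI)
  fix x y :: "nat \<times> nat"
  assume xy: "x \<in> {(a, b). a < b}" "y \<in> {(a, b). a < b}" "(\<lambda>(a, b). tr a b) x = (\<lambda>(a, b). tr a b) y"
  obtain a b c d where x: "x = (a, b)" and y: "y = (c, d)" by (cases x, cases y)
  have ab: "a < b" "c < d" "tr a b = tr c d" using xy by (simp_all add: x y)
  have moved: "{z. tr u v z \<noteq> z} = {u, v}" if "u < v" for u v :: nat
    using that by (auto simp: transpose_eq_iff)
  have "{a, b} = {c, d}" using moved[OF ab(1)] moved[OF ab(2)] ab(3) by simp
  then show "x = y" using ab(1,2) unfolding x y by (auto simp: doubleton_eq_iff)
qed

lemma cycle_type_on_eq: "cycle_type_on d p = ctype {1..d} p"
  by (simp add: cycle_type_on_def ctype_def cycles_def)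

lemma cycle_type_one:
  assumes "p permutes {1..d}"
  shows "cycle_type_on d p = replicate_mset d 1 \<longleftrightarrow> p = id"
proof
  assume t: "cycle_type_on d p = replicate_mset d 1"
  have p: "permutation p" using assms by (intro permutes_permutation[of "{1..d}"]) simp
  have "p x = x" if x: "x \<in> {1..d}" for x
  proof -
    have "card (orbit p x) \<in># ctype {1..d} p" using ctype_split[of "{1..d}" x p] x by simp
    then have "card (orbit p x) = 1" using t unfolding cycle_type_on_eq by (simp split: if_splits)
    then obtain y where "orbit p x = {y}" by (rule card_1_singletonE)
    then have "orbit p x = {x}" using permutation_self_in_orbit[OF p, of x] by auto
    then show ?thesis by (simp only: orbit_eq_singleton_iff)
  qed
  moreover have "p x = x" if "x \<notin> {1..d}" for x using assms that by (rule permutes_not_in)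
  ultimately show "p = id" by (intro ext) (metis id_apply)
next
  assume "p = id"
  have "orbit id x = {x}" for x :: nat by (simp add: orbit_eq_singleton_iff)
  then have "cycles {1..d} p = (\<lambda>x. {x}) ` {1..d}" unfolding cycles_def \<open>p = id\<close> by simp
  then show "cycle_type_on d p = replicate_mset d 1"
    unfolding cycle_type_on_eq ctype_def
    by (simp add: image_mset_mset_set[symmetric] multiset.map_comp comp_def image_mset_const_eq)
qed

text \<open>The permutation \<rho> is inverse to the product of the transpositions, so it preserves
  every uncut set and contributes no connection. Conversely, the orbit of a point under the group is
  an uncut set.\<close>

lemma transitive_iff_conn:
  assumes \<rho>: "\<rho> permutes {1..d}" "\<rho> \<circ> tprod ps = id" and ps: "ps \<in> mono_seqs {1..d} {1..d} r"
  shows "transitive_on d (generate (sym_group d) ({\<rho>, id} \<union> set (map (\<lambda>(a, b). tr a b) ps))) \<longleftrightarrow> conn {1..d} (uncut ps)"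
    (is "transitive_on d ?H \<longleftrightarrow> _")
proof
  let ?gen = "{\<rho>, id} \<union> set (map (\<lambda>(a, b). tr a b) ps)"
  interpret G: group "sym_group d" by (rule sym_group_is_group)
  have trp: "tr a b permutes {1..d}" if "(a, b) \<in> set ps" for a b
    using mono_seqsD(2,3)[OF ps that] by (intro permutes_swap_id)
  have gen: "?gen \<subseteq> carrier (sym_group d)"
    using \<rho>(1) trp permutes_id by (auto simp: sym_group_carrier)
  assume T: "transitive_on d ?H"
  show "conn {1..d} (uncut ps)"
    unfolding conn_def
  proof
    fix C assume C: "C \<in> uncut ps"
    have gen_C: "\<forall>x. h x \<in> C \<longleftrightarrow> x \<in> C" if h: "h \<in> ?gen" for h
    proof -
      consider "h = \<rho>" | "h = id" | a b where "(a, b) \<in> set ps" "h = tr a b" using h by auto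
      then show ?thesis
      proof cases
        case 1
        have img: "tprod ps ` C = C" using C by (rule tprod_image_uncut)
        have inj: "inj (tprod ps)" using tprod_permutes[OF ps] by (rule permutes_inj)
        have bij: "surj (tprod ps)" using tprod_permutes[OF ps] by (rule permutes_surj)
        show ?thesis
        proof
          fix x
          obtain y where y: "x = tprod ps y" using bij by (auto simp: surj_def)
          have "\<rho> x = y" using fun_cong[OF \<rho>(2), of y] y by simp
          moreover have "x \<in> C \<longleftrightarrow> y \<in> C" using inj_image_mem_iff[OF inj, of y C] img y by simp
          ultimately show "h x \<in> C \<longleftrightarrow> x \<in> C" using 1 by simp
        qed
      next
        case 2
        then show ?thesis by simp
      next
        case 3
        have "tr a b ` C = C" using uncutD[OF C 3(1)] by (rule tr_image_uncut)
        then show ?thesis using 3(2) mem_tr_image[of _ a b C] by simp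
      qed
    qed
    have key: "\<forall>x. h x \<in> C \<longleftrightarrow> x \<in> C" if "h \<in> ?H" for h
      using that
    proof (induction rule: generate.induct)
      case one
      then show ?case by (simp add: sym_group_one)
    next
      case (incl h)
      show ?case using incl by (rule gen_C)
    next
      case (inv h)
      have hC: "\<forall>x. h x \<in> C \<longleftrightarrow> x \<in> C" using inv by (rule gen_C)
      have "h \<circ> inv\<^bsub>sym_group d\<^esub> h = id"
        using G.r_inv[OF subsetD[OF gen inv]] by (simp only: sym_group_mult sym_group_one)
      then have e: "h ((inv\<^bsub>sym_group d\<^esub> h) x) = x" for x by (simp only: fun_eq_iff o_apply id_apply)
      show ?case
      proof
        fix x
        have "h ((inv\<^bsub>sym_group d\<^esub> h) x) \<in> C \<longleftrightarrow> (inv\<^bsub>sym_group d\<^esub> h) x \<in> C" using hC by (rule spec)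
        then show "(inv\<^bsub>sym_group d\<^esub> h) x \<in> C \<longleftrightarrow> x \<in> C" unfolding e by (rule sym)
      qed
    next
      case (eng h1 h2)
      then show ?case by (simp add: sym_group_mult)
    qed
    show "{1..d} \<subseteq> C \<or> {1..d} \<inter> C = {}"
    proof (rule disjCI)
      assume "{1..d} \<inter> C \<noteq> {}"
      then obtain x where x: "x \<in> {1..d}" "x \<in> C" by blast
      show "{1..d} \<subseteq> C"
      proof
        fix y assume "y \<in> {1..d}"
        then obtain h where "h \<in> ?H" "h x = y" using T x(1) unfolding transitive_on_def by blast
        then show "y \<in> C" using key x(2) by blast
      qed
    qed
  qed
next
  assume c: "conn {1..d} (uncut ps)"
  show "transitive_on d ?H"
    unfolding transitive_on_def
  proof (intro ballI)
    fix x y assume x: "x \<in> {1..d}" and y: "y \<in> {1..d}"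
    define C where "C = (\<lambda>h. h x) ` ?H"
    have step: "tr a b z \<in> C" if ab: "(a, b) \<in> set ps" and z: "z \<in> C" for a b z
    proof -
      obtain h where h: "h \<in> ?H" "z = h x" using z unfolding C_def by blast
      have "tr a b \<in> {\<rho>, id} \<union> set (map (\<lambda>(a, b). tr a b) ps)" using ab by force
      then have "tr a b \<in> ?H" by (rule generate.incl)
      then have "mult (sym_group d) (tr a b) h \<in> ?H" using h(1) by (rule generate.eng)
      then have "tr a b \<circ> h \<in> ?H" by (simp only: sym_group_mult)
      then show ?thesis unfolding C_def h(2) by (rule rev_image_eqI) simp
    qed
    have "C \<in> uncut ps"
    proof (rule uncutI)
      fix a b assume "(a, b) \<in> set ps"
      then show "a \<in> C \<longleftrightarrow> b \<in> C" using step[of a b a] step[of a b b] by auto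
    qed
    then have "{1..d} \<subseteq> C \<or> {1..d} \<inter> C = {}" using c unfolding conn_def by blast
    moreover have "x \<in> C"
    proof -
      have "one (sym_group d) \<in> ?H" by (rule generate.one)
      then show ?thesis unfolding C_def sym_group_one by (rule rev_image_eqI) simp
    qed
    ultimately have "y \<in> C" using x y by blast
    then show "\<exists>h\<in>?H. h x = y" unfolding C_def by blast
  qed
qed

text \<open>As \<sigma> is the identity, the transpositions factor the inverse of \<rho>, which has
  the same cycle type as \<rho>.\<close>

lemma monotone_hurwitz_eq:
  assumes \<alpha>: "sum_list \<alpha> \<ge> 1" and r: "r + 2 = 2 * g + length \<alpha> + sum_list \<alpha>"
  shows "monotone_hurwitz g \<alpha> = card {p. p permutes {1..sum_list \<alpha>} \<and> ctype {1..sum_list \<alpha>} p = mset \<alpha>} * fact_number r (mset \<alpha>)"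
proof -
  define d where "d = sum_list \<alpha>"
  define B where "B = {1..d}"
  define P where "P = {p. p permutes B \<and> ctype B p = mset \<alpha>}"
  define Q where "Q = (SIGMA p:P. {ps \<in> mono_seqs B B r. tprod ps = inv' p \<and> conn B (uncut ps)})"
  define f where "f = (\<lambda>(p :: nat \<Rightarrow> nat, ps). (p, id :: nat \<Rightarrow> nat, map (\<lambda>(a, b). tr a b) ps))"
  have finB: "finite B" by (simp add: B_def)
  have fold: "foldr (mult (sym_group d)) (p # id # map (\<lambda>(a, b). tr a b) ps) (one (sym_group d)) = p \<circ> tprod ps" for p ps
  proof -
    have "foldr (\<circ>) (map (\<lambda>(a, b). tr a b) ps) id = tprod ps" by (induction ps) auto
    then show ?thesis unfolding sym_group_mult sym_group_one by simp
  qed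
  have monot: "monotone_transpositions d ts \<longleftrightarrow> (\<exists>ps \<in> mono_seqs B B (length ts). ts = map (\<lambda>(a, b). tr a b) ps)" for ts
  proof -
    have e: "ps \<in> mono_seqs B B (length ps) \<longleftrightarrow> (\<forall>(a, b)\<in>set ps. 1 \<le> a \<and> a < b \<and> b \<le> d) \<and> sorted (map snd ps)" for ps
      unfolding mono_seqs_def B_def by auto
    show ?thesis
    proof
      assume "monotone_transpositions d ts"
      then obtain ps where ps: "ts = map (\<lambda>(a, b). tr a b) ps"
        "(\<forall>(a, b)\<in>set ps. 1 \<le> a \<and> a < b \<and> b \<le> d) \<and> sorted (map snd ps)"
        unfolding monotone_transpositions_def by blast
      have len: "length ts = length ps" unfolding ps(1) by simp
      have "ps \<in> mono_seqs B B (length ts)" unfolding len using e[of ps] ps(2) by (rule iffD2)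
      then show "\<exists>ps\<in>mono_seqs B B (length ts). ts = map (\<lambda>(a, b). tr a b) ps" using ps(1) by blast
    next
      assume "\<exists>ps\<in>mono_seqs B B (length ts). ts = map (\<lambda>(a, b). tr a b) ps"
      then obtain ps where ps: "ps \<in> mono_seqs B B (length ts)" "ts = map (\<lambda>(a, b). tr a b) ps" by blast
      then have "ps \<in> mono_seqs B B (length ps)" by (simp only: length_map)
      then show "monotone_transpositions d ts" unfolding monotone_transpositions_def using e[of ps] ps(2) by blast
    qed
  qed
  have inv_iff: "p \<circ> t = id \<longleftrightarrow> t = inv' p" if "p permutes B" for p t
  proof
    assume "p \<circ> t = id"
    then have "inv' p \<circ> (p \<circ> t) = inv' p" by simp
    then show "t = inv' p" unfolding comp_assoc[symmetric] permutes_inv_o(2)[OF that] by simp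
  qed (simp add: permutes_inv_o(1)[OF that])
  have "monotone_hurwitz_tuples g \<alpha> = f ` Q"
  proof (rule Set.set_eqI)
    fix x :: "(nat \<Rightarrow> nat) \<times> (nat \<Rightarrow> nat) \<times> (nat \<Rightarrow> nat) list"
    obtain p s ts where x: "x = (p, s, ts)" by (cases x)
    show "x \<in> monotone_hurwitz_tuples g \<alpha> \<longleftrightarrow> x \<in> f ` Q"
    proof
      assume "x \<in> monotone_hurwitz_tuples g \<alpha>"
      then have t: "p permutes B" "ctype B p = mset \<alpha>" "s permutes {1..d}" "cycle_type_on d s = replicate_mset d 1"
        "monotone_transpositions d ts"
        "foldr (mult (sym_group d)) (p # s # ts) (one (sym_group d)) = one (sym_group d)"
        "transitive_on d (generate (sym_group d) ({p, s} \<union> set ts))"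
        "length ts + 2 = 2 * g + length \<alpha> + d"
        unfolding x monotone_hurwitz_tuples_def Let_def d_def[symmetric] B_def by (auto simp: cycle_type_on_eq)
      have s: "s = id" using cycle_type_one[OF t(3)] t(4) by blast
      obtain ps where ps: "ps \<in> mono_seqs B B (length ts)" "ts = map (\<lambda>(a, b). tr a b) ps" using t(5) monot by blast
      have len: "length ts = r" using t(8) r by (simp add: d_def)
      have prod: "p \<circ> tprod ps = id" using t(6)[unfolded s ps(2), unfolded fold] by (simp only: sym_group_one)
      have "conn B (uncut ps)"
        using t(7) transitive_iff_conn[OF t(1)[unfolded B_def] prod ps(1)[unfolded B_def]] unfolding s ps(2) B_def by blast
      then have "(p, ps) \<in> Q" using t(1,2) ps(1) prod inv_iff[OF t(1)] unfolding Q_def P_def len by simp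
      then show "x \<in> f ` Q" unfolding x s ps(2) by (rule rev_image_eqI) (simp add: f_def)
    next
      assume "x \<in> f ` Q"
      then obtain ps where ps: "(p, ps) \<in> Q" "s = id" "ts = map (\<lambda>(a, b). tr a b) ps" unfolding x f_def by auto
      have p: "p permutes B" "ctype B p = mset \<alpha>" "ps \<in> mono_seqs B B r" "tprod ps = inv' p" "conn B (uncut ps)"
        using ps(1) unfolding Q_def P_def by auto
      have prod: "p \<circ> tprod ps = id" using inv_iff[OF p(1)] p(4) by blast
      have len: "length ts = r" using mono_seqsD(1)[OF p(3)] ps(3) by simp
      have "transitive_on d (generate (sym_group d) ({p, s} \<union> set ts))"
        using p(5) transitive_iff_conn[OF p(1)[unfolded B_def] prod p(3)[unfolded B_def]] unfolding ps(2,3) B_def by blast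
      moreover have "monotone_transpositions d ts" unfolding monot len using p(3) ps(3) by blast
      moreover have "foldr (mult (sym_group d)) (p # s # ts) (one (sym_group d)) = one (sym_group d)"
        unfolding ps(2,3) unfolding fold prod by (simp only: sym_group_one)
      moreover have "s permutes {1..d}" unfolding ps(2) by (rule permutes_id)
      moreover from this have "cycle_type_on d s = replicate_mset d 1" using cycle_type_one ps(2) by blast
      moreover have "length ts + 2 = 2 * g + length \<alpha> + d" using len r by (simp add: d_def)
      moreover have "p permutes {1..d}" "cycle_type_on d p = mset \<alpha>" using p(1,2) by (simp_all add: B_def cycle_type_on_eq)
      ultimately show "x \<in> monotone_hurwitz_tuples g \<alpha>"
        unfolding x monotone_hurwitz_tuples_def Let_def d_def[symmetric] by simp
    qed
  qed
  moreover have "inj_on f Q"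
  proof (rule inj_onI)
    fix x y assume xy: "x \<in> Q" "y \<in> Q" "f x = f y"
    obtain p ps p' ps' where x: "x = (p, ps)" and y: "y = (p', ps')" by (cases x, cases y)
    have "p = p'" "map (\<lambda>(a, b). tr a b) ps = map (\<lambda>(a, b). tr a b) ps'" using xy(3) unfolding x y f_def by simp_all
    moreover have "set ps \<union> set ps' \<subseteq> {(a, b). a < b}"
      using xy(1,2) unfolding x y Q_def by (auto simp: mono_seqs_def)
    ultimately show "x = y"
      unfolding x y using map_inj_on[of "\<lambda>(a, b). tr a b" ps ps'] inj_on_subset[OF inj_on_tr] by blast
  qed
  ultimately have "monotone_hurwitz g \<alpha> = card Q" unfolding monotone_hurwitz_def by (simp only: card_image)
  also have "\<dots> = (\<Sum>p\<in>P. fact_count r B (inv' p))"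
  proof -
    have "finite P" unfolding P_def by (rule finite_subset[OF _ finite_permutations[OF finB]]) auto
    moreover have "\<forall>p\<in>P. finite {ps \<in> mono_seqs B B r. tprod ps = inv' p \<and> conn B (uncut ps)}"
      using finite_mono_seqs[OF finB finB] by simp
    ultimately show ?thesis unfolding Q_def fact_count_def by (rule card_SigmaI)
  qed
  also have "\<dots> = (\<Sum>p\<in>P. fact_number r (mset \<alpha>))"
  proof (rule sum.cong[OF refl])
    fix p assume "p \<in> P"
    then have p: "p permutes B" "ctype B p = mset \<alpha>" by (simp_all add: P_def)
    have perm: "permutation p" using permutes_permutation[OF finB p(1)] .
    have "B \<noteq> {}" using \<alpha> by (simp add: B_def d_def)
    then have "perm_on B (inv' p)" using finB permutes_inv[OF p(1)] by (simp add: perm_on_def)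
    moreover have "ctype B (inv' p) = mset \<alpha>"
      using p(2) unfolding ctype_def cycles_def orbit_inv_eq[OF perm] .
    ultimately show "fact_count r B (inv' p) = fact_number r (mset \<alpha>)" using fact_count_eq_fact_number[of B "inv' p" r] by simp
  qed
  finally show ?thesis unfolding P_def B_def d_def by simp
qed

section \<open>From the number of transpositions to the genus\<close>

lemma mset_eq_mset_on: "mset xs = image_mset ((!) xs) (mset_set {..<length xs})"
proof -
  have "mset xs = mset (map ((!) xs) [0..<length xs])" by (simp add: map_nth)
  then show ?thesis by (simp add: atLeast0LessThan)
qed

lemma sum_mset_on: "sum_mset (mset_on c S) = (\<Sum>j\<in>S. c j)"
  by (simp add: sum_unfold_sum_mset)

lemma card_sum_split:
  assumes "finite S" "I \<subseteq> S"
  shows "card I + card (S - I) = card S" "(\<Sum>j\<in>I. c j) + (\<Sum>j\<in>S - I. c j) = (\<Sum>j\<in>S. c j :: nat)"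
proof -
  have "finite I" using assms finite_subset by blast
  then show "card I + card (S - I) = card S" using assms by (simp add: card_Diff_subset card_mono)
  show "(\<Sum>j\<in>I. c j) + (\<Sum>j\<in>S - I. c j) = (\<Sum>j\<in>S. c j)"
    using sum.subset_diff[OF assms(2,1), of c] by simp
qed

text \<open>The Riemann-Hurwitz relation, read off the recursion: undoing a join keeps the genus,
  undoing a connected cut raises it by 1, and the two halves of a disconnected factorization add
  their genera.\<close>

lemma fact_number_nonzero:
  "fact_number r M \<noteq> 0 \<Longrightarrow> M \<noteq> {#} \<Longrightarrow> 0 \<notin># M \<Longrightarrow> \<exists>g. r + 2 = 2 * g + size M + sum_mset M"
proof (induction r arbitrary: M rule: less_induct)
  case (less r)
  show ?case
  proof (cases r)
    case 0
    then have "M = {#1#}" using less.prems fact_number_0[of M] by (simp split: if_splits)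
    then show ?thesis using 0 by simp
  next
    case (Suc r')
    obtain k M' where M: "M = add_mset k M'" using less.prems(2) by (cases M) auto
    obtain xs where "M' = mset xs" by (metis ex_mset)
    define c where "c = (!) xs"
    define S where "S = {..<length xs}"
    have M': "M' = mset_on c S" unfolding c_def S_def \<open>M' = mset xs\<close> by (rule mset_eq_mset_on)
    have S: "finite S" by (simp add: S_def)
    have k: "k > 0" using less.prems(3) M by auto
    have c: "c j > 0" if "j \<in> S" for j using less.prems(3) that S unfolding M M' by auto
    have card_sum: "size M = card S + 1" "sum_mset M = k + (\<Sum>j\<in>S. c j)"
      unfolding M M' by (simp_all add: sum_mset_on)
    have pos: "0 \<notin># add_mset i (mset_on c I)" if "i > 0" "I \<subseteq> S" for i I
    proof -
      have "finite I" using that(2) S by (rule finite_subset)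
      moreover have "c j \<noteq> 0" if "j \<in> I" for j using c[OF subsetD[OF \<open>I \<subseteq> S\<close> that]] by simp
      ultimately show ?thesis using that(1) by (auto simp: image_iff)
    qed
    have "rec_rhs r' k S c \<noteq> 0"
      using less.prems(1) fact_number_Suc[OF S k, of c r'] c unfolding Suc M M' by simp
    then consider (join) j where "j \<in> S" "fact_number r' (add_mset (k + c j) (mset_on c (S - {j}))) \<noteq> 0"
      | (cut) i where "i \<in> {1..<k}" "fact_number r' (add_mset i (add_mset (k - i) (mset_on c S))) \<noteq> 0"
      | (split) i I s where "i \<in> {1..<k}" "I \<subseteq> S" "s \<le> r'" "fact_number s (add_mset (k - i) (mset_on c I)) \<noteq> 0"
          "fact_number (r' - s) (add_mset i (mset_on c (S - I))) \<noteq> 0"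
    proof -
      have "rec_rhs r' k S c = 0"
        if j: "\<forall>j\<in>S. fact_number r' (add_mset (k + c j) (mset_on c (S - {j}))) = 0"
          and i: "\<forall>i\<in>{1..<k}. fact_number r' (add_mset i (add_mset (k - i) (mset_on c S))) = 0"
          and s: "\<forall>i\<in>{1..<k}. \<forall>I\<in>Pow S. \<forall>s\<in>{..r'}. fact_number s (add_mset (k - i) (mset_on c I)) *
            fact_number (r' - s) (add_mset i (mset_on c (S - I))) = 0"
      proof -
        have "(\<Sum>I\<in>Pow S. \<Sum>s\<le>r'. fact_number s (add_mset (k - i) (mset_on c I)) *
            fact_number (r' - s) (add_mset i (mset_on c (S - I)))) = 0" if "i \<in> {1..<k}" for i
          by (intro sum.neutral ballI) (use s that in blast)
        then show ?thesis unfolding rec_rhs_def using j i by simp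
      qed
      then have "(\<exists>j\<in>S. fact_number r' (add_mset (k + c j) (mset_on c (S - {j}))) \<noteq> 0) \<or>
        (\<exists>i\<in>{1..<k}. fact_number r' (add_mset i (add_mset (k - i) (mset_on c S))) \<noteq> 0) \<or>
        (\<exists>i\<in>{1..<k}. \<exists>I\<in>Pow S. \<exists>s\<in>{..r'}. fact_number s (add_mset (k - i) (mset_on c I)) *
            fact_number (r' - s) (add_mset i (mset_on c (S - I))) \<noteq> 0)"
        using \<open>rec_rhs r' k S c \<noteq> 0\<close> by blast
      then show ?thesis
      proof (elim disjE bexE)
        fix i I s assume "i \<in> {1..<k}" "I \<in> Pow S" "s \<in> {..r'}" "fact_number s (add_mset (k - i) (mset_on c I)) *
            fact_number (r' - s) (add_mset i (mset_on c (S - I))) \<noteq> 0"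
        then show ?thesis by (intro split[of i I s]) simp_all
      qed (use join cut in blast)+
    qed
    then show ?thesis
    proof cases
      case join
      have cs: "card {j} + card (S - {j}) = card S" "(\<Sum>i\<in>{j}. c i) + (\<Sum>i\<in>S - {j}. c i) = (\<Sum>i\<in>S. c i)"
        using card_sum_split[OF S, of "{j}"] join(1) by blast+
      obtain g where "r' + 2 = 2 * g + size (add_mset (k + c j) (mset_on c (S - {j}))) +
          sum_mset (add_mset (k + c j) (mset_on c (S - {j})))"
        using less.IH[of r' "add_mset (k + c j) (mset_on c (S - {j}))"] join pos[of "k + c j" "S - {j}"] k Suc by auto
      then have "Suc r' + 2 = 2 * g + size M + sum_mset M"
        unfolding card_sum using cs by (simp add: sum_mset_on)
      then show ?thesis unfolding Suc by blast
    next
      case cut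
      obtain g where "r' + 2 = 2 * g + size (add_mset i (add_mset (k - i) (mset_on c S))) +
          sum_mset (add_mset i (add_mset (k - i) (mset_on c S)))"
        using less.IH[of r' "add_mset i (add_mset (k - i) (mset_on c S))"] cut pos[of "k - i" S] Suc by auto
      then have "Suc r' + 2 = 2 * (g + 1) + size M + sum_mset M"
        unfolding card_sum using cut(1) by (simp add: sum_mset_on)
      then show ?thesis unfolding Suc by blast
    next
      case split
      obtain g where g: "s + 2 = 2 * g + size (add_mset (k - i) (mset_on c I)) +
          sum_mset (add_mset (k - i) (mset_on c I))"
        using less.IH[of s "add_mset (k - i) (mset_on c I)"] split pos[of "k - i" I] Suc by auto
      have "r' - s < r" using Suc by simp
      then obtain h where h: "r' - s + 2 = 2 * h + size (add_mset i (mset_on c (S - I))) +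
          sum_mset (add_mset i (mset_on c (S - I)))"
        using less.IH[of "r' - s" "add_mset i (mset_on c (S - I))"] split pos[of i "S - I"] Suc by auto
      have "Suc r' + 2 = 2 * (g + h) + size M + sum_mset M"
        unfolding card_sum using g h split(1,3) card_sum_split(1)[OF S split(2)] card_sum_split(2)[OF S split(2), of c] by (simp add: sum_mset_on)
      then show ?thesis unfolding Suc by blast
    qed
  qed
qed

text \<open>\<open>fact_number\<close> is meaningful only for types of permutations of nonempty
  sets. Elsewhere the value is 0, as the locale demands for a part of size 0.\<close>

definition genus_number :: "nat \<Rightarrow> nat multiset \<Rightarrow> rat" where
  "genus_number g M = (if M = {#} \<or> 0 \<in># M then 0 else of_nat (fact_number (2 * g + size M + sum_mset M - 2) M))"

lemma genus_number_eq:
  assumes "M \<noteq> {#}" "0 \<notin># M" "r + 2 = 2 * g + size M + sum_mset M"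
  shows "genus_number g M = of_nat (fact_number r M)"
proof -
  have "r = 2 * g + size M + sum_mset M - 2" using assms(3) by simp
  then show ?thesis using assms(1,2) by (simp add: genus_number_def)
qed

text \<open>A distribution of the transpositions contributes only if both factors have a natural
  number as genus; the two offsets 2 of the genus relation add up to the 4.\<close>

lemma genus_number_convolution:
  assumes M: "M \<noteq> {#}" "0 \<notin># M" and N: "N \<noteq> {#}" "0 \<notin># N"
    and r: "r + 4 = 2 * g + size M + sum_mset M + size N + sum_mset N"
  shows "(\<Sum>s\<le>r. of_nat (fact_number s M * fact_number (r - s) N)) = (\<Sum>h\<le>g. genus_number h M * genus_number (g - h) N)"
proof -
  define e where "e = (\<lambda>M :: nat multiset. size M + sum_mset M)"
  have ge: "e M \<ge> 2" if "M \<noteq> {#}" "0 \<notin># M" for M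
  proof -
    obtain k M' where "M = add_mset k M'" using \<open>M \<noteq> {#}\<close> by (cases M) auto
    then show ?thesis using that(2) by (cases k) (auto simp: e_def)
  qed
  let ?s = "\<lambda>h. 2 * h + e M - 2"
  have eM: "e M \<ge> 2" and eN: "e N \<ge> 2" using ge M N by blast+
  have r': "r + 4 = 2 * g + e M + e N" using r by (simp add: e_def)
  have "(\<Sum>h\<le>g. genus_number h M * genus_number (g - h) N) = (\<Sum>h\<le>g. of_nat (fact_number (?s h) M * fact_number (r - ?s h) N))"
  proof (rule sum.cong[OF refl])
    fix h assume h: "h \<in> {..g}"
    have "genus_number h M = of_nat (fact_number (?s h) M)" using eM by (intro genus_number_eq[OF M]) (simp add: e_def)
    moreover have "genus_number (g - h) N = of_nat (fact_number (r - ?s h) N)"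
      using eM eN r' h by (intro genus_number_eq[OF N]) (simp add: e_def)
    ultimately show "genus_number h M * genus_number (g - h) N = of_nat (fact_number (?s h) M * fact_number (r - ?s h) N)" by simp
  qed
  also have "\<dots> = (\<Sum>s\<in>?s ` {..g}. of_nat (fact_number s M * fact_number (r - s) N))"
    using eM by (subst sum.reindex) (auto simp: inj_on_def)
  also have "\<dots> = (\<Sum>s\<le>r. of_nat (fact_number s M * fact_number (r - s) N))"
  proof (rule sum.mono_neutral_left)
    show "?s ` {..g} \<subseteq> {..r}" using eM eN r' by auto
    show "\<forall>s\<in>{..r} - ?s ` {..g}. of_nat (fact_number s M * fact_number (r - s) N) = (0 :: rat)"
    proof (rule ballI, rule ccontr)
      fix s assume s: "s \<in> {..r} - ?s ` {..g}" and "of_nat (fact_number s M * fact_number (r - s) N) \<noteq> (0 :: rat)"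
      then have "fact_number s M \<noteq> 0" "fact_number (r - s) N \<noteq> 0" by auto
      then obtain h h' where h: "s + 2 = 2 * h + e M" "r - s + 2 = 2 * h' + e N"
        using fact_number_nonzero[OF _ M] fact_number_nonzero[OF _ N] unfolding e_def add.assoc by blast
      have "h \<le> g" "s = ?s h" using h r' s eM by auto
      then show False using s by blast
    qed
  qed simp
  finally show ?thesis by (rule sym)
qed

interpretation cut_join genus_number
proof
  show "genus_number g M = 0" if "0 \<in># M" for g M using that by (simp add: genus_number_def)
next
  fix k g :: nat and S :: "nat set" and a :: "nat \<Rightarrow> nat"
  assume k: "k > 0" and S: "finite S" and a: "\<forall>j\<in>S. a j > 0"
  let ?M = "\<lambda>I. mset_on a I"
  let ?d = "k + (\<Sum>j\<in>S. a j)"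
  have pos: "0 \<notin># add_mset i (?M I)" if "i > 0" "I \<subseteq> S" for i I
  proof -
    have "finite I" using that(2) S by (rule finite_subset)
    moreover have "a j \<noteq> 0" if "j \<in> I" for j using a subsetD[OF \<open>I \<subseteq> S\<close> that] by auto
    ultimately show ?thesis using that(1) by (auto simp: image_iff)
  qed
  show "genus_number g (add_mset k (?M S)) =
        (if g = 0 \<and> S = {} \<and> k = 1 then 1 else 0)
        + (\<Sum>j\<in>S. of_nat (a j) * genus_number g (add_mset (k + a j) (?M (S - {j}))))
        + (\<Sum>i\<in>{1..<k}. (if g = 0 then 0 else genus_number (g - 1) (add_mset i (add_mset (k - i) (?M S))))
            + (\<Sum>(I, h)\<in>Pow S \<times> {..g}. genus_number h (add_mset i (?M I)) * genus_number (g - h) (add_mset (k - i) (?M (S - I)))))"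
  proof (cases "g = 0 \<and> S = {} \<and> k = 1")
    case True
    then show ?thesis using genus_number_eq[of "{#1#}" 0 0] fact_number_0[of "{#1#}"] by simp
  next
    case False
    have big: "2 * g + card S + 1 + ?d \<ge> 3"
    proof (cases "S = {}")
      case False
      then have "card S > 0" using S card_gt_0_iff by blast
      then show ?thesis using k by simp
    qed (use \<open>\<not> (g = 0 \<and> S = {} \<and> k = 1)\<close> k in auto)
    \<comment> \<open>\<open>Suc r\<close> is the number of transpositions, which is positive
      outside the initial case.\<close>
    define r where "r = 2 * g + card S + 1 + ?d - 3"
    have r: "r + 3 = 2 * g + card S + 1 + ?d" using big by (simp add: r_def)
    have "genus_number g (add_mset k (?M S)) = of_nat (fact_number (Suc r) (add_mset k (?M S)))"
      using pos[of k S] k r by (intro genus_number_eq) (simp_all add: sum_mset_on)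
    also have "\<dots> = of_nat (rec_rhs r k S a)" using fact_number_Suc[OF S k a] by simp
    also have "\<dots> = (\<Sum>j\<in>S. of_nat (a j) * of_nat (fact_number r (add_mset (k + a j) (?M (S - {j}))))) +
      ((\<Sum>i\<in>{1..<k}. of_nat (fact_number r (add_mset i (add_mset (k - i) (?M S))))) +
       (\<Sum>i\<in>{1..<k}. \<Sum>I\<in>Pow S. \<Sum>s\<le>r. of_nat (fact_number s (add_mset (k - i) (?M I)) * fact_number (r - s) (add_mset i (?M (S - I))))))"
      unfolding rec_rhs_def by (simp add: sum.distrib)
    also have "(\<Sum>j\<in>S. of_nat (a j) * of_nat (fact_number r (add_mset (k + a j) (?M (S - {j}))))) =
      (\<Sum>j\<in>S. of_nat (a j) * genus_number g (add_mset (k + a j) (?M (S - {j}))))"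
    proof (rule sum.cong[OF refl])
      fix j assume j: "j \<in> S"
      have cs: "card {j} + card (S - {j}) = card S" "(\<Sum>i\<in>{j}. a i) + (\<Sum>i\<in>S - {j}. a i) = (\<Sum>i\<in>S. a i)"
        using card_sum_split[OF S, of "{j}"] j by blast+
      have "genus_number g (add_mset (k + a j) (?M (S - {j}))) = of_nat (fact_number r (add_mset (k + a j) (?M (S - {j}))))"
        using pos[of "k + a j" "S - {j}"] k r cs by (intro genus_number_eq) (auto simp: sum_mset_on)
      then show "of_nat (a j) * of_nat (fact_number r (add_mset (k + a j) (?M (S - {j})))) = of_nat (a j) * genus_number g (add_mset (k + a j) (?M (S - {j})))"
        by simp
    qed
    also have "(\<Sum>i\<in>{1..<k}. of_nat (fact_number r (add_mset i (add_mset (k - i) (?M S))))) =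
      (\<Sum>i\<in>{1..<k}. if g = 0 then 0 else genus_number (g - 1) (add_mset i (add_mset (k - i) (?M S))))"
    proof (rule sum.cong[OF refl])
      fix i assume i: "i \<in> {1..<k}"
      let ?N = "add_mset i (add_mset (k - i) (?M S))"
      have N: "?N \<noteq> {#}" "0 \<notin># ?N" using pos[of "k - i" S] i by auto
      have size: "size ?N + sum_mset ?N = card S + 2 + ?d" using i by (simp add: sum_mset_on)
      show "of_nat (fact_number r ?N) = (if g = 0 then 0 else genus_number (g - 1) ?N)"
      proof (cases "g = 0")
        case True
        \<comment> \<open>A nonzero value would need genus -1.\<close>
        have "fact_number r ?N = 0"
        proof (rule ccontr)
          assume "fact_number r ?N \<noteq> 0"
          then obtain h where "r + 2 = 2 * h + size ?N + sum_mset ?N" using fact_number_nonzero[OF _ N] by blast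
          then show False using size r True by linarith
        qed
        then show ?thesis using True by simp
      next
        case False
        have "genus_number (g - 1) ?N = of_nat (fact_number r ?N)" using size r False by (intro genus_number_eq[OF N]) linarith
        then show ?thesis using False by simp
      qed
    qed
    \<comment> \<open>Reflection of i: \<open>rec_rhs\<close> puts k - i together with I, the locale
      puts i there.\<close>
    also have "(\<Sum>i\<in>{1..<k}. \<Sum>I\<in>Pow S. \<Sum>s\<le>r. of_nat (fact_number s (add_mset (k - i) (?M I)) * fact_number (r - s) (add_mset i (?M (S - I))))) =
      (\<Sum>i\<in>{1..<k}. \<Sum>I\<in>Pow S. \<Sum>s\<le>r. of_nat (fact_number s (add_mset i (?M I)) * fact_number (r - s) (add_mset (k - i) (?M (S - I)))))"
      by (rule sum.reindex_bij_witness[of _ "\<lambda>i. k - i" "\<lambda>i. k - i"]) auto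
    also have "\<dots> = (\<Sum>i\<in>{1..<k}. \<Sum>I\<in>Pow S. \<Sum>h\<le>g. genus_number h (add_mset i (?M I)) * genus_number (g - h) (add_mset (k - i) (?M (S - I))))"
    proof (rule sum.cong[OF refl], rule sum.cong[OF refl], rule genus_number_convolution)
      fix i I assume i: "i \<in> {1..<k}" and I: "I \<in> Pow S"
      show "0 \<notin># add_mset i (?M I)" "0 \<notin># add_mset (k - i) (?M (S - I))"
        using pos[of i I] pos[of "k - i" "S - I"] i I by auto
      show "r + 4 = 2 * g + size (add_mset i (?M I)) + sum_mset (add_mset i (?M I)) +
        size (add_mset (k - i) (?M (S - I))) + sum_mset (add_mset (k - i) (?M (S - I)))"
        using r i card_sum_split(1)[OF S, of I] card_sum_split(2)[OF S, of I a] I by (simp add: sum_mset_on)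
    qed simp_all
    finally show ?thesis using False by (simp add: sum.distrib sum.cartesian_product)
  qed
qed

lemma zprod_mset: "zprod (mset xs) = aut_order xs * (\<Prod>j<length xs. xs ! j)"
proof -
  have "zprod (mset xs) = (\<Prod>k\<in>set xs. k ^ count (mset xs) k) * (\<Prod>k\<in>set xs. fact (count (mset xs) k))"
    unfolding zprod_def prod.distrib by simp
  also have "(\<Prod>k\<in>set xs. k ^ count (mset xs) k) = prod_mset (mset xs)"
    unfolding prod_mset_multiplicity by simp
  also have "\<dots> = (\<Prod>j<length xs. xs ! j)"
    by (subst mset_eq_mset_on) (simp only: prod_unfold_prod_mset)
  also have "(\<Prod>k\<in>set xs. fact (count (mset xs) k)) = aut_order xs"
    unfolding aut_order_def count_mset ..
  finally show ?thesis by (simp only: mult.commute)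
qed

theorem theorem1p5:
  fixes g l :: nat
  assumes "l \<ge> 1" and "(g, l) \<notin> {(0, 1), (0, 2)}"
  shows "\<exists>P :: rat mpolynomial. in_variables l P \<and>
    (\<forall>d \<alpha>. d \<ge> 1 \<longrightarrow> partition_of \<alpha> d \<longrightarrow> length \<alpha> = l \<longrightarrow>
       of_nat (monotone_hurwitz g \<alpha>) =
         fact d / of_nat (aut_order \<alpha>)
         * eval_mpolynomial P (\<lambda>j. of_nat (\<alpha> ! j))
         * (\<Prod>j<l. of_nat ((2 * \<alpha> ! j) choose (\<alpha> ! j))))"
proof -
  \<comment> \<open>Label 0 is the distinguished part; the excluded pairs are those with 2g + card S
    < 2.\<close>
  let ?S = "{1..<l}"
  have ins: "insert 0 ?S = {..<l}" using assms(1) by auto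
  have "2 * g + card ?S \<ge> 2" using assms by (cases g) auto
  then have "poly_V 0 g ?S" by (intro poly_V) simp_all
  then obtain p where p: "polyfun {..<l} p"
    and V: "\<And>a. \<forall>j\<in>?S. a j > 0 \<Longrightarrow> V 0 g ?S a = of_nat (a 0) * cbin (a 0) * wt ?S a * p (ev a)"
    unfolding poly_V_def ins by blast
  obtain P where P: "in_variables l P" "\<And>x. eval_mpolynomial P x = p x"
    using polyfun_mpolynomial[OF p] by blast
  have "of_nat (monotone_hurwitz g \<alpha>) = fact d / of_nat (aut_order \<alpha>) * eval_mpolynomial P (\<lambda>j. of_nat (\<alpha> ! j))
    * (\<Prod>j<l. cbin (\<alpha> ! j))" if d: "d \<ge> 1" and \<alpha>: "partition_of \<alpha> d" and l: "length \<alpha> = l" for d \<alpha>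
  proof -
    let ?a = "(!) \<alpha>"
    let ?M = "mset \<alpha>"
    have pos: "\<forall>x\<in>set \<alpha>. x > 0" and sum: "sum_list \<alpha> = d" using \<alpha> unfolding partition_of_def by auto
    have M: "?M \<noteq> {#}" "0 \<notin># ?M" using pos l assms(1) by auto
    have a_pos: "\<forall>j\<in>?S. ?a j > 0" using pos l by auto
    have sum_M: "sum_mset ?M = d" using sum by (simp add: sum_mset_sum_list)
    define r where "r = 2 * g + l + d - 2"
    have r: "r + 2 = 2 * g + l + d" using d assms(1) by (simp add: r_def)
    have "mset \<alpha> = image_mset ?a (mset_set (insert 0 ?S))" using mset_eq_mset_on[of \<alpha>] l ins by simp
    then have "V 0 g ?S ?a = genus_number g ?M" unfolding V_def by simp
    also have "\<dots> = of_nat (fact_number r ?M)" using r l sum_M by (intro genus_number_eq[OF M]) simp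
    finally have "of_nat (fact_number r ?M) = of_nat (?a 0) * cbin (?a 0) * wt ?S ?a * p (ev ?a)"
      using V[OF a_pos] by (simp only:)
    also have "of_nat (?a 0) * cbin (?a 0) * wt ?S ?a = (\<Prod>j<l. of_nat (?a j) * cbin (?a j))"
      unfolding wt_def ins[symmetric] by (subst prod.insert) simp_all
    finally have W: "of_nat (fact_number r ?M) = (\<Prod>j<l. of_nat (?a j)) * (\<Prod>j<l. cbin (?a j)) * p (ev ?a)"
      unfolding prod.distrib .
    let ?N = "card (perms_of_type {1..d} ?M)"
    have H: "monotone_hurwitz g \<alpha> = ?N * fact_number r ?M"
      using monotone_hurwitz_eq[of \<alpha> r g] d r l sum unfolding perms_of_type_def by simp
    have "?N * zprod ?M = fact d"
      using card_perms_of_type[of "{1..d}" ?M] M(2) sum_M by simp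
    then have "of_nat (?N * (aut_order \<alpha> * (\<Prod>j<l. ?a j))) = (fact d :: rat)"
      unfolding zprod_mset l by (simp only: of_nat_fact)
    then have N: "of_nat ?N * (of_nat (aut_order \<alpha>) * (\<Prod>j<l. of_nat (?a j))) = (fact d :: rat)"
      by (simp only: of_nat_mult of_nat_prod)
    have aut: "of_nat (aut_order \<alpha>) \<noteq> (0 :: rat)" by (simp add: aut_order_def)
    \<comment> \<open>The product of the parts by which the centralizer order exceeds |Aut| is
      absorbed by the factors \<open>of_nat (?a j)\<close> in \<open>W\<close>.\<close>
    have "fact d / of_nat (aut_order \<alpha>) = of_nat ?N * (\<Prod>j<l. of_nat (?a j) :: rat)"
      unfolding N[symmetric] using aut by simp
    then show ?thesis unfolding H of_nat_mult W P(2) by (simp only: mult_ac)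
  qed
  then show ?thesis using P(1) by blast
qed

end
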